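(* Let $p(y_1,y_2|x_1,x_2)=p(y_1|x_1)\,p(y_2|x_1,x_2)$ be a discrete memoryless Z-interference channel satisfying Conditions 1 and 2 (stated in the context), with $p^*(x_2)$ the distribution from Condition 2. Let $U_1,U_2$ be independent sources on finite alphabets, let $V_1=h_1(U_1)$, for a deterministic function $h_1$, be available as side information at Receiver 2, and let Receiver 1 have no side information ($V_2=\emptyset$). Then necessary and sufficient conditions for reliable transmission of $(U_1,U_2)$ are \begin{align*} H(U_1) &< I(X_1;Y_1),\\ H(U_2) &< I(W,X_2;Y_2),\\ H(U_1|V_1)+H(U_2) &< I(W,X_2;Y_2)+I(X_1;Y_1|W) \end{align*} for some $p(w)p(x_1|w)$, where the mutual informations and entropies are evaluated with $$p(u_1,v_1,u_2,w,x_1,x_2,y_1,y_2)=p(u_1,v_1)\,p(u_2)\,p(w)\,p(x_1|w)\,p^*(x_2)\,p(y_1|x_1)\,p(y_2|x_1,x_2).$$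
   Context: Channel: finite input alphabets $\mathcal{X}_1,\mathcal{X}_2$ and finite output alphabets $\mathcal{Y}_1,\mathcal{Y}_2$; $n$ uses of the channel are governed by the product law, e.g. $p(y_2^n|x_1^n,x_2^n)=\prod_{i=1}^n p(y_{2,i}|x_{1,i},x_{2,i})$. Notation: $A^n=(A_1,\dots,A_n)$. $W$ is an auxiliary random variable. Condition 1: for every positive integer $n$ and every distribution $p(x_1^n)$ on $\mathcal{X}_1^n$, the entropy $H(Y_2^n|X_2^n=x_2^n)$, evaluated with the distribution $\sum_{x_1^n}p(x_1^n)p(y_2^n|x_1^n,x_2^n)$ of $Y_2^n$, does not depend on $x_2^n\in\mathcal{X}_2^n$. Condition 2: let $\tau=\max_{p(x_1)p(x_2)}H(Y_2)$. There exists a distribution $p^*(x_2)$ on $\mathcal{X}_2$ such that $H(Y_2)$, evaluated with the distribution $\sum_{x_1,x_2}p(x_1)p^*(x_2)p(y_2|x_1,x_2)$, equals $\tau$ for every $p(x_1)$. Sources and codes: $(U_{1,i},U_{2,i})_{i\ge1}$ are i.i.d. with law $p(u_1)p(u_2)$ on the finite alphabet $\mathcal{U}_1\times\mathcal{U}_2$, and $V_{1,i}=h_1(U_{1,i})\in\mathcal{V}_1$; $p(u_1,v_1)$ denotes the joint law of $(U_1,V_1)$. Transmitter $k$ sends $X_k^n=f_k^n(U_k^n)$ with $f_k^n:\mathcal{U}_k^n\to\mathcal{X}_k^n$, $k=1,2$. Receiver 1 outputs $\hat U_1^n=g_1^n(Y_1^n)$ and Receiver 2 outputs $\hat U_2^n=g_2^n(Y_2^n,V_1^n)$,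 with values in $\mathcal{U}_1^n$ and $\mathcal{U}_2^n$ respectively. The error probability is $P_e^n=\Pr\{(U_1^n,U_2^n)\ne(\hat U_1^n,\hat U_2^n)\}$. Reliable transmission of $(U_1,U_2)$ means that there is a sequence $(f_1^n,f_2^n,g_1^n,g_2^n)$ with $P_e^n\to0$ as $n\to\infty$.
   Formalization: Sufficiency is proved with the strict inequalities, but necessity only with "≤" in place of "<", because strict necessity is false at the boundary (e.g. all alphabets singletons: zero error, yet 0 < 0 fails). W ranges over finite alphabets. *)

theory Defs
  imports "HOL-Probability.Probability"
begin

text \<open>
  Alphabets are types of class \<open>finite\<close>, probability laws are \<open>pmf\<close>s, and a sequence
  $a^n = (a_1,\dots,a_n)$ is a list of length \<open>n\<close>.
\<close>

section \<open>Information measures\<close>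

text \<open>
  These are the notions of \<open>HOL-Probability.Information\<close> to base 2 for discrete random variables
  on the probability space \<open>P\<close>. Every range is measured by \<open>count_space UNIV\<close>, which is
  sigma-finite because the value types are countable.
\<close>

definition H :: "'a pmf \<Rightarrow> ('a \<Rightarrow> 'b::countable) \<Rightarrow> real" where
  "H P X = prob_space.entropy (measure_pmf P) 2 (count_space UNIV) X"

definition H_cond :: "'a pmf \<Rightarrow> ('a \<Rightarrow> 'b::countable) \<Rightarrow> ('a \<Rightarrow> 'c::countable) \<Rightarrow> real" where
  "H_cond P X Y =
     prob_space.conditional_entropy (measure_pmf P) 2 (count_space UNIV) (count_space UNIV) X Y"

definition I :: "'a pmf \<Rightarrow> ('a \<Rightarrow> 'b::countable) \<Rightarrow> ('a \<Rightarrow> 'c::countable) \<Rightarrow> real" where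
  "I P X Y =
     prob_space.mutual_information (measure_pmf P) 2 (count_space UNIV) (count_space UNIV) X Y"

definition I_cond ::
  "'a pmf \<Rightarrow> ('a \<Rightarrow> 'b::countable) \<Rightarrow> ('a \<Rightarrow> 'c::countable) \<Rightarrow> ('a \<Rightarrow> 'd::countable) \<Rightarrow> real" where
  "I_cond P X Y Z =
     prob_space.conditional_mutual_information (measure_pmf P) 2
       (count_space UNIV) (count_space UNIV) (count_space UNIV) X Y Z"

lemma H_eq_sum:
  fixes P :: "'a::countable pmf"
  assumes "finite (set_pmf P)"
  shows "H P (\<lambda>x. x) = - (\<Sum>x\<in>set_pmf P. pmf P x * log 2 (pmf P x))"
proof -
  interpret information_space "measure_pmf P" 2
    by unfold_locales simp
  have d: "distributed (measure_pmf P) (count_space UNIV) (\<lambda>x. x) (\<lambda>x. ennreal (pmf P x))"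
    unfolding distributed_def
    by (simp add: measure_pmf_eq_density[symmetric] distr_id2)
  have "(\<integral>x. pmf P x * log 2 (pmf P x) \<partial>count_space UNIV)
      = (\<Sum>x\<in>set_pmf P. pmf P x * log 2 (pmf P x))"
  proof -
    have "(\<Sum>a | a \<in> UNIV \<and> pmf P a * log 2 (pmf P a) \<noteq> 0. pmf P a * log 2 (pmf P a))
        = (\<Sum>x\<in>set_pmf P. pmf P x * log 2 (pmf P x))"
      using assms by (intro sum.mono_neutral_left) (auto simp: set_pmf_iff)
    moreover have "finite {a. pmf P a * log 2 (pmf P a) \<noteq> 0}"
      by (rule finite_subset[OF _ assms]) (auto simp: set_pmf_iff)
    ultimately show ?thesis
      by (subst lebesgue_integral_count_space_finite_support) auto
  qed
  then show ?thesis
    unfolding H_def by (subst entropy_distr[OF d]) auto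
qed

lemma H_le_log_card:
  fixes P :: "'a::finite pmf"
  shows "H P (\<lambda>x. x) \<le> log 2 (real CARD('a))"
proof -
  interpret information_space "measure_pmf P" 2
    by unfold_locales simp
  have "simple_distributed (measure_pmf P) (\<lambda>x. x) (\<lambda>x. measure_pmf.prob P {y. y = x})"
    by (simp add: simple_distributed_def simple_function_def distributed_def distr_id2 measure_pmf_eq_density[symmetric] measure_pmf_single)
  from entropy_le_card[OF this] show ?thesis
    unfolding H_def by simp
qed

section \<open>Memoryless channels\<close>

text \<open>Law of the outputs of the \<open>n\<close>-fold use of a channel on input sequences of length \<open>n\<close>.\<close>

definition memoryless ::
  "nat \<Rightarrow> ('x1 \<Rightarrow> 'x2 \<Rightarrow> 'y pmf) \<Rightarrow> 'x1 list \<Rightarrow> 'x2 list \<Rightarrow> 'y list pmf" where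
  "memoryless n q xs1 xs2 =
     map_pmf (\<lambda>y. map y [0..<n]) (Pi_pmf {..<n} undefined (\<lambda>i. q (xs1 ! i) (xs2 ! i)))"

lemma pmf_memoryless:
  assumes "length ys = n"
  shows "pmf (memoryless n q xs1 xs2) ys = (\<Prod>i<n. pmf (q (xs1 ! i) (xs2 ! i)) (ys ! i))"
proof -
  let ?p = "Pi_pmf {..<n} undefined (\<lambda>i. q (xs1 ! i) (xs2 ! i))"
  let ?f = "\<lambda>i. if i < n then ys ! i else undefined"
  have "pmf (memoryless n q xs1 xs2) ys = measure_pmf.prob ?p ((\<lambda>y. map y [0..<n]) -` {ys})"
    by (simp add: memoryless_def pmf_map)
  also have "\<dots> = measure_pmf.prob ?p {?f}"
  proof (rule measure_pmf.finite_measure_eq_AE)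
    show "AE y in measure_pmf ?p. (y \<in> (\<lambda>y. map y [0..<n]) -` {ys}) = (y \<in> {?f})"
      using set_Pi_pmf_subset[of "{..<n}" undefined "\<lambda>i. q (xs1 ! i) (xs2 ! i)"] assms
      by (auto simp: AE_measure_pmf_iff list_eq_iff_nth_eq fun_eq_iff)
  qed auto
  also have "\<dots> = (\<Prod>i<n. pmf (q (xs1 ! i) (xs2 ! i)) (ys ! i))"
    by (simp add: measure_pmf_single) (subst pmf_Pi', auto)
  finally show ?thesis .
qed

text \<open>
  Output law when the first input sequence has law \<open>p\<close> and the second one is \<open>xs2\<close>. The condition
  concerns the marginal channel \<open>q2\<close> to the second output.
\<close>

definition condition1 :: "('x1::finite \<Rightarrow> 'x2::finite \<Rightarrow> 'y2::finite pmf) \<Rightarrow> bool" where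
  "condition1 q2 \<longleftrightarrow>
     (\<forall>n\<ge>1. \<forall>p :: 'x1 list pmf. set_pmf p \<subseteq> {xs. length xs = n} \<longrightarrow>
        (\<forall>xs2 xs2'. length xs2 = n \<longrightarrow> length xs2' = n \<longrightarrow>
           H (bind_pmf p (\<lambda>xs1. memoryless n q2 xs1 xs2)) (\<lambda>ys2. ys2) =
           H (bind_pmf p (\<lambda>xs1. memoryless n q2 xs1 xs2')) (\<lambda>ys2. ys2)))"

definition output_law :: "('x1 \<Rightarrow> 'x2 \<Rightarrow> 'y pmf) \<Rightarrow> 'x1 pmf \<Rightarrow> 'x2 pmf \<Rightarrow> 'y pmf" where
  "output_law q p1 p2 = do {x1 \<leftarrow> p1; x2 \<leftarrow> p2; q x1 x2}"

definition max_output_entropy :: "('x1::finite \<Rightarrow> 'x2::finite \<Rightarrow> 'y2::finite pmf) \<Rightarrow> real" where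
  "max_output_entropy q2 = (SUP (p1, p2). H (output_law q2 p1 p2) (\<lambda>y2. y2))"

text \<open>The supremum is one of a nonempty set of reals that is bounded:\<close>

lemma bdd_above_output_entropy:
  fixes q2 :: "'x1::finite \<Rightarrow> 'x2::finite \<Rightarrow> 'y2::finite pmf"
  shows "bdd_above (range (\<lambda>(p1, p2). H (output_law q2 p1 p2) (\<lambda>y2. y2)))"
  by (rule bdd_aboveI[of _ "log 2 (real CARD('y2))"]) (auto intro: H_le_log_card)

text \<open>
  The second condition on the channel says that some \<open>pstar\<close> satisfies the following predicate; for
  such \<open>pstar\<close> the supremum is attained, so that it is a maximum.
\<close>

definition condition2_witness ::
  "('x1::finite \<Rightarrow> 'x2::finite \<Rightarrow> 'y2::finite pmf) \<Rightarrow> 'x2 pmf \<Rightarrow> bool" where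
  "condition2_witness q2 pstar \<longleftrightarrow>
     (\<forall>p1. H (output_law q2 p1 pstar) (\<lambda>y2. y2) = max_output_entropy q2)"

section \<open>Transmission of independent sources with side information at Receiver 2\<close>

text \<open>Joint law of $(U_1^n, U_2^n, Y_1^n, Y_2^n)$ induced by the encoders \<open>f1\<close>, \<open>f2\<close>.\<close>

definition code_law ::
  "nat \<Rightarrow> ('x1 \<Rightarrow> 'x2 \<Rightarrow> ('y1 \<times> 'y2) pmf) \<Rightarrow> 'u1 pmf \<Rightarrow> 'u2 pmf \<Rightarrow>
   ('u1 list \<Rightarrow> 'x1 list) \<Rightarrow> ('u2 list \<Rightarrow> 'x2 list) \<Rightarrow>
   ('u1 list \<times> 'u2 list \<times> 'y1 list \<times> 'y2 list) pmf" where
  "code_law n ch pU1 pU2 f1 f2 = do {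
     us1 \<leftarrow> replicate_pmf n pU1;
     us2 \<leftarrow> replicate_pmf n pU2;
     ys \<leftarrow> memoryless n ch (f1 us1) (f2 us2);
     return_pmf (us1, us2, map fst ys, map snd ys)}"

definition error_prob ::
  "nat \<Rightarrow> ('x1 \<Rightarrow> 'x2 \<Rightarrow> ('y1 \<times> 'y2) pmf) \<Rightarrow> 'u1 pmf \<Rightarrow> ('u1 \<Rightarrow> 'v1) \<Rightarrow> 'u2 pmf \<Rightarrow>
   ('u1 list \<Rightarrow> 'x1 list) \<Rightarrow> ('u2 list \<Rightarrow> 'x2 list) \<Rightarrow>
   ('y1 list \<Rightarrow> 'u1 list) \<Rightarrow> ('y2 list \<Rightarrow> 'v1 list \<Rightarrow> 'u2 list) \<Rightarrow> real" where
  "error_prob n ch pU1 h1 pU2 f1 f2 g1 g2 =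
     measure_pmf.prob (code_law n ch pU1 pU2 f1 f2)
       {(us1, us2, ys1, ys2). (us1, us2) \<noteq> (g1 ys1, g2 ys2 (map h1 us1))}"

definition reliable_transmission ::
  "('x1::finite \<Rightarrow> 'x2::finite \<Rightarrow> ('y1::finite \<times> 'y2::finite) pmf) \<Rightarrow>
   'u1::finite pmf \<Rightarrow> ('u1 \<Rightarrow> 'v1::finite) \<Rightarrow> 'u2::finite pmf \<Rightarrow> bool" where
  "reliable_transmission ch pU1 h1 pU2 \<longleftrightarrow>
     (\<exists>(f1 :: nat \<Rightarrow> 'u1 list \<Rightarrow> 'x1 list) (f2 :: nat \<Rightarrow> 'u2 list \<Rightarrow> 'x2 list)
       (g1 :: nat \<Rightarrow> 'y1 list \<Rightarrow> 'u1 list) (g2 :: nat \<Rightarrow> 'y2 list \<Rightarrow> 'v1 list \<Rightarrow> 'u2 list).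
        (\<forall>n us1. length us1 = n \<longrightarrow> length (f1 n us1) = n) \<and>
        (\<forall>n us2. length us2 = n \<longrightarrow> length (f2 n us2) = n) \<and>
        (\<forall>n ys1. length ys1 = n \<longrightarrow> length (g1 n ys1) = n) \<and>
        (\<forall>n ys2 vs1. length ys2 = n \<longrightarrow> length vs1 = n \<longrightarrow> length (g2 n ys2 vs1) = n) \<and>
        (\<lambda>n. error_prob n ch pU1 h1 pU2 (f1 n) (f2 n) (g1 n) (g2 n)) \<longlonglongrightarrow> 0)"

section \<open>Single-letter variables\<close>

datatype ('u1, 'v1, 'u2, 'w, 'x1, 'x2, 'y1, 'y2) letter =
  Letter (U1: 'u1) (V1: 'v1) (U2: 'u2) (W: 'w) (X1: 'x1) (X2: 'x2) (Y1: 'y1) (Y2: 'y2)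

definition single_letter_law ::
  "('x1 \<Rightarrow> 'y1 pmf) \<Rightarrow> ('x1 \<Rightarrow> 'x2 \<Rightarrow> 'y2 pmf) \<Rightarrow> 'u1 pmf \<Rightarrow> ('u1 \<Rightarrow> 'v1) \<Rightarrow> 'u2 pmf \<Rightarrow>
   'w pmf \<Rightarrow> ('w \<Rightarrow> 'x1 pmf) \<Rightarrow> 'x2 pmf \<Rightarrow>
   ('u1, 'v1, 'u2, 'w, 'x1, 'x2, 'y1, 'y2) letter pmf" where
  "single_letter_law q1 q2 pU1 h1 pU2 pW pX1W pX2 = do {
     u1 \<leftarrow> pU1; u2 \<leftarrow> pU2; w \<leftarrow> pW; x1 \<leftarrow> pX1W w; x2 \<leftarrow> pX2;
     y1 \<leftarrow> q1 x1; y2 \<leftarrow> q2 x1 x2;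
     return_pmf (Letter u1 (h1 u1) u2 w x1 x2 y1 y2)}"

end

theory Submission
  imports Defs
begin

text \<open>
  Converse. Fano's inequality leaves differences $H(Y_1^n|V_1^n) - H(Y_2^n|U_2^n,V_1^n)$. Since the two
  sources are independent, Condition 1 allows one to replace the second input by a constant, which turns
  $Y_2^n$ into an output $T^n$ that depends on $X_1^n$ only; Csiszar's sum identity then single-letterizes
  the difference with $W_i = (V_1^n, Y_1^{i-1}, T_{i+1}^n)$. As the vanishing error terms depend on the
  block length, the rate conditions are first obtained up to arbitrary slack. The points
  $(p, H(Y_1), H(Y_2|X_2=x_0))$ for input laws $p$ form a compact set, whose convex hull is again compact
  and consists of the values for finitely supported $W$, so the slack can be removed.

  Achievability. Transmitter 1 uses superposition coding, where the cloud centre of $u_1^n$ is selected by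
  its side information $v_1^n$ and a hash of rate \<open>R\<close>. Receiver 2 knows $v_1^n$ and need only cope with
  the hash; the threshold decoders compare likelihoods weighted with the source law. By Condition 2 one has
  $I(X_2;Y_2|W) = I(W,X_2;Y_2)$, so decoding $u_2^n$ when the hash is right costs no further condition.
\<close>

section \<open>Entropy of finitely supported laws\<close>

text \<open>The hash rate \<open>R\<close> is the free parameter of the code. Receiver 1 separates
  words with equal side information if \<open>R + I(X1;Y1|W)\<close> exceeds
  \<open>H(U1|V1)\<close>; Receiver 2 needs \<open>R + H(U2)\<close> below
  \<open>I(W,X2;Y2)\<close>. Eliminating \<open>R \<ge> 0\<close> gives the second and third rate
  conditions, and the first one covers words in other clouds. In the converse one auxiliary variable
  has to serve both the bound on \<open>H(U2)\<close> and the sum bound. The sum identity leaves the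
  conditional entropies of the letters of \<open>T\<close> given the auxiliary variable, and their
  total is at most the block entropy that bounds \<open>H(U2)\<close>, so the same choice works for
  both. Condition 1 equates entropies and not laws; hence \<open>T\<close> is a fictitious output on
  a probability space of its own, compared with the code only through entropies. Strict inequalities
  leave positive exponents for the decoder tests, whereas the limit over block lengths preserves
  only weak ones. This is why the two directions differ on the boundary.\<close>

abbreviation expec :: "'a pmf \<Rightarrow> ('a \<Rightarrow> real) \<Rightarrow> real" where
  "expec \<equiv> measure_pmf.expectation"

text \<open>The mean of the self-information, for values of any type: the converse needs entropies
  of functions on positions, whereas \<open>H\<close> is restricted to countable types. Entropies of
  several variables on one space become expectations under the same law and combine
  linearly.\<close>

definition ent :: "'a pmf \<Rightarrow> real" where
  "ent p = expec p (\<lambda>x. - log 2 (pmf p x))"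

text \<open>Conditional entropy as a difference, so that the chain rule holds by definition. The
  form as a mean of kernel entropies is \<open>cent_kernel\<close>.\<close>

definition cent :: "'a pmf \<Rightarrow> ('a \<Rightarrow> 'b) \<Rightarrow> ('a \<Rightarrow> 'c) \<Rightarrow> real" where
  "cent P X Z = ent (map_pmf (\<lambda>\<omega>. (X \<omega>, Z \<omega>)) P) - ent (map_pmf Z P)"

lemma expec_sum:
  assumes "finite (set_pmf p)"
  shows "expec p f = (\<Sum>x\<in>set_pmf p. pmf p x * f x)"
  using integral_measure_pmf[of "set_pmf p" p f] assms by simp

lemma expec_bind:
  assumes "finite (set_pmf p)" "\<And>x. x \<in> set_pmf p \<Longrightarrow> finite (set_pmf (K x))"
  shows "expec (bind_pmf p K) f = expec p (\<lambda>x. expec (K x) f)"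
  using pmf_expectation_bind[of "set_pmf p" K p f] assms by (simp add: expec_sum)

lemma expec_mono:
  assumes "finite (set_pmf p)" "\<And>x. x \<in> set_pmf p \<Longrightarrow> f x \<le> g x"
  shows "expec p f \<le> expec p g"
  using assms by (auto simp: expec_sum intro!: sum_mono mult_left_mono)

lemma expec_cong:
  assumes "\<And>x. x \<in> set_pmf p \<Longrightarrow> f x = g x"
  shows "expec p f = expec p g"
  using assms by (intro integral_cong_AE) (auto simp: AE_measure_pmf_iff)

lemma expec_add:
  "finite (set_pmf p) \<Longrightarrow> expec p (\<lambda>x. f x + g x) = expec p f + expec p g"
  by (simp add: integrable_measure_pmf_finite)

lemma expec_diff:
  "finite (set_pmf p) \<Longrightarrow> expec p (\<lambda>x. f x - g x) = expec p f - expec p g"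
  by (simp add: integrable_measure_pmf_finite)

lemma ent_sum:
  assumes "finite (set_pmf p)"
  shows "ent p = - (\<Sum>x\<in>set_pmf p. pmf p x * log 2 (pmf p x))"
  using assms by (simp add: ent_def expec_sum sum_negf)

lemma ent_map: "ent (map_pmf X P) = expec P (\<lambda>\<omega>. - log 2 (pmf (map_pmf X P) (X \<omega>)))"
  by (simp add: ent_def)

text \<open>Entropy sees only the partition that a variable induces on the support. Reordering
  tuples, dropping redundant components and injective recoding are all instances of this
  criterion.\<close>

lemma ent_map_cong:
  assumes "\<And>\<omega> \<omega>'. \<omega> \<in> set_pmf P \<Longrightarrow> \<omega>' \<in> set_pmf P \<Longrightarrow> X \<omega> = X \<omega>' \<longleftrightarrow> Y \<omega> = Y \<omega>'"
  shows "ent (map_pmf X P) = ent (map_pmf Y P)"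
proof -
  have "pmf (map_pmf X P) (X \<omega>) = pmf (map_pmf Y P) (Y \<omega>)" if "\<omega> \<in> set_pmf P" for \<omega>
    unfolding pmf_map using assms[OF _ that]
    by (intro measure_pmf.finite_measure_eq_AE) (auto simp: AE_measure_pmf_iff)
  then show ?thesis by (auto simp: ent_map intro!: expec_cong)
qed

lemma ent_map_inj: "inj_on f (set_pmf p) \<Longrightarrow> ent (map_pmf f p) = ent p"
  using ent_map_cong[of p f "\<lambda>x. x"] by (auto simp: inj_on_def)

lemma cent_map: "cent (map_pmf f P) X Z = cent P (\<lambda>\<omega>. X (f \<omega>)) (\<lambda>\<omega>. Z (f \<omega>))"
  by (simp add: cent_def pmf.map_comp o_def)

lemma cent_cong_Z:
  assumes "\<And>\<omega> \<omega>'. \<omega> \<in> set_pmf P \<Longrightarrow> \<omega>' \<in> set_pmf P \<Longrightarrow> Z \<omega> = Z \<omega>' \<longleftrightarrow> Z' \<omega> = Z' \<omega>'"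
  shows "cent P X Z = cent P X Z'"
  unfolding cent_def
  by (intro arg_cong2[where f = "(-)"] ent_map_cong) (auto simp: assms)

text \<open>The atom at \<open>(x, y)\<close> has mass \<open>pmf p x * pmf (K x) y\<close>, and on
  the support its logarithm splits into the two parts.\<close>

lemma ent_bind_pair:
  assumes "finite (set_pmf p)" "\<And>x. x \<in> set_pmf p \<Longrightarrow> finite (set_pmf (K x))"
  shows "ent (bind_pmf p (\<lambda>x. map_pmf (\<lambda>y. (x, y)) (K x))) = ent p + expec p (\<lambda>x. ent (K x))"
proof -
  let ?J = "bind_pmf p (\<lambda>x. map_pmf (\<lambda>y. (x, y)) (K x))"
  have J: "pmf ?J (x, y) = pmf p x * pmf (K x) y" for x y
  proof -
    have "pmf (map_pmf (Pair z) (K z)) (x, y) = (if z = x then pmf (K x) y else 0)" for z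
      by (auto simp: pmf_map vimage_def measure_pmf_single)
    then have "pmf ?J (x, y) = (\<integral>z. (if z = x then pmf (K x) y else 0) \<partial>measure_pmf p)"
      by (simp add: pmf_bind)
    also have "\<dots> = (\<Sum>z\<in>{x}. pmf p z *\<^sub>R (if z = x then pmf (K x) y else 0))"
      by (rule integral_measure_pmf) (auto split: if_splits)
    finally show ?thesis by simp
  qed
  have "ent ?J = expec p (\<lambda>x. expec (K x) (\<lambda>y. - log 2 (pmf p x * pmf (K x) y)))"
    unfolding ent_def using assms by (subst expec_bind) (auto simp: J)
  also have "\<dots> = expec p (\<lambda>x. - log 2 (pmf p x) + ent (K x))"
  proof (rule expec_cong)
    fix x assume x: "x \<in> set_pmf p"
    then have px: "pmf p x > 0" by (simp add: pmf_positive)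
    have "expec (K x) (\<lambda>y. - log 2 (pmf p x * pmf (K x) y))
        = expec (K x) (\<lambda>y. - log 2 (pmf p x) + - log 2 (pmf (K x) y))"
      using px by (intro expec_cong) (auto simp: log_mult set_pmf_iff)
    also have "\<dots> = - log 2 (pmf p x) + ent (K x)"
      using assms(2)[OF x] by (subst expec_add) (auto simp: ent_def)
    finally show "expec (K x) (\<lambda>y. - log 2 (pmf p x * pmf (K x) y)) = - log 2 (pmf p x) + ent (K x)" .
  qed
  finally show ?thesis using assms(1) by (subst (asm) expec_add) (auto simp: ent_def)
qed

text \<open>Gibbs' inequality. A well-chosen reference kernel \<open>r\<close> yields both that conditioning reduces
  entropy and Fano's inequality.\<close>

lemma cent_le_cross:
  assumes fin: "finite (set_pmf P)"
    and pos: "\<And>\<omega>. \<omega> \<in> set_pmf P \<Longrightarrow> 0 < r (Z \<omega>) (X \<omega>)"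
    and nn: "\<And>z x. 0 \<le> r z x"
    and le1: "\<And>z. z \<in> Z ` set_pmf P \<Longrightarrow> (\<Sum>x\<in>X ` set_pmf P. r z x) \<le> 1"
  shows "cent P X Z \<le> expec P (\<lambda>\<omega>. - log 2 (r (Z \<omega>) (X \<omega>)))"
proof -
  let ?J = "map_pmf (\<lambda>\<omega>. (X \<omega>, Z \<omega>)) P" and ?Z = "map_pmf Z P"
  \<comment> \<open>Ratio of the joint mass that the reference kernel would produce to the true one.
    Its mean is at most 1, so \<open>ln_le_minus_one\<close> bounds the mean of its logarithm by
    0.\<close>
  let ?g = "\<lambda>\<omega>. r (Z \<omega>) (X \<omega>) * pmf ?Z (Z \<omega>) / pmf ?J (X \<omega>, Z \<omega>)"
  have pJ: "pmf ?J (X \<omega>, Z \<omega>) > 0" and pZ: "pmf ?Z (Z \<omega>) > 0" if "\<omega> \<in> set_pmf P" for \<omega>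
    using that by (auto intro!: pmf_positive)
  have "expec P ?g = expec ?J (\<lambda>(x, z). r z x * pmf ?Z z / pmf ?J (x, z))"
    by (simp add: case_prod_unfold)
  also have "\<dots> = (\<Sum>(x, z)\<in>set_pmf ?J. pmf ?J (x, z) * (r z x * pmf ?Z z / pmf ?J (x, z)))"
    using fin by (subst expec_sum) (auto simp: case_prod_unfold)
  also have "\<dots> = (\<Sum>(x, z)\<in>set_pmf ?J. r z x * pmf ?Z z)"
    using fin by (intro sum.cong) (auto simp: pJ less_imp_neq[symmetric] dest: pJ)
  also have "\<dots> \<le> (\<Sum>(x, z)\<in>X ` set_pmf P \<times> Z ` set_pmf P. r z x * pmf ?Z z)"
    using fin nn by (intro sum_mono2) auto
  also have "\<dots> = (\<Sum>z\<in>Z ` set_pmf P. pmf ?Z z * (\<Sum>x\<in>X ` set_pmf P. r z x))"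
    by (subst sum.cartesian_product[symmetric], subst sum.swap) (simp add: sum_distrib_left mult.commute)
  also have "\<dots> \<le> (\<Sum>z\<in>Z ` set_pmf P. pmf ?Z z * 1)"
    using le1 by (intro sum_mono mult_left_mono) auto
  also have "\<dots> = 1"
    using fin sum_pmf_eq_1[of "Z ` set_pmf P" ?Z] by simp
  finally have g1: "expec P ?g \<le> 1" .
  have "expec P (\<lambda>\<omega>. log 2 (?g \<omega>)) \<le> expec P (\<lambda>\<omega>. (?g \<omega> - 1) / ln 2)"
  proof (rule expec_mono[OF fin])
    fix \<omega> assume "\<omega> \<in> set_pmf P"
    then have "?g \<omega> > 0" using pJ pZ pos by simp
    from ln_le_minus_one[OF this] show "log 2 (?g \<omega>) \<le> (?g \<omega> - 1) / ln 2"
      by (simp add: log_def divide_right_mono)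
  qed
  also have "\<dots> = (expec P ?g - 1) / ln 2"
    using fin by (simp add: integrable_measure_pmf_finite)
  also have "\<dots> \<le> 0" using g1 by (simp add: divide_le_0_iff)
  finally have 1: "expec P (\<lambda>\<omega>. log 2 (?g \<omega>)) \<le> 0" .
  have "expec P (\<lambda>\<omega>. log 2 (?g \<omega>)) = expec P (\<lambda>\<omega>. log 2 (r (Z \<omega>) (X \<omega>)) + log 2 (pmf ?Z (Z \<omega>)) - log 2 (pmf ?J (X \<omega>, Z \<omega>)))"
    by (rule expec_cong) (use pJ pZ pos in \<open>simp add: log_divide log_mult less_imp_neq[symmetric]\<close>)
  also have "\<dots> = expec P (\<lambda>\<omega>. log 2 (r (Z \<omega>) (X \<omega>))) + (cent P X Z)"
    using fin by (simp add: cent_def ent_map integrable_measure_pmf_finite)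
  finally show ?thesis using 1 fin by simp
qed

text \<open>The reference kernel ignores \<open>Y\<close> and uses the true conditional law of
  \<open>X\<close> given \<open>Z\<close>; its cross entropy is exactly
  \<open>cent P X Z\<close>.\<close>

lemma cent_reduce:
  assumes fin: "finite (set_pmf P)"
  shows "cent P X (\<lambda>\<omega>. (Y \<omega>, Z \<omega>)) \<le> cent P X Z"
proof -
  let ?J = "map_pmf (\<lambda>\<omega>. (X \<omega>, Z \<omega>)) P" and ?Z = "map_pmf Z P"
  let ?r = "\<lambda>(y::'c, z) x. pmf ?J (x, z) / pmf ?Z z"
  have pJ: "pmf ?J (X \<omega>, Z \<omega>) > 0" and pZ: "pmf ?Z (Z \<omega>) > 0" if "\<omega> \<in> set_pmf P" for \<omega>
    using that by (auto intro!: pmf_positive)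
  have s: "(\<Sum>x\<in>X ` set_pmf P. pmf ?J (x, z)) = pmf ?Z z" for z
  proof -
    have "(\<Sum>x\<in>X ` set_pmf P. pmf ?J (x, z)) = (\<Sum>a\<in>(\<lambda>x. (x, z)) ` X ` set_pmf P. pmf ?J a)"
      by (subst sum.reindex) (auto simp: inj_on_def)
    also have "\<dots> = measure_pmf.prob ?J ((\<lambda>x. (x, z)) ` X ` set_pmf P)"
      using fin by (subst measure_measure_pmf_finite) auto
    also have "\<dots> = measure_pmf.prob P (Z -` {z})"
      unfolding measure_map_pmf
      by (intro measure_pmf.finite_measure_eq_AE) (auto simp: AE_measure_pmf_iff)
    finally show ?thesis by (simp add: pmf_map)
  qed
  have "cent P X (\<lambda>\<omega>. (Y \<omega>, Z \<omega>)) \<le> expec P (\<lambda>\<omega>. - log 2 (?r (Y \<omega>, Z \<omega>) (X \<omega>)))"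
    by (rule cent_le_cross[OF fin]) (auto simp: pJ pZ s sum_divide_distrib[symmetric])
  also have "\<dots> = expec P (\<lambda>\<omega>. - log 2 (pmf ?J (X \<omega>, Z \<omega>)) - - log 2 (pmf ?Z (Z \<omega>)))"
    by (rule expec_cong) (use pJ pZ in \<open>simp add: log_divide less_imp_neq[symmetric]\<close>)
  also have "\<dots> = cent P X Z"
    using fin by (subst expec_diff) (simp_all add: cent_def ent_map)
  finally show ?thesis .
qed

lemma cent_le_ent:
  assumes "finite (set_pmf P)"
  shows "cent P X Z \<le> ent (map_pmf X P)"
proof -
  have "cent P X Z = cent P X (\<lambda>\<omega>. (Z \<omega>, ()))" by (rule cent_cong_Z) auto
  also have "\<dots> \<le> cent P X (\<lambda>\<omega>. ())" by (rule cent_reduce[OF assms])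
  also have "\<dots> = ent (map_pmf X P)"
    unfolding cent_def by (subst ent_map_cong[of P "\<lambda>\<omega>. (X \<omega>, ())" X]) (auto simp: ent_def)
  finally show ?thesis .
qed

text \<open>A correct guess costs one bit, a wrong one a further \<open>log 2 N\<close> bits.
  \<open>N\<close> only bounds the number of values, so the full power of the source alphabet may be
  inserted even if the source has smaller support.\<close>

lemma fano:
  assumes fin: "finite (set_pmf P)" and N: "card (X ` set_pmf P) \<le> N"
  shows "cent P X Z \<le> 1 + measure_pmf.prob P {\<omega>. X \<omega> \<noteq> g (Z \<omega>)} * log 2 (real N)"
proof -
  \<comment> \<open>half of the mass on the guess, the other half spread over the at most \<open>N\<close> values\<close>
  let ?r = "\<lambda>z x. (if x = g z then 1 / 2 else 1 / (2 * real N))"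
  have "card (X ` set_pmf P) > 0" using fin by (simp add: card_gt_0_iff set_pmf_not_empty)
  with N have N0: "real N > 0" by linarith
  have "cent P X Z \<le> expec P (\<lambda>\<omega>. - log 2 (?r (Z \<omega>) (X \<omega>)))"
  proof (rule cent_le_cross[OF fin])
    fix z
    have "(\<Sum>x\<in>X ` set_pmf P. ?r z x) \<le> (\<Sum>x\<in>X ` set_pmf P. (if x = g z then 1 / 2 else 0) + 1 / (2 * real N))"
      by (intro sum_mono) auto
    also have "\<dots> = (\<Sum>x\<in>X ` set_pmf P. if x = g z then 1 / 2 else 0) + real (card (X ` set_pmf P)) * (1 / (2 * real N))"
      by (simp add: sum.distrib)
    also have "\<dots> \<le> 1 / 2 + real N * (1 / (2 * real N))"
      using fin N by (intro add_mono mult_right_mono) (auto simp: sum.delta)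
    also have "\<dots> = 1" using N0 by simp
    finally show "(\<Sum>x\<in>X ` set_pmf P. ?r z x) \<le> 1" .
  qed (use N0 in auto)
  also have "\<dots> \<le> expec P (\<lambda>\<omega>. 1 + indicator {\<omega>. X \<omega> \<noteq> g (Z \<omega>)} \<omega> * log 2 (real N))"
    using N0 by (intro expec_mono[OF fin]) (auto simp: log_divide log_mult)
  also have "\<dots> = 1 + measure_pmf.prob P {\<omega>. X \<omega> \<noteq> g (Z \<omega>)} * log 2 (real N)"
    using fin by (subst expec_add) auto
  finally show ?thesis .
qed

section \<open>Subadditivity and product laws\<close>

lemma chain_le:
  fixes n :: nat
  assumes fin: "finite (set_pmf P)"
  shows "ent (map_pmf (\<lambda>\<omega> j. if j < n then Y \<omega> j else d) P)
    \<le> (\<Sum>i<n. ent (map_pmf (\<lambda>\<omega>. Y \<omega> i) P))"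
proof (induction n)
  case 0 then show ?case by (simp add: ent_def)
next
  case (Suc n)
  let ?R = "\<lambda>n \<omega> (j::nat). if j < n then Y \<omega> j else d"
  have "ent (map_pmf (?R (Suc n)) P) = ent (map_pmf (\<lambda>\<omega>. (Y \<omega> n, ?R n \<omega>)) P)"
    by (rule ent_map_cong) (auto simp: fun_eq_iff less_Suc_eq)
  also have "\<dots> = cent P (\<lambda>\<omega>. Y \<omega> n) (?R n) + ent (map_pmf (?R n) P)"
    by (simp add: cent_def)
  finally show ?case using Suc cent_le_ent[OF fin, of "\<lambda>\<omega>. Y \<omega> n" "?R n"] by simp
qed

lemma finite_set_Pi_pmf:
  assumes "finite A" "\<And>i. i \<in> A \<Longrightarrow> finite (set_pmf (p i))"
  shows "finite (set_pmf (Pi_pmf A d p))"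
  using assms by (auto simp: set_Pi_pmf intro!: finite_PiE_dflt)

lemma ent_pair:
  assumes "finite (set_pmf p)" "finite (set_pmf q)"
  shows "ent (pair_pmf p q) = ent p + ent q"
proof -
  have "pair_pmf p q = bind_pmf p (\<lambda>x. map_pmf (\<lambda>y. (x, y)) q)"
    by (simp add: pair_pmf_def map_pmf_def)
  then show ?thesis using ent_bind_pair[of p "\<lambda>_. q"] assms by simp
qed

lemma ent_Pi_pmf:
  assumes "finite A" "\<And>i. i \<in> A \<Longrightarrow> finite (set_pmf (p i))"
  shows "ent (Pi_pmf A d p) = (\<Sum>i\<in>A. ent (p i))"
  using assms
proof (induction A rule: finite_induct)
  case empty then show ?case by (simp add: ent_def)
next
  case (insert x A)
  \<comment> \<open>Overwriting is injective because every function drawn over \<open>A\<close>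
    takes the default \<open>d\<close> at the new point.\<close>
  have "inj_on (\<lambda>(y, f). f(x := y)) (set_pmf (pair_pmf (p x) (Pi_pmf A d p)))"
  proof (rule inj_onI, clarsimp)
    fix a b a' b' assume "b \<in> set_pmf (Pi_pmf A d p)" "b' \<in> set_pmf (Pi_pmf A d p)"
      and e: "b(x := a) = b'(x := a')"
    then have "b x = d" "b' x = d" using set_Pi_pmf_subset[of A d p] insert by auto
    with e show "a = a' \<and> b = b'" by (metis fun_upd_same fun_upd_triv fun_upd_upd)
  qed
  then have "ent (Pi_pmf (insert x A) d p) = ent (pair_pmf (p x) (Pi_pmf A d p))"
    using insert by (simp add: Pi_pmf_insert ent_map_inj)
  also have "\<dots> = ent (p x) + ent (Pi_pmf A d p)"
    using insert by (intro ent_pair finite_set_Pi_pmf) auto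
  finally show ?case using insert by simp
qed

section \<open>The information measures in terms of entropies\<close>

lemma distributed_pmf:
  fixes X :: "'a \<Rightarrow> 'b"
  shows "distributed (measure_pmf P) (count_space UNIV) X (\<lambda>x. ennreal (pmf (map_pmf X P) x))"
  unfolding distributed_def
  by (simp add: measure_pmf_eq_density[symmetric] map_pmf_rep_eq)

lemma count_space_pair:
  "count_space (UNIV :: 'a::countable set) \<Otimes>\<^sub>M count_space (UNIV :: 'b::countable set) = count_space UNIV"
  by (subst pair_measure_countable) auto

lemma integral_pmf_count_space:
  "(\<integral>x. pmf p x * f x \<partial>count_space UNIV) = expec p f"
  by (subst measure_pmf_eq_density) (simp add: integral_density)

lemma sigma_finite_count_space_countable:
  "sigma_finite_measure (count_space (UNIV :: 'a::countable set))"
  by (rule sigma_finite_measure_count_space_countable) auto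

lemma distributed_pmf_pair:
  fixes X :: "'a \<Rightarrow> 'b::countable" and Y :: "'a \<Rightarrow> 'c::countable"
  shows "distributed (measure_pmf P) (count_space UNIV \<Otimes>\<^sub>M count_space UNIV) (\<lambda>\<omega>. (X \<omega>, Y \<omega>))
    (\<lambda>z. ennreal (pmf (map_pmf (\<lambda>\<omega>. (X \<omega>, Y \<omega>)) P) z))"
  unfolding count_space_pair by (rule distributed_pmf)

lemma H_eq_ent:
  fixes X :: "'a \<Rightarrow> 'b::countable"
  assumes "finite (set_pmf P)"
  shows "H P X = ent (map_pmf X P)"
proof -
  interpret information_space "measure_pmf P" 2
    by unfold_locales simp
  have "H P X = - (\<integral>x. pmf (map_pmf X P) x * log 2 (pmf (map_pmf X P) x) \<partial>count_space UNIV)"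
    unfolding H_def by (subst entropy_distr[OF distributed_pmf]) auto
  also have "\<dots> = ent (map_pmf X P)"
    by (subst integral_pmf_count_space) (simp add: ent_def)
  finally show ?thesis .
qed

text \<open>With counting measure the density formula becomes the expectation of one log-ratio under
  \<open>P\<close>, which splits into three self-informations.\<close>

lemma mutual_information_pmf:
  fixes X :: "'a \<Rightarrow> 'b::countable" and Y :: "'a \<Rightarrow> 'c::countable"
  assumes fin: "finite (set_pmf P)"
  shows "prob_space.mutual_information (measure_pmf P) 2 (count_space UNIV) (count_space UNIV) X Y
    = ent (map_pmf X P) + ent (map_pmf Y P) - ent (map_pmf (\<lambda>\<omega>. (X \<omega>, Y \<omega>)) P)"
proof -
  interpret information_space "measure_pmf P" 2
    by unfold_locales simp
  let ?XY = "map_pmf (\<lambda>\<omega>. (X \<omega>, Y \<omega>)) P"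
  have pos: "pmf ?XY (X \<omega>, Y \<omega>) > 0" "pmf (map_pmf X P) (X \<omega>) > 0" "pmf (map_pmf Y P) (Y \<omega>) > 0"
    if "\<omega> \<in> set_pmf P" for \<omega>
    using that by (auto intro!: pmf_positive)
  have "prob_space.mutual_information (measure_pmf P) 2 (count_space UNIV) (count_space UNIV) X Y
      = (\<integral>z. pmf ?XY z * log 2 (pmf ?XY z / (pmf (map_pmf X P) (fst z) * pmf (map_pmf Y P) (snd z))) \<partial>count_space UNIV)"
    using mutual_information_distr[OF sigma_finite_count_space_countable sigma_finite_count_space_countable
        distributed_pmf[of P X] _ distributed_pmf[of P Y] _ distributed_pmf_pair[of P X Y]]
    by (simp add: count_space_pair)
  also have "\<dots> = expec P (\<lambda>\<omega>. log 2 (pmf ?XY (X \<omega>, Y \<omega>) / (pmf (map_pmf X P) (X \<omega>) * pmf (map_pmf Y P) (Y \<omega>))))"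
    by (subst integral_pmf_count_space) simp
  also have "\<dots> = expec P (\<lambda>\<omega>. - log 2 (pmf (map_pmf X P) (X \<omega>)) + - log 2 (pmf (map_pmf Y P) (Y \<omega>))
      - - log 2 (pmf ?XY (X \<omega>, Y \<omega>)))"
    by (rule expec_cong) (use pos in \<open>simp add: log_divide log_mult less_imp_neq[symmetric]\<close>)
  also have "\<dots> = ent (map_pmf X P) + ent (map_pmf Y P) - ent ?XY"
    using fin by (simp add: expec_diff expec_add ent_map integrable_measure_pmf_finite)
  finally show ?thesis .
qed

text \<open>Written as output entropy minus the entropy of the output given the input, because the
  latter is an average of channel entropies.\<close>

lemma I_eq_ent:
  fixes X :: "'a \<Rightarrow> 'b::countable" and Y :: "'a \<Rightarrow> 'c::countable"
  assumes "finite (set_pmf P)"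
  shows "I P X Y = ent (map_pmf Y P) - cent P Y X"
proof -
  have "ent (map_pmf (\<lambda>\<omega>. (X \<omega>, Y \<omega>)) P) = ent (map_pmf (\<lambda>\<omega>. (Y \<omega>, X \<omega>)) P)"
    by (rule ent_map_cong) auto
  then show ?thesis
    unfolding I_def mutual_information_pmf[OF assms] cent_def by simp
qed

lemma I_cond_eq_ent:
  fixes X :: "'a \<Rightarrow> 'b::countable" and Y :: "'a \<Rightarrow> 'c::countable" and Z :: "'a \<Rightarrow> 'd::countable"
  assumes "finite (set_pmf P)"
  shows "I_cond P X Y Z = cent P Y Z - cent P Y (\<lambda>\<omega>. (X \<omega>, Z \<omega>))"
proof -
  have "ent (map_pmf (\<lambda>\<omega>. (X \<omega>, Y \<omega>, Z \<omega>)) P) = ent (map_pmf (\<lambda>\<omega>. (Y \<omega>, X \<omega>, Z \<omega>)) P)"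
    by (rule ent_map_cong) auto
  then show ?thesis
    unfolding I_cond_def prob_space.conditional_mutual_information_def[OF measure_pmf.prob_space_axioms] count_space_pair
      mutual_information_pmf[OF assms] cent_def by simp
qed

lemma H_cond_eq_ent:
  fixes X :: "'a \<Rightarrow> 'b::countable" and Y :: "'a \<Rightarrow> 'c::countable"
  assumes fin: "finite (set_pmf P)"
  shows "H_cond P X Y = cent P X Y"
proof -
  interpret information_space "measure_pmf P" 2
    by unfold_locales simp
  let ?XY = "map_pmf (\<lambda>\<omega>. (X \<omega>, Y \<omega>)) P"
  have pos: "pmf ?XY (X \<omega>, Y \<omega>) > 0" "pmf (map_pmf Y P) (Y \<omega>) > 0"
    if "\<omega> \<in> set_pmf P" for \<omega>
    using that by (auto intro!: pmf_positive)
  have "H_cond P X Y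
      = - (\<integral>z. pmf ?XY z * log 2 (pmf ?XY z / pmf (map_pmf Y P) (snd z)) \<partial>count_space UNIV)"
    unfolding H_cond_def
    by (subst conditional_entropy_generic_eq[OF sigma_finite_count_space_countable sigma_finite_count_space_countable
          distributed_pmf _ distributed_pmf_pair])
       (auto simp: count_space_pair case_prod_unfold)
  also have "\<dots> = - expec P (\<lambda>\<omega>. log 2 (pmf ?XY (X \<omega>, Y \<omega>) / (pmf (map_pmf Y P) (Y \<omega>))))"
    by (subst integral_pmf_count_space) simp
  also have "expec P (\<lambda>\<omega>. log 2 (pmf ?XY (X \<omega>, Y \<omega>) / (pmf (map_pmf Y P) (Y \<omega>))))
     = expec P (\<lambda>\<omega>. - log 2 (pmf (map_pmf Y P) (Y \<omega>)) - - log 2 (pmf ?XY (X \<omega>, Y \<omega>)))"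
    by (rule expec_cong) (use pos in \<open>simp add: log_divide less_imp_neq[symmetric]\<close>)
  also have "- \<dots> = cent P X Y"
    using fin by (simp add: expec_diff ent_map cent_def integrable_measure_pmf_finite)
  finally show ?thesis .
qed

section \<open>Single-letter laws\<close>

lemma joint_kernel:
  assumes fin: "finite (set_pmf P)"
    and J: "map_pmf (\<lambda>\<omega>. (Z \<omega>, Y \<omega>)) P = bind_pmf p (\<lambda>z. map_pmf (Pair z) (K z))"
  shows "map_pmf Z P = p" "finite (set_pmf p)" "z \<in> set_pmf p \<Longrightarrow> finite (set_pmf (K z))"
proof -
  have "map_pmf Z P = map_pmf fst (map_pmf (\<lambda>\<omega>. (Z \<omega>, Y \<omega>)) P)"
    by (simp add: pmf.map_comp o_def)
  also have "\<dots> = p"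
    unfolding J by (simp add: map_bind_pmf pmf.map_comp o_def bind_return_pmf')
  finally show Z: "map_pmf Z P = p" .
  then show "finite (set_pmf p)" using fin by auto
  show "finite (set_pmf (K z))" if "z \<in> set_pmf p"
  proof -
    have "Pair z ` set_pmf (K z) \<subseteq> set_pmf (bind_pmf p (\<lambda>z. map_pmf (Pair z) (K z)))"
      using that by auto
    also have "finite \<dots>" unfolding J[symmetric] using fin by simp
    finally (finite_subset) show ?thesis by (rule finite_imageD) (auto simp: inj_on_def)
  qed
qed

text \<open>The bridge from variables to channels: once a joint law is displayed as a first-stage
  law followed by a kernel, \<open>ent_bind_pair\<close> supplies the conditional entropy.
  Single-letter and block quantities are both computed this way.\<close>

lemma cent_kernel:
  assumes fin: "finite (set_pmf P)"
    and J: "map_pmf (\<lambda>\<omega>. (Z \<omega>, Y \<omega>)) P = bind_pmf p (\<lambda>z. map_pmf (Pair z) (K z))"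
  shows "cent P Y Z = expec p (\<lambda>z. ent (K z))"
proof -
  have "ent (map_pmf (\<lambda>\<omega>. (Z \<omega>, Y \<omega>)) P) = ent p + expec p (\<lambda>z. ent (K z))"
    unfolding J by (intro ent_bind_pair joint_kernel[OF assms])
  moreover have "ent (map_pmf (\<lambda>\<omega>. (Z \<omega>, Y \<omega>)) P) = ent (map_pmf (\<lambda>\<omega>. (Y \<omega>, Z \<omega>)) P)"
    by (rule ent_map_cong) auto
  ultimately show ?thesis unfolding cent_def joint_kernel(1)[OF assms] by simp
qed

text \<open>Supplies the means of the log-likelihoods to which the law of large numbers is applied
  in the analysis of the decoder tests.\<close>

lemma expec_log_kernel:
  assumes fin: "finite (set_pmf P)"
    and J: "map_pmf (\<lambda>\<omega>. (Z \<omega>, Y \<omega>)) P = bind_pmf p (\<lambda>z. map_pmf (Pair z) (K z))"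
  shows "expec P (\<lambda>\<omega>. log 2 (pmf (K (Z \<omega>)) (Y \<omega>))) = - expec p (\<lambda>z. ent (K z))"
proof -
  note fp = joint_kernel(2)[OF assms] and fK = joint_kernel(3)[OF assms]
  have "expec P (\<lambda>\<omega>. log 2 (pmf (K (Z \<omega>)) (Y \<omega>))) = expec (map_pmf (\<lambda>\<omega>. (Z \<omega>, Y \<omega>)) P) (\<lambda>(z, y). log 2 (pmf (K z) y))"
    by simp
  also have "\<dots> = expec p (\<lambda>z. - ent (K z))"
    unfolding J using fp fK by (subst expec_bind) (auto simp: ent_def)
  finally show ?thesis by simp
qed

lemma expec_log_marginal: "map_pmf X P = p \<Longrightarrow> expec P (\<lambda>\<omega>. log 2 (pmf p (X \<omega>))) = - ent p"
  by (auto simp: ent_map)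

text \<open>Block length 1 of Condition 1. It makes the conditional entropy of \<open>Y2\<close> the
  same for every second input letter, so that a fixed letter can stand for all of them.\<close>

lemma condition1_single:
  assumes "condition1 q2"
  shows "ent (bind_pmf p (\<lambda>x. q2 x x2)) = ent (bind_pmf p (\<lambda>x. q2 x x2'))"
proof -
  have m: "memoryless (Suc 0) q2 [x1] [x2] = map_pmf (\<lambda>y. [y]) (q2 x1 x2)" for x1 x2
    by (simp add: memoryless_def lessThan_Suc Pi_pmf_singleton pmf.map_comp o_def)
  have "H (bind_pmf (map_pmf (\<lambda>x. [x]) p) (\<lambda>xs1. memoryless 1 q2 xs1 [x2])) (\<lambda>ys2. ys2)
      = H (bind_pmf (map_pmf (\<lambda>x. [x]) p) (\<lambda>xs1. memoryless 1 q2 xs1 [x2'])) (\<lambda>ys2. ys2)"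
    using assms[unfolded condition1_def, rule_format, of 1 "map_pmf (\<lambda>x. [x]) p" "[x2]" "[x2']"]
    by (simp add: image_subset_iff)
  then have "H (map_pmf (\<lambda>y. [y]) (bind_pmf p (\<lambda>x. q2 x x2))) (\<lambda>ys2. ys2)
      = H (map_pmf (\<lambda>y. [y]) (bind_pmf p (\<lambda>x. q2 x x2'))) (\<lambda>ys2. ys2)"
    by (simp add: bind_map_pmf m map_bind_pmf)
  then show ?thesis by (simp add: H_eq_ent ent_map_inj inj_on_def)
qed

lemma finite_set_single_letter_law:
  fixes q1 :: "'x1::finite \<Rightarrow> 'y1::finite pmf" and q2 :: "'x1 \<Rightarrow> 'x2::finite \<Rightarrow> 'y2::finite pmf"
    and pU1 :: "'u1::finite pmf" and pU2 :: "'u2::finite pmf" and h1 :: "'u1 \<Rightarrow> 'v1"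
  assumes "finite (set_pmf pW)"
  shows "finite (set_pmf (single_letter_law q1 q2 pU1 h1 pU2 pW pX1W pX2))"
  using assms by (auto simp: single_letter_law_def)

text \<open>The joint marginals are displayed as a first-stage law followed by a kernel, the shape
  that \<open>cent_kernel\<close> and \<open>expec_log_kernel\<close> require.\<close>

lemma map_single_letter_law:
  fixes q1 :: "'x1 \<Rightarrow> 'y1 pmf" and q2 :: "'x1 \<Rightarrow> 'x2 \<Rightarrow> 'y2 pmf"
    and pU1 :: "'u1 pmf" and pU2 :: "'u2 pmf" and h1 :: "'u1 \<Rightarrow> 'v1"
    and pW :: "'w pmf" and pX1W :: "'w \<Rightarrow> 'x1 pmf" and pX2 :: "'x2 pmf"
  defines "P \<equiv> single_letter_law q1 q2 pU1 h1 pU2 pW pX1W pX2"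
  shows law_X1_Y1: "map_pmf (\<lambda>l. (X1 l, Y1 l)) P = bind_pmf (bind_pmf pW pX1W) (\<lambda>x. map_pmf (Pair x) (q1 x))"
    and law_W_X2_Y2: "map_pmf (\<lambda>l. ((W l, X2 l), Y2 l)) P
      = bind_pmf (pair_pmf pW pX2) (\<lambda>z. map_pmf (Pair z) (bind_pmf (pX1W (fst z)) (\<lambda>x1. q2 x1 (snd z))))"
    and law_W_Y1: "map_pmf (\<lambda>l. (W l, Y1 l)) P = bind_pmf pW (\<lambda>w. map_pmf (Pair w) (bind_pmf (pX1W w) q1))"
    and law_X1_W_Y1: "map_pmf (\<lambda>l. ((X1 l, W l), Y1 l)) P
      = bind_pmf (bind_pmf pW (\<lambda>w. map_pmf (\<lambda>x. (x, w)) (pX1W w))) (\<lambda>z. map_pmf (Pair z) (q1 (fst z)))"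
    and law_W_Y2: "map_pmf (\<lambda>l. (W l, Y2 l)) P
      = bind_pmf pW (\<lambda>w. map_pmf (Pair w) (bind_pmf (pX1W w) (\<lambda>x1. bind_pmf pX2 (q2 x1))))"
    and law_U1: "map_pmf U1 P = pU1" and law_U2: "map_pmf U2 P = pU2"
    and law_V1: "map_pmf V1 P = map_pmf h1 pU1" and law_h1_U1: "map_pmf (\<lambda>l. h1 (U1 l)) P = map_pmf h1 pU1"
    and law_U1_V1: "map_pmf (\<lambda>l. (U1 l, V1 l)) P = map_pmf (\<lambda>u. (u, h1 u)) pU1"
    and law_Y1: "map_pmf Y1 P = bind_pmf pW (\<lambda>w. bind_pmf (pX1W w) q1)"
    and law_Y2: "map_pmf Y2 P = bind_pmf pW (\<lambda>w. bind_pmf (pX1W w) (\<lambda>x1. bind_pmf pX2 (q2 x1)))"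
proof -
  \<comment> \<open>Here \<open>X2\<close> belongs to the conditioning but is drawn after
    \<open>X1\<close>, so the two independent draws must be exchanged.\<close>
  show "map_pmf (\<lambda>l. ((W l, X2 l), Y2 l)) P
      = bind_pmf (pair_pmf pW pX2) (\<lambda>z. map_pmf (Pair z) (bind_pmf (pX1W (fst z)) (\<lambda>x1. q2 x1 (snd z))))"
    by (subst pair_pmf_def)
       (simp add: P_def single_letter_law_def map_pmf_def bind_assoc_pmf bind_return_pmf,
        subst (2) bind_commute_pmf, rule refl)
qed (simp_all add: P_def single_letter_law_def map_pmf_def bind_assoc_pmf bind_return_pmf bind_return_pmf')

lemma law_support:
  assumes "l \<in> set_pmf (single_letter_law q1 q2 pU1 h1 pU2 pW pX1W pX2)"
  shows "U1 l \<in> set_pmf pU1" "U2 l \<in> set_pmf pU2" "V1 l = h1 (U1 l)" "W l \<in> set_pmf pW"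
    "X1 l \<in> set_pmf (pX1W (W l))" "X2 l \<in> set_pmf pX2" "Y1 l \<in> set_pmf (q1 (X1 l))" "Y2 l \<in> set_pmf (q2 (X1 l) (X2 l))"
  using assms by (auto simp: single_letter_law_def)

context
  fixes q1 :: "'x1::finite \<Rightarrow> 'y1::finite pmf" and q2 :: "'x1 \<Rightarrow> 'x2::finite \<Rightarrow> 'y2::finite pmf"
    and pU1 :: "'u1::finite pmf" and pU2 :: "'u2::finite pmf" and h1 :: "'u1 \<Rightarrow> 'v1::finite"
    and pW :: "'w::countable pmf" and pX1W :: "'w \<Rightarrow> 'x1 pmf" and pX2 :: "'x2 pmf"
  assumes finW: "finite (set_pmf pW)"
begin

lemmas fin_law = finite_set_single_letter_law[OF finW]

lemma law_H_U1: "H (single_letter_law q1 q2 pU1 h1 pU2 pW pX1W pX2) U1 = ent pU1"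
  by (simp add: H_eq_ent fin_law law_U1)

lemma law_H_U2: "H (single_letter_law q1 q2 pU1 h1 pU2 pW pX1W pX2) U2 = ent pU2"
  by (simp add: H_eq_ent fin_law law_U2)

lemma law_H_cond: "H_cond (single_letter_law q1 q2 pU1 h1 pU2 pW pX1W pX2) U1 V1 = ent pU1 - ent (map_pmf h1 pU1)"
  unfolding H_cond_eq_ent[OF fin_law] cent_def law_U1_V1 law_V1
  by (subst ent_map_inj) (auto simp: inj_on_def)

lemma law_I1: "I (single_letter_law q1 q2 pU1 h1 pU2 pW pX1W pX2) X1 Y1 = ent (bind_pmf (bind_pmf pW pX1W) q1) - expec (bind_pmf pW pX1W) (\<lambda>x. ent (q1 x))"
  unfolding I_eq_ent[OF fin_law] law_Y1 cent_kernel[OF fin_law law_X1_Y1] bind_assoc_pmf ..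

lemma law_I2: "I (single_letter_law q1 q2 pU1 h1 pU2 pW pX1W pX2) (\<lambda>l. (W l, X2 l)) Y2 = ent (output_law q2 (bind_pmf pW pX1W) pX2)
    - expec (pair_pmf pW pX2) (\<lambda>z. ent (bind_pmf (pX1W (fst z)) (\<lambda>x1. q2 x1 (snd z))))"
  unfolding I_eq_ent[OF fin_law] law_Y2 cent_kernel[OF fin_law law_W_X2_Y2] output_law_def bind_assoc_pmf ..

text \<open>Given the first input, the auxiliary variable has no influence on \<open>Y1\<close>; the
  subtracted term is therefore the channel entropy averaged over the mixed input law.\<close>

lemma law_I_cond: "I_cond (single_letter_law q1 q2 pU1 h1 pU2 pW pX1W pX2) X1 Y1 W
   = expec pW (\<lambda>w. ent (bind_pmf (pX1W w) q1)) - expec (bind_pmf pW pX1W) (\<lambda>x. ent (q1 x))"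
proof -
  have "expec (bind_pmf pW (\<lambda>w. map_pmf (\<lambda>x. (x, w)) (pX1W w))) (\<lambda>z. ent (q1 (fst z)))
     = expec (bind_pmf pW pX1W) (\<lambda>x. ent (q1 x))"
    using finW by (simp add: expec_bind)
  then show ?thesis
    unfolding I_cond_eq_ent[OF fin_law] cent_kernel[OF fin_law law_W_Y1] cent_kernel[OF fin_law law_X1_W_Y1]
    by simp
qed

text \<open>Condition 2 pins the entropy of \<open>Y2\<close> at its maximum for every law of the
  first input, and Condition 1 freezes the second input at \<open>x0\<close> in the conditional
  entropy. The result depends only on the law of \<open>W\<close> and \<open>X1\<close>, which is
  what the converse controls.\<close>

lemma law_I2_conditions:
  assumes c1: "condition1 q2" and c2: "condition2_witness q2 pX2"
  shows "I (single_letter_law q1 q2 pU1 h1 pU2 pW pX1W pX2) (\<lambda>l. (W l, X2 l)) Y2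
    = max_output_entropy q2 - expec pW (\<lambda>w. ent (bind_pmf (pX1W w) (\<lambda>x1. q2 x1 x0)))"
proof -
  have "ent (output_law q2 (bind_pmf pW pX1W) pX2) = max_output_entropy q2"
    using c2 by (simp add: condition2_witness_def H_eq_ent)
  moreover have "expec (pair_pmf pW pX2) (\<lambda>z. ent (bind_pmf (pX1W (fst z)) (\<lambda>x1. q2 x1 (snd z))))
      = expec (pair_pmf pW pX2) (\<lambda>z. ent (bind_pmf (pX1W (fst z)) (\<lambda>x1. q2 x1 x0)))"
    by (rule expec_cong) (rule condition1_single[OF c1])
  moreover have "\<dots> = expec (map_pmf fst (pair_pmf pW pX2)) (\<lambda>w. ent (bind_pmf (pX1W w) (\<lambda>x1. q2 x1 x0)))"
    by (simp only: integral_map_pmf)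
  ultimately show ?thesis unfolding law_I2 map_fst_pair_pmf by simp
qed

end

section \<open>Block codes\<close>

lemma cond_mutual_info_commute:
  "cent P X Z - cent P X (\<lambda>\<omega>. (Y \<omega>, Z \<omega>)) = cent P Y Z - cent P Y (\<lambda>\<omega>. (X \<omega>, Z \<omega>))"
proof -
  have "ent (map_pmf (\<lambda>\<omega>. (X \<omega>, Y \<omega>, Z \<omega>)) P) = ent (map_pmf (\<lambda>\<omega>. (Y \<omega>, X \<omega>, Z \<omega>)) P)"
    by (rule ent_map_cong) auto
  then show ?thesis by (simp add: cent_def)
qed

lemma mutual_info_commute: "ent (map_pmf X P) - cent P X Y = ent (map_pmf Y P) - cent P Y X"
proof -
  have "ent (map_pmf (\<lambda>\<omega>. (X \<omega>, Y \<omega>)) P) = ent (map_pmf (\<lambda>\<omega>. (Y \<omega>, X \<omega>)) P)"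
    by (rule ent_map_cong) auto
  then show ?thesis by (simp add: cent_def)
qed

text \<open>Concavity of entropy, obtained by forgetting the mixture index. It merges the positions
  of a block into one letter.\<close>

lemma ent_mixture_le:
  assumes "finite (set_pmf p)" "\<And>x. x \<in> set_pmf p \<Longrightarrow> finite (set_pmf (K x))"
  shows "expec p (\<lambda>x. ent (K x)) \<le> ent (bind_pmf p K)"
proof -
  let ?J = "bind_pmf p (\<lambda>x. map_pmf (Pair x) (K x))"
  have fin: "finite (set_pmf ?J)" using assms by auto
  have "cent ?J snd fst = expec p (\<lambda>x. ent (K x))"
    by (rule cent_kernel[OF fin]) (simp add: map_bind_pmf pmf.map_comp o_def)
  moreover have "map_pmf snd ?J = bind_pmf p K"
    by (simp add: map_bind_pmf pmf.map_comp o_def)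
  ultimately show ?thesis using cent_le_ent[OF fin, of snd fst] by simp
qed

text \<open>Draws the value of \<open>h\<close> before \<open>u\<close>. This turns a variable
  computed from \<open>u\<close> into a first-stage law, as \<open>cent_kernel\<close>
  demands.\<close>

lemma bind_pmf_disintegrate:
  "bind_pmf p (\<lambda>u. map_pmf (Pair (h u)) (M u))
    = bind_pmf (map_pmf h p) (\<lambda>v. map_pmf (Pair v) (bind_pmf (cond_pmf p {u. h u = v}) M))"
proof -
  have p: "bind_pmf (map_pmf h p) (\<lambda>v. cond_pmf p {u. v = h u}) = p"
    by (rule bind_cond_pmf_cancel) (auto simp: pmf_map vimage_def measure_pmf_single eq_commute Collect_conv_if)
  have "bind_pmf p (\<lambda>u. map_pmf (Pair (h u)) (M u))
     = bind_pmf (bind_pmf (map_pmf h p) (\<lambda>v. cond_pmf p {u. v = h u})) (\<lambda>u. map_pmf (Pair (h u)) (M u))"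
    by (simp only: p)
  also have "\<dots> = bind_pmf (map_pmf h p) (\<lambda>v. bind_pmf (cond_pmf p {u. v = h u}) (\<lambda>u. map_pmf (Pair (h u)) (M u)))"
    by (simp add: bind_assoc_pmf)
  also have "\<dots> = bind_pmf (map_pmf h p) (\<lambda>v. bind_pmf (cond_pmf p {u. h u = v}) (\<lambda>u. map_pmf (Pair v) (M u)))"
  proof (rule bind_pmf_cong[OF refl])
    fix v assume v: "v \<in> set_pmf (map_pmf h p)"
    have e: "{u. v = h u} = {u. h u = v}" by auto
    have "set_pmf p \<inter> {u. h u = v} \<noteq> {}" using v by auto
    then show "bind_pmf (cond_pmf p {u. v = h u}) (\<lambda>u. map_pmf (Pair (h u)) (M u))
        = bind_pmf (cond_pmf p {u. h u = v}) (\<lambda>u. map_pmf (Pair v) (M u))"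
      unfolding e by (intro bind_pmf_cong refl) auto
  qed
  finally show ?thesis by (simp add: map_bind_pmf)
qed

section \<open>Words as functions on positions\<close>

abbreviation PiN :: "nat \<Rightarrow> (nat \<Rightarrow> 'a pmf) \<Rightarrow> (nat \<Rightarrow> 'a) pmf" where
  "PiN n K \<equiv> Pi_pmf {..<n} undefined K"

abbreviation lst :: "nat \<Rightarrow> (nat \<Rightarrow> 'a) \<Rightarrow> 'a list" where
  "lst n f \<equiv> map f [0..<n]"

lemma PiN_undefined: "f \<in> set_pmf (PiN n K) \<Longrightarrow> \<not> i < n \<Longrightarrow> f i = undefined"
  using set_Pi_pmf_subset[of "{..<n}" undefined K] by auto

lemma inj_on_lst: "inj_on (lst n) (set_pmf (PiN n K))"
proof (rule inj_onI, rule ext)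
  fix f g :: "nat \<Rightarrow> 'a" and i assume fg: "f \<in> set_pmf (PiN n K)" "g \<in> set_pmf (PiN n K)" and e: "lst n f = lst n g"
  show "f i = g i"
  proof (cases "i < n")
    case True
    then show ?thesis using arg_cong[OF e, of "\<lambda>l. l ! i"] by simp
  next
    case False
    then show ?thesis using PiN_undefined[OF fg(1) False] PiN_undefined[OF fg(2) False] by simp
  qed
qed

text \<open>The default is that of \<open>PiN\<close>, so restriction is the identity on the support
  of \<open>PiN n K\<close>, and equality of two restrictions means equality of the first
  \<open>n\<close> letters.\<close>

definition res :: "nat \<Rightarrow> (nat \<Rightarrow> 'a) \<Rightarrow> nat \<Rightarrow> 'a" where
  "res n f = (\<lambda>i. if i < n then f i else undefined)"

lemma res_nth [simp]: "i < n \<Longrightarrow> res n f i = f i"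
  by (simp add: res_def)

lemma finite_set_PiN: "finite (set_pmf (PiN n (K :: nat \<Rightarrow> 'a::finite pmf)))"
  by (rule finite_set_Pi_pmf) auto

lemma replicate_pmf_eq_Pi: "replicate_pmf n p = map_pmf (lst n) (PiN n (\<lambda>_. p))"
proof (induction n)
  case 0 then show ?case by simp
next
  case (Suc n)
  \<comment> \<open>\<open>PiN\<close> grows at its last index, so the new letter has to be appended
    to the list instead of put in front.\<close>
  have "replicate_pmf (Suc n) p = replicate_pmf (n + 1) p" by simp
  also have "\<dots> = do {xs \<leftarrow> map_pmf (lst n) (PiN n (\<lambda>_. p)); y \<leftarrow> p; return_pmf (xs @ [y])}"
    unfolding replicate_pmf_distrib Suc replicate_pmf_1 by (simp add: bind_map_pmf)
  also have "\<dots> = do {f \<leftarrow> PiN n (\<lambda>_. p); y \<leftarrow> p; return_pmf (lst n f @ [y])}"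
    by (simp add: bind_map_pmf)
  also have "\<dots> = map_pmf (lst (Suc n)) (PiN (Suc n) (\<lambda>_. p))"
    unfolding lessThan_Suc
    by (subst Pi_pmf_insert', simp, simp, subst bind_commute_pmf)
       (auto simp: map_bind_pmf intro!: bind_pmf_cong)
  finally show ?case .
qed

lemma PiN_pair:
  "PiN n (\<lambda>i. pair_pmf (K i) (L i))
    = do {f \<leftarrow> PiN n K; g \<leftarrow> PiN n L; return_pmf (\<lambda>i. if i < n then (f i, g i) else undefined)}"
  unfolding pair_pmf_def
  by (subst Pi_pmf_bind[where d' = undefined], simp, subst Pi_pmf_bind[where d' = undefined])
     (simp_all add: lessThan_def)

lemma memoryless_pair:
  assumes "\<And>x1 x2. ch x1 x2 = pair_pmf (q1 x1) (q2 x1 x2)"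
  shows "map_pmf (\<lambda>ys. (map fst ys, map snd ys)) (memoryless n ch a b)
    = do {y1 \<leftarrow> PiN n (\<lambda>i. q1 (a ! i)); y2 \<leftarrow> PiN n (\<lambda>i. q2 (a ! i) (b ! i)); return_pmf (lst n y1, lst n y2)}"
  by (auto simp: memoryless_def assms PiN_pair pmf.map_comp map_bind_pmf o_def intro!: bind_pmf_cong)

text \<open>The outputs are functions on positions, which makes single coordinates easy to resample;
  the source words stay lists because the encoders act on lists.\<close>

definition code_fun_law ::
  "nat \<Rightarrow> ('x1 \<Rightarrow> 'y1 pmf) \<Rightarrow> ('x1 \<Rightarrow> 'x2 \<Rightarrow> 'y2 pmf) \<Rightarrow> 'u1 pmf \<Rightarrow> 'u2 pmf \<Rightarrow>
   ('u1 list \<Rightarrow> 'x1 list) \<Rightarrow> ('u2 list \<Rightarrow> 'x2 list) \<Rightarrow>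
   ('u1 list \<times> 'u2 list \<times> (nat \<Rightarrow> 'y1) \<times> (nat \<Rightarrow> 'y2)) pmf" where
  "code_fun_law n q1 q2 pU1 pU2 f1 f2 = do {
     us1 \<leftarrow> replicate_pmf n pU1;
     us2 \<leftarrow> replicate_pmf n pU2;
     y1 \<leftarrow> PiN n (\<lambda>i. q1 (f1 us1 ! i));
     y2 \<leftarrow> PiN n (\<lambda>i. q2 (f1 us1 ! i) (f2 us2 ! i));
     return_pmf (us1, us2, y1, y2)}"

lemma code_law_eq:
  assumes "\<And>x1 x2. ch x1 x2 = pair_pmf (q1 x1) (q2 x1 x2)"
  shows "code_law n ch pU1 pU2 f1 f2
    = map_pmf (\<lambda>(u1, u2, y1, y2). (u1, u2, lst n y1, lst n y2)) (code_fun_law n q1 q2 pU1 pU2 f1 f2)"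
proof -
  have "code_law n ch pU1 pU2 f1 f2 = do {us1 \<leftarrow> replicate_pmf n pU1; us2 \<leftarrow> replicate_pmf n pU2;
     yy \<leftarrow> map_pmf (\<lambda>ys. (map fst ys, map snd ys)) (memoryless n ch (f1 us1) (f2 us2));
     return_pmf (us1, us2, fst yy, snd yy)}"
    by (simp add: code_law_def bind_map_pmf)
  also have "\<dots> = map_pmf (\<lambda>(u1, u2, y1, y2). (u1, u2, lst n y1, lst n y2)) (code_fun_law n q1 q2 pU1 pU2 f1 f2)"
    unfolding memoryless_pair[OF assms] code_fun_law_def
    by (simp add: bind_assoc_pmf bind_return_pmf map_bind_pmf)
  finally show ?thesis .
qed

lemma error_prob_eq:
  assumes "\<And>x1 x2. ch x1 x2 = pair_pmf (q1 x1) (q2 x1 x2)"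
  shows "error_prob n ch pU1 h1 pU2 f1 f2 g1 g2
    = measure_pmf.prob (code_fun_law n q1 q2 pU1 pU2 f1 f2)
       {(us1, us2, y1, y2). (us1, us2) \<noteq> (g1 (lst n y1), g2 (lst n y2) (map h1 us1))}"
  unfolding error_prob_def code_law_eq[OF assms] measure_map_pmf
  by (rule arg_cong[where f = "measure_pmf.prob _"]) auto

section \<open>Single-letterization\<close>

text \<open>Coordinate \<open>i\<close> is independent of everything that does not look at it. For
  the auxiliary variable of the converse this is the Markov property: given the input letter, an
  output letter at position \<open>i\<close> is a fresh use of the channel.\<close>

lemma Pi_pmf_resample:
  assumes fin: "finite A" and i: "i \<in> A" and G: "\<And>f a. G (f(i := a)) = G f"
  shows "map_pmf (\<lambda>f. (G f, f i)) (Pi_pmf A d p) = bind_pmf (Pi_pmf A d p) (\<lambda>f. map_pmf (Pair (G f)) (p i))"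
proof -
  let ?B = "A - {i}"
  have A: "A = insert i ?B" using i by auto
  have P: "Pi_pmf A d p = bind_pmf (p i) (\<lambda>y. bind_pmf (Pi_pmf ?B d p) (\<lambda>f. return_pmf (f(i := y))))"
    by (subst A, subst Pi_pmf_insert') (use fin in auto)
  have "map_pmf (\<lambda>f. (G f, f i)) (Pi_pmf A d p)
      = bind_pmf (p i) (\<lambda>y. bind_pmf (Pi_pmf ?B d p) (\<lambda>f. return_pmf (G f, y)))"
    unfolding P by (simp add: map_bind_pmf G)
  also have "\<dots> = bind_pmf (Pi_pmf ?B d p) (\<lambda>f. map_pmf (Pair (G f)) (p i))"
    by (subst bind_commute_pmf) (simp add: map_pmf_def)
  also have "\<dots> = bind_pmf (Pi_pmf A d p) (\<lambda>f. map_pmf (Pair (G f)) (p i))"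
    unfolding P by (simp add: bind_assoc_pmf bind_return_pmf G)
  finally show ?thesis .
qed

text \<open>The suffix from position \<open>i\<close> on, inclusive. The auxiliary variable takes it
  at \<open>Suc i\<close>, so that the letter at \<open>i\<close> itself is left out.\<close>

definition upward :: "nat \<Rightarrow> nat \<Rightarrow> (nat \<Rightarrow> 'a) \<Rightarrow> nat \<Rightarrow> 'a" where
  "upward n i f = (\<lambda>j. if i \<le> j \<and> j < n then f j else undefined)"

lemma res_Suc_eq: "res (Suc i) f = res (Suc i) g \<longleftrightarrow> f i = g i \<and> res i f = res i g"
  by (auto simp: res_def fun_eq_iff less_Suc_eq)

lemma upward_eq: "i < n \<Longrightarrow> upward n i f = upward n i g \<longleftrightarrow> f i = g i \<and> upward n (Suc i) f = upward n (Suc i) g"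
proof -
  assume "i < n"
  moreover have "i \<le> j \<longleftrightarrow> j = i \<or> Suc i \<le> j" for j by auto
  ultimately show ?thesis by (auto simp: upward_def fun_eq_iff)
qed

text \<open>The hybrids \<open>(V, Y\<^sup>i, T\<^sub>i\<^sup>n)\<close> interpolate between
  \<open>(V, T\<^sup>n)\<close> and \<open>(V, Y\<^sup>n)\<close>.\<close>

lemma csiszar_sum:
  "cent P (\<lambda>\<omega>. res n (Y \<omega>)) V - cent P (\<lambda>\<omega>. upward n 0 (T \<omega>)) V
    = (\<Sum>i<n. cent P (\<lambda>\<omega>. Y \<omega> i) (\<lambda>\<omega>. (V \<omega>, res i (Y \<omega>), upward n (Suc i) (T \<omega>)))
            - cent P (\<lambda>\<omega>. T \<omega> i) (\<lambda>\<omega>. (V \<omega>, res i (Y \<omega>), upward n (Suc i) (T \<omega>))))"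
proof -
  define G where "G i = ent (map_pmf (\<lambda>\<omega>. (V \<omega>, res i (Y \<omega>), upward n i (T \<omega>))) P)" for i
  let ?W = "\<lambda>i \<omega>. (V \<omega>, res i (Y \<omega>), upward n (Suc i) (T \<omega>))"
  have 1: "cent P (\<lambda>\<omega>. Y \<omega> i) (?W i) - cent P (\<lambda>\<omega>. T \<omega> i) (?W i) = G (Suc i) - G i" if "i < n" for i
  proof -
    have "ent (map_pmf (\<lambda>\<omega>. (Y \<omega> i, ?W i \<omega>)) P) = G (Suc i)"
      unfolding G_def by (rule ent_map_cong) (auto simp: res_Suc_eq)
    moreover have "ent (map_pmf (\<lambda>\<omega>. (T \<omega> i, ?W i \<omega>)) P) = G i"
      unfolding G_def by (rule ent_map_cong) (auto simp: upward_eq that)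
    ultimately show ?thesis by (simp add: cent_def)
  qed
  have "(\<Sum>i<n. cent P (\<lambda>\<omega>. Y \<omega> i) (?W i) - cent P (\<lambda>\<omega>. T \<omega> i) (?W i)) = G n - G 0"
    using 1 by (simp add: sum_lessThan_telescope)
  moreover have "G n = ent (map_pmf (\<lambda>\<omega>. (res n (Y \<omega>), V \<omega>)) P)"
    unfolding G_def by (rule ent_map_cong) (auto simp: upward_def fun_eq_iff)
  moreover have "G 0 = ent (map_pmf (\<lambda>\<omega>. (upward n 0 (T \<omega>), V \<omega>)) P)"
    unfolding G_def by (rule ent_map_cong) (auto simp: res_def)
  ultimately show ?thesis by (simp add: cent_def)
qed

text \<open>The chain rule run from the last position backwards; the extra component
  \<open>Z i\<close> can only lower each term. With the prefix of \<open>Y1\<close> for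
  \<open>Z i\<close>, the bound on \<open>H(U2)\<close> uses the same auxiliary variable as the sum
  bound.\<close>

lemma chain_upward:
  assumes fin: "finite (set_pmf P)"
  shows "(\<Sum>i<n. cent P (\<lambda>\<omega>. T \<omega> i) (\<lambda>\<omega>. (V \<omega>, Z i \<omega>, upward n (Suc i) (T \<omega>))))
    \<le> cent P (\<lambda>\<omega>. upward n 0 (T \<omega>)) V"
proof -
  define G where "G i = ent (map_pmf (\<lambda>\<omega>. (upward n i (T \<omega>), V \<omega>)) P)" for i
  have 1: "cent P (\<lambda>\<omega>. T \<omega> i) (\<lambda>\<omega>. (V \<omega>, Z i \<omega>, upward n (Suc i) (T \<omega>))) \<le> G i - G (Suc i)"
    if "i < n" for i
  proof -
    have "cent P (\<lambda>\<omega>. T \<omega> i) (\<lambda>\<omega>. (V \<omega>, Z i \<omega>, upward n (Suc i) (T \<omega>)))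
        = cent P (\<lambda>\<omega>. T \<omega> i) (\<lambda>\<omega>. (Z i \<omega>, upward n (Suc i) (T \<omega>), V \<omega>))"
      by (rule cent_cong_Z) auto
    also have "\<dots> \<le> cent P (\<lambda>\<omega>. T \<omega> i) (\<lambda>\<omega>. (upward n (Suc i) (T \<omega>), V \<omega>))"
      by (rule cent_reduce[OF fin])
    also have "\<dots> = G i - G (Suc i)"
      unfolding G_def cent_def
      by (subst ent_map_cong[of P "\<lambda>\<omega>. (upward n i (T \<omega>), V \<omega>)" "\<lambda>\<omega>. (T \<omega> i, upward n (Suc i) (T \<omega>), V \<omega>)"])
         (auto simp: upward_eq that)
    finally show ?thesis .
  qed
  have "(\<Sum>i<n. cent P (\<lambda>\<omega>. T \<omega> i) (\<lambda>\<omega>. (V \<omega>, Z i \<omega>, upward n (Suc i) (T \<omega>)))) \<le> (\<Sum>i<n. G i - G (Suc i))"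
    using 1 by (intro sum_mono) auto
  also have "\<dots> = G 0 - G n" by (rule sum_lessThan_telescope')
  also have "G n = ent (map_pmf V P)"
    unfolding G_def by (rule ent_map_cong) (auto simp: upward_def fun_eq_iff)
  finally show ?thesis by (simp add: cent_def G_def)
qed

text \<open>Condition 1 is applied with the constant word \<open>replicate n x0\<close> as the
  second one. Passing between lists and functions is injective on the support, hence preserves the
  entropy.\<close>

lemma condition1_block:
  fixes q2 :: "'x1::finite \<Rightarrow> 'x2::finite \<Rightarrow> 'y2::finite pmf"
  assumes c1: "condition1 q2" and n: "n \<ge> 1" and x2: "length x2 = n"
    and p: "set_pmf p \<subseteq> {xs. length xs = n}"
  shows "ent (bind_pmf p (\<lambda>x1. PiN n (\<lambda>i. q2 (x1 ! i) (x2 ! i))))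
       = ent (bind_pmf p (\<lambda>x1. PiN n (\<lambda>i. q2 (x1 ! i) x0)))"
proof -
  have e: "H (bind_pmf p (\<lambda>xs1. memoryless n q2 xs1 b)) (\<lambda>ys2. ys2)
      = ent (bind_pmf p (\<lambda>x1. PiN n (\<lambda>i. q2 (x1 ! i) (b ! i))))" for b
  proof -
    have m: "bind_pmf p (\<lambda>xs1. memoryless n q2 xs1 b)
      = map_pmf (lst n) (bind_pmf p (\<lambda>x1. PiN n (\<lambda>i. q2 (x1 ! i) (b ! i))))"
      by (simp add: memoryless_def map_bind_pmf)
    have "finite (set_pmf p)" using p by (rule finite_subset) (rule finite_lists_length_eq[of UNIV, simplified], simp)
    then have "finite (set_pmf (bind_pmf p (\<lambda>xs1. memoryless n q2 xs1 b)))"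
      by (auto simp: memoryless_def finite_set_PiN)
    moreover have "inj_on (lst n) (set_pmf (bind_pmf p (\<lambda>x1. PiN n (\<lambda>i. q2 (x1 ! i) (b ! i)))))"
    proof (rule inj_onI, rule ext)
      fix f g :: "nat \<Rightarrow> 'y2" and i
      assume fg: "f \<in> set_pmf (bind_pmf p (\<lambda>x1. PiN n (\<lambda>i. q2 (x1 ! i) (b ! i))))"
        "g \<in> set_pmf (bind_pmf p (\<lambda>x1. PiN n (\<lambda>i. q2 (x1 ! i) (b ! i))))" and e: "lst n f = lst n g"
      show "f i = g i"
        using fg arg_cong[OF e, of "\<lambda>l. l ! i"] by (cases "i < n") (auto dest!: PiN_undefined)
    qed
    ultimately show ?thesis by (simp add: H_eq_ent m ent_map_inj)
  qed
  have "PiN n (\<lambda>i. q2 (x1 ! i) (replicate n x0 ! i)) = PiN n (\<lambda>i. q2 (x1 ! i) x0)" for x1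
    by (rule Pi_pmf_cong) auto
  then show ?thesis
    using c1[unfolded condition1_def, rule_format, OF n p, of x2 "replicate n x0"] x2 by (simp add: e)
qed

lemma ent_replicate_pmf:
  "finite (set_pmf p) \<Longrightarrow> ent (replicate_pmf n p) = n * ent p"
  by (simp add: replicate_pmf_eq_Pi ent_map_inj[OF inj_on_lst] ent_Pi_pmf)

lemma map_replicate_pmf: "map_pmf (map h) (replicate_pmf n p) = replicate_pmf n (map_pmf h p)"
proof (induction n)
  case (Suc n)
  then show ?case by (simp flip: Suc add: map_bind_pmf bind_map_pmf)
qed simp

lemma card_set_replicate_pmf:
  fixes p :: "'a::finite pmf"
  shows "card (set_pmf (replicate_pmf n p)) \<le> CARD('a) ^ n"
proof -
  have "card (set_pmf (replicate_pmf n p)) \<le> card {xs :: 'a list. set xs \<subseteq> UNIV \<and> length xs = n}"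
    by (rule card_mono[OF finite_lists_length_eq]) (auto simp: set_replicate_pmf)
  then show ?thesis by (subst (asm) card_lists_length_eq) auto
qed

text \<open>The witness \<open>D\<close> is the law of a uniform position \<open>i\<close> together with the auxiliary variable
  $(V_1^n, Y_1^{i-1}, T_{i+1}^n)$, where \<open>T\<close> is the output \<open>Y2\<close> for the constant second input \<open>x0\<close>;
  \<open>k\<close> is the conditional law of the \<open>i\<close>-th letter of the first input.\<close>

lemma converse_block:
  fixes q1 :: "'x1::finite \<Rightarrow> 'y1::finite pmf" and q2 :: "'x1 \<Rightarrow> 'x2::finite \<Rightarrow> 'y2::finite pmf"
    and pU1 :: "'u1::finite pmf" and pU2 :: "'u2::finite pmf" and h1 :: "'u1 \<Rightarrow> 'v1::finite"
    and g1 :: "'y1 list \<Rightarrow> 'u1 list" and g2 :: "'y2 list \<Rightarrow> 'v1 list \<Rightarrow> 'u2 list"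
  assumes c1: "condition1 q2" and n: "n \<ge> 1"
    and f1: "\<forall>u. length u = n \<longrightarrow> length (f1 u) = n"
    and f2: "\<forall>u. length u = n \<longrightarrow> length (f2 u) = n"
  defines "\<epsilon> \<equiv> measure_pmf.prob (code_fun_law n q1 q2 pU1 pU2 f1 f2)
       {(us1, us2, y1, y2). (us1, us2) \<noteq> (g1 (lst n y1), g2 (lst n y2) (map h1 us1))}"
  shows "\<exists>(D :: (nat \<times> 'v1 list \<times> (nat \<Rightarrow> 'y1) \<times> (nat \<Rightarrow> 'y2)) pmf) k.
    finite (set_pmf D) \<and>
    ent pU1 \<le> 1 / n + \<epsilon> * log 2 CARD('u1)
       + ent (bind_pmf (bind_pmf D k) q1) - expec (bind_pmf D k) (\<lambda>x. ent (q1 x)) \<and>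
    ent pU2 \<le> 1 / n + \<epsilon> * log 2 CARD('u2)
       + max_output_entropy q2 - expec D (\<lambda>z. ent (bind_pmf (k z) (\<lambda>x. q2 x x0))) \<and>
    ent pU1 - ent (map_pmf h1 pU1) + ent pU2 \<le> 2 / n + \<epsilon> * log 2 CARD('u1) + \<epsilon> * log 2 CARD('u2)
       + max_output_entropy q2 - expec D (\<lambda>z. ent (bind_pmf (k z) (\<lambda>x. q2 x x0)))
       + expec D (\<lambda>z. ent (bind_pmf (k z) q1)) - expec (bind_pmf D k) (\<lambda>x. ent (q1 x))"
proof -
  define A where "A = replicate_pmf n pU1"
  define B where "B = replicate_pmf n pU2"
  define K1 where "K1 = (\<lambda>u. PiN n (\<lambda>i. q1 (f1 u ! i)))"
  define K2 where "K2 = (\<lambda>u u'. PiN n (\<lambda>i. q2 (f1 u ! i) (f2 u' ! i)))"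
  define KT where "KT = (\<lambda>u. PiN n (\<lambda>i. q2 (f1 u ! i) x0))"
  define Q where "Q = code_fun_law n q1 q2 pU1 pU2 f1 f2"
  \<comment> \<open>Only the laws of \<open>(u, y)\<close> and \<open>(map h1 u, t)\<close> matter
    for the comparison with the code, so the coupling of the two outputs is free. Conditional
    independence given \<open>u\<close> lets either of them be resampled without touching the
    other.\<close>
  define R where "R = do {u \<leftarrow> A; y \<leftarrow> K1 u; t \<leftarrow> KT u; return_pmf (u, y, t)}"
  have Q: "Q = do {u1 \<leftarrow> A; u2 \<leftarrow> B; y1 \<leftarrow> K1 u1; y2 \<leftarrow> K2 u1 u2; return_pmf (u1, u2, y1, y2)}"
    by (simp add: Q_def code_fun_law_def A_def B_def K1_def K2_def)
  have R_swap: "R = do {u \<leftarrow> A; t \<leftarrow> KT u; y \<leftarrow> K1 u; return_pmf (u, y, t)}"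
    unfolding R_def by (intro bind_pmf_cong refl bind_commute_pmf)
  define U :: "'u1 list \<times> 'u2 list \<times> (nat \<Rightarrow> 'y1) \<times> (nat \<Rightarrow> 'y2) \<Rightarrow> 'u1 list" where "U = (\<lambda>(u1, u2, y1, y2). u1)"
  define U' :: "'u1 list \<times> 'u2 list \<times> (nat \<Rightarrow> 'y1) \<times> (nat \<Rightarrow> 'y2) \<Rightarrow> 'u2 list" where "U' = (\<lambda>(u1, u2, y1, y2). u2)"
  define Y :: "'u1 list \<times> 'u2 list \<times> (nat \<Rightarrow> 'y1) \<times> (nat \<Rightarrow> 'y2) \<Rightarrow> nat \<Rightarrow> 'y1" where "Y = (\<lambda>(u1, u2, y1, y2). y1)"
  define Y' :: "'u1 list \<times> 'u2 list \<times> (nat \<Rightarrow> 'y1) \<times> (nat \<Rightarrow> 'y2) \<Rightarrow> nat \<Rightarrow> 'y2" where "Y' = (\<lambda>(u1, u2, y1, y2). y2)"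
  define V where "V = (\<lambda>\<omega>. map h1 (U \<omega>))"
  note rv = U_def U'_def Y_def Y'_def V_def
  have finA: "finite (set_pmf A)" and finB: "finite (set_pmf B)"
    by (auto simp: A_def B_def replicate_pmf_eq_Pi finite_set_PiN)
  have finK: "finite (set_pmf (K1 u))" "finite (set_pmf (K2 u u'))" "finite (set_pmf (KT u))" for u u'
    by (auto simp: K1_def K2_def KT_def finite_set_PiN)
  have finQ: "finite (set_pmf Q)" and finR: "finite (set_pmf R)"
    using finA finB finK by (auto simp: Q R_def)
  have setA: "length u = n" if "u \<in> set_pmf A" for u using that by (auto simp: A_def set_replicate_pmf)
  have setB: "length u = n" if "u \<in> set_pmf B" for u using that by (auto simp: B_def set_replicate_pmf)

  have entA: "ent A = n * ent pU1" and entB: "ent B = n * ent pU2"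
    and entV: "ent (map_pmf (map h1) A) = n * ent (map_pmf h1 pU1)"
    by (simp_all add: A_def B_def ent_replicate_pmf map_replicate_pmf)

  have mU: "map_pmf U Q = A" and mU': "map_pmf U' Q = B" and mV: "map_pmf V Q = map_pmf (map h1) A"
    by (simp_all add: Q rv map_bind_pmf bind_return_pmf' map_pmf_def bind_assoc_pmf bind_return_pmf)

  have fano1: "cent Q U Y \<le> 1 + \<epsilon> * (n * log 2 CARD('u1))"
  proof -
    have "cent Q U Y \<le> 1 + measure_pmf.prob Q {\<omega>. U \<omega> \<noteq> (\<lambda>y. g1 (lst n y)) (Y \<omega>)} * log 2 (real (CARD('u1) ^ n))"
      by (rule fano[OF finQ]) (use card_set_replicate_pmf[of n pU1] mU in \<open>simp flip: set_map_pmf add: A_def\<close>)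
    also have "log 2 (real (CARD('u1) ^ n)) = n * log 2 CARD('u1)" by (simp add: log_nat_power)
    also have "measure_pmf.prob Q {\<omega>. U \<omega> \<noteq> (\<lambda>y. g1 (lst n y)) (Y \<omega>)} \<le> \<epsilon>"
      unfolding \<epsilon>_def Q_def by (rule measure_pmf.finite_measure_mono) (auto simp: rv)
    finally show ?thesis by (simp add: mult_right_mono)
  qed
  have fano2: "cent Q U' (\<lambda>\<omega>. (Y' \<omega>, V \<omega>)) \<le> 1 + \<epsilon> * (n * log 2 CARD('u2))"
  proof -
    have "cent Q U' (\<lambda>\<omega>. (Y' \<omega>, V \<omega>)) \<le> 1 + measure_pmf.prob Q {\<omega>. U' \<omega> \<noteq> (\<lambda>(y, v). g2 (lst n y) v) (Y' \<omega>, V \<omega>)} * log 2 (real (CARD('u2) ^ n))"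
      by (rule fano[OF finQ]) (use card_set_replicate_pmf[of n pU2] mU' in \<open>simp flip: set_map_pmf add: B_def\<close>)
    also have "log 2 (real (CARD('u2) ^ n)) = n * log 2 CARD('u2)" by (simp add: log_nat_power)
    also have "measure_pmf.prob Q {\<omega>. U' \<omega> \<noteq> (\<lambda>(y, v). g2 (lst n y) v) (Y' \<omega>, V \<omega>)} \<le> \<epsilon>"
      unfolding \<epsilon>_def Q_def by (rule measure_pmf.finite_measure_mono) (auto simp: rv)
    finally show ?thesis by (simp add: mult_right_mono)
  qed

  have Y_U: "cent Q Y U = expec A (\<lambda>u. ent (K1 u))"
    by (rule cent_kernel[OF finQ]) (simp add: Q rv map_bind_pmf map_pmf_def bind_assoc_pmf bind_return_pmf)
  have Y_UV: "cent Q Y (\<lambda>\<omega>. (U \<omega>, V \<omega>)) = cent Q Y U"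
    by (rule cent_cong_Z) (auto simp: V_def)
  have U'_V: "cent Q U' V = ent B"
  proof -
    have "cent Q U' V = expec (map_pmf (map h1) A) (\<lambda>_. ent B)"
      by (rule cent_kernel[OF finQ]) (simp add: Q rv map_bind_pmf map_pmf_def bind_assoc_pmf bind_return_pmf)
    then show ?thesis by simp
  qed

  define AV where "AV = (\<lambda>v. cond_pmf A {u. map h1 u = v})"
  have dis: "bind_pmf A (\<lambda>u. map_pmf (Pair (map h1 u)) (M u))
      = bind_pmf (map_pmf (map h1) A) (\<lambda>v. map_pmf (Pair v) (bind_pmf (AV v) M))" for M :: "_ \<Rightarrow> (nat \<Rightarrow> 'y2) pmf"
    unfolding AV_def by (rule bind_pmf_disintegrate)
  have setAV: "set_pmf (AV v) \<subseteq> set_pmf A" if "v \<in> set_pmf (map_pmf (map h1) A)" for v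
    unfolding AV_def by (subst set_cond_pmf) (use that in auto)
  have T_V: "cent R (\<lambda>(u, y, t). t) (\<lambda>(u, y, t). map h1 u) = expec (map_pmf (map h1) A) (\<lambda>v. ent (bind_pmf (AV v) KT))"
  proof (rule cent_kernel[OF finR])
    have "map_pmf (\<lambda>\<omega>. ((\<lambda>(u, y, t). map h1 u) \<omega>, (\<lambda>(u, y, t). t) \<omega>)) R = bind_pmf A (\<lambda>u. map_pmf (Pair (map h1 u)) (KT u))"
      by (simp add: R_def map_bind_pmf map_pmf_def bind_assoc_pmf bind_return_pmf)
    then show "map_pmf (\<lambda>\<omega>. ((\<lambda>(u, y, t). map h1 u) \<omega>, (\<lambda>(u, y, t). t) \<omega>)) R
      = bind_pmf (map_pmf (map h1) A) (\<lambda>z. map_pmf (Pair z) (bind_pmf (AV z) KT))"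
      by (simp only: dis)
  qed
  \<comment> \<open>By independence of the sources, fixing the second word and \<open>v\<close>
    leaves the first word with its law \<open>AV v\<close>. Condition 1 then applies, for each such
    pair, to the encoded version of \<open>AV v\<close>.\<close>
  have Y'_UV: "cent Q Y' (\<lambda>\<omega>. (U' \<omega>, V \<omega>)) = cent R (\<lambda>(u, y, t). t) (\<lambda>(u, y, t). map h1 u)"
  proof -
    have "cent Q Y' (\<lambda>\<omega>. (U' \<omega>, V \<omega>))
      = expec (pair_pmf B (map_pmf (map h1) A)) (\<lambda>z. ent (bind_pmf (AV (snd z)) (\<lambda>u. K2 u (fst z))))"
    proof (rule cent_kernel[OF finQ])
      have "map_pmf (\<lambda>\<omega>. ((U' \<omega>, V \<omega>), Y' \<omega>)) Q = bind_pmf B (\<lambda>u'. map_pmf (\<lambda>(v, y). ((u', v), y)) (bind_pmf A (\<lambda>u. map_pmf (Pair (map h1 u)) (K2 u u'))))"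
        by (simp add: Q rv map_bind_pmf map_pmf_def bind_assoc_pmf bind_return_pmf) (rule bind_commute_pmf)
      also have "\<dots> = bind_pmf (pair_pmf B (map_pmf (map h1) A)) (\<lambda>z. map_pmf (Pair z) (bind_pmf (AV (snd z)) (\<lambda>u. K2 u (fst z))))"
        by (simp only: dis)
           (simp add: pair_pmf_def map_bind_pmf bind_assoc_pmf bind_return_pmf pmf.map_comp o_def bind_map_pmf)
      finally show "map_pmf (\<lambda>\<omega>. ((U' \<omega>, V \<omega>), Y' \<omega>)) Q = \<dots>" .
    qed
    also have "\<dots> = expec (pair_pmf B (map_pmf (map h1) A)) (\<lambda>z. ent (bind_pmf (AV (snd z)) KT))"
    proof (rule expec_cong)
      fix z assume z: "z \<in> set_pmf (pair_pmf B (map_pmf (map h1) A))"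
      have "ent (bind_pmf (map_pmf f1 (AV (snd z))) (\<lambda>x1. PiN n (\<lambda>i. q2 (x1 ! i) (f2 (fst z) ! i))))
         = ent (bind_pmf (map_pmf f1 (AV (snd z))) (\<lambda>x1. PiN n (\<lambda>i. q2 (x1 ! i) x0)))"
        by (rule condition1_block[OF c1 n]) (use z setAV[of "snd z"] in \<open>auto intro!: f1[rule_format] f2[rule_format] setA setB dest: subsetD\<close>)
      then show "ent (bind_pmf (AV (snd z)) (\<lambda>u. K2 u (fst z))) = ent (bind_pmf (AV (snd z)) KT)"
        by (simp add: bind_map_pmf K2_def KT_def)
    qed
    also have "\<dots> = expec (map_pmf snd (pair_pmf B (map_pmf (map h1) A))) (\<lambda>v. ent (bind_pmf (AV v) KT))"
      by (simp only: integral_map_pmf)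
    finally show ?thesis unfolding T_V map_snd_pair_pmf .
  qed

  have Y'_le: "ent (map_pmf Y' Q) \<le> n * max_output_entropy q2"
  proof -
    have "map_pmf Y' Q = map_pmf (\<lambda>\<omega> j. if j < n then Y' \<omega> j else undefined) Q"
      by (rule map_pmf_cong) (auto simp: Q rv K2_def fun_eq_iff dest: PiN_undefined)
    then have "ent (map_pmf Y' Q) \<le> (\<Sum>i<n. ent (map_pmf (\<lambda>\<omega>. Y' \<omega> i) Q))"
      using chain_le[OF finQ, where Y = Y' and n = n and d = undefined] by simp
    also have "\<dots> \<le> (\<Sum>i<n. max_output_entropy q2)"
    proof (rule sum_mono)
      fix i assume i: "i \<in> {..<n}"
      have comp: "map_pmf (\<lambda>f. f i) (K2 u u') = q2 (f1 u ! i) (f2 u' ! i)" for u u'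
        unfolding K2_def by (subst Pi_pmf_component) (use i in auto)
      have "map_pmf (\<lambda>\<omega>. Y' \<omega> i) Q = bind_pmf A (\<lambda>u. bind_pmf B (\<lambda>u'. map_pmf (\<lambda>f. f i) (K2 u u')))"
        by (simp add: Q rv map_bind_pmf map_pmf_def bind_assoc_pmf bind_return_pmf)
      \<comment> \<open>The input letters at one position inherit independence from the sources, so
        their product law competes in the supremum.\<close>
      also have "\<dots> = output_law q2 (map_pmf (\<lambda>u. f1 u ! i) A) (map_pmf (\<lambda>u. f2 u ! i) B)"
        by (simp add: comp output_law_def bind_map_pmf)
      finally have "ent (map_pmf (\<lambda>\<omega>. Y' \<omega> i) Q) = H (output_law q2 (map_pmf (\<lambda>u. f1 u ! i) A) (map_pmf (\<lambda>u. f2 u ! i) B)) (\<lambda>y. y)"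
        by (simp add: H_eq_ent)
      also have "\<dots> \<le> max_output_entropy q2"
        unfolding max_output_entropy_def
        using cSUP_upper[OF UNIV_I[of "(map_pmf (\<lambda>u. f1 u ! i) A, map_pmf (\<lambda>u. f2 u ! i) B)"] bdd_above_output_entropy[of q2]]
        by simp
      finally show "ent (map_pmf (\<lambda>\<omega>. Y' \<omega> i) Q) \<le> max_output_entropy q2" .
    qed
    finally show ?thesis by simp
  qed

  define S where "S = cent R (\<lambda>(u, y, t). t) (\<lambda>(u, y, t). map h1 u)"
  define E where "E = expec A (\<lambda>u. ent (K1 u))"
  have I1: "n * ent pU1 \<le> 1 + \<epsilon> * (n * log 2 CARD('u1)) + ent (map_pmf Y Q) - E"
    using mutual_info_commute[of U Q Y] fano1 by (simp add: mU entA Y_U E_def)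
  \<comment> \<open>\<open>H(U2)\<close> is split, given \<open>V\<close>, into an information term
    and the Fano term. The former is the entropy of \<open>Y2\<close> given \<open>V\<close>, at
    most \<open>n\<close> times the maximum, minus \<open>S\<close>.\<close>
  have I2: "n * ent pU2 \<le> 1 + \<epsilon> * (n * log 2 CARD('u2)) + n * max_output_entropy q2 - S"
    using cond_mutual_info_commute[of Q U' V Y'] fano2 U'_V entB Y'_UV Y'_le cent_le_ent[OF finQ, of Y' V]
    by (simp add: S_def)
  \<comment> \<open>Conditioning on \<open>V\<close> from the start makes the sum with
    \<open>I2\<close> contain exactly \<open>cent Q Y V - S\<close>, the difference treated by
    \<open>csiszar_sum\<close>.\<close>
  have I3: "n * (ent pU1 - ent (map_pmf h1 pU1)) \<le> 1 + \<epsilon> * (n * log 2 CARD('u1)) + cent Q Y V - E"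
  proof -
    have "cent Q U V = ent A - ent (map_pmf (map h1) A)"
      unfolding cent_def mV by (subst ent_map_cong[of Q _ U]) (auto simp: V_def mU)
    moreover have "cent Q U (\<lambda>\<omega>. (Y \<omega>, V \<omega>)) \<le> cent Q U Y"
      by (subst cent_cong_Z[of Q _ "\<lambda>\<omega>. (V \<omega>, Y \<omega>)"], blast, rule cent_reduce[OF finQ])
    ultimately show ?thesis
      using cond_mutual_info_commute[of Q U V Y] fano1 by (simp add: Y_UV Y_U E_def entA entV right_diff_distrib)
  qed

  define W where "W = (\<lambda>i (u, y, t). (map h1 u :: 'v1 list, res i y :: nat \<Rightarrow> 'y1, upward n (Suc i) t :: nat \<Rightarrow> 'y2))"
  define X where "X = (\<lambda>i (u, y :: nat \<Rightarrow> 'y1, t :: nat \<Rightarrow> 'y2). f1 u ! i)"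
  define c where "c = (\<lambda>i w. map_pmf (X i) (cond_pmf R {\<omega>. W i \<omega> = w}))"
  have Y_R: "cent R (\<lambda>(u, y, t). y i) (W i) = expec (map_pmf (W i) R) (\<lambda>w. ent (bind_pmf (c i w) q1))"
   and T_R: "cent R (\<lambda>(u, y, t). t i) (W i) = expec (map_pmf (W i) R) (\<lambda>w. ent (bind_pmf (c i w) (\<lambda>x. q2 x x0)))"
    if i: "i < n" for i
  proof -
    have "map_pmf (\<lambda>\<omega>. (W i \<omega>, (\<lambda>(u, y, t). y i) \<omega>)) R = bind_pmf R (\<lambda>\<omega>. map_pmf (Pair (W i \<omega>)) (q1 (X i \<omega>)))"
    proof -
      \<comment> \<open>The prefix in \<open>W i\<close> ends before position \<open>i\<close> and
        the suffix begins after it. Neither output letter at \<open>i\<close> is read, so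
        \<open>Pi_pmf_resample\<close> applies to both outputs.\<close>
      have 1: "map_pmf (\<lambda>y. (W i (u, y, t), y i)) (K1 u) = bind_pmf (K1 u) (\<lambda>y. map_pmf (Pair (W i (u, y, t))) (q1 (f1 u ! i)))" for u t
        unfolding K1_def by (rule Pi_pmf_resample) (use i in \<open>auto simp: W_def res_def fun_eq_iff\<close>)
      have "map_pmf (\<lambda>\<omega>. (W i \<omega>, (\<lambda>(u, y, t). y i) \<omega>)) R = bind_pmf A (\<lambda>u. bind_pmf (KT u) (\<lambda>t. map_pmf (\<lambda>y. (W i (u, y, t), y i)) (K1 u)))"
        unfolding R_swap by (simp add: map_bind_pmf map_pmf_def bind_assoc_pmf bind_return_pmf)
      also have "\<dots> = bind_pmf R (\<lambda>\<omega>. map_pmf (Pair (W i \<omega>)) (q1 (X i \<omega>)))"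
        unfolding R_swap 1 by (simp add: X_def bind_assoc_pmf bind_return_pmf)
      finally show ?thesis .
    qed
    also have "\<dots> = bind_pmf (map_pmf (W i) R) (\<lambda>w. map_pmf (Pair w) (bind_pmf (c i w) q1))"
      by (subst bind_pmf_disintegrate) (simp add: c_def bind_map_pmf)
    finally show "cent R (\<lambda>(u, y, t). y i) (W i) = expec (map_pmf (W i) R) (\<lambda>w. ent (bind_pmf (c i w) q1))"
      by (rule cent_kernel[OF finR])
    have "map_pmf (\<lambda>\<omega>. (W i \<omega>, (\<lambda>(u, y, t). t i) \<omega>)) R = bind_pmf R (\<lambda>\<omega>. map_pmf (Pair (W i \<omega>)) (q2 (X i \<omega>) x0))"
    proof -
      have 1: "map_pmf (\<lambda>t. (W i (u, y, t), t i)) (KT u) = bind_pmf (KT u) (\<lambda>t. map_pmf (Pair (W i (u, y, t))) (q2 (f1 u ! i) x0))" for u y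
        unfolding KT_def by (rule Pi_pmf_resample) (use i in \<open>auto simp: W_def upward_def fun_eq_iff\<close>)
      have "map_pmf (\<lambda>\<omega>. (W i \<omega>, (\<lambda>(u, y, t). t i) \<omega>)) R = bind_pmf A (\<lambda>u. bind_pmf (K1 u) (\<lambda>y. map_pmf (\<lambda>t. (W i (u, y, t), t i)) (KT u)))"
        unfolding R_def by (simp add: map_bind_pmf map_pmf_def bind_assoc_pmf bind_return_pmf)
      also have "\<dots> = bind_pmf R (\<lambda>\<omega>. map_pmf (Pair (W i \<omega>)) (q2 (X i \<omega>) x0))"
        unfolding R_def 1 by (simp add: X_def bind_assoc_pmf bind_return_pmf)
      finally show ?thesis .
    qed
    also have "\<dots> = bind_pmf (map_pmf (W i) R) (\<lambda>w. map_pmf (Pair w) (bind_pmf (c i w) (\<lambda>x. q2 x x0)))"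
      by (subst bind_pmf_disintegrate) (simp add: c_def bind_map_pmf)
    finally show "cent R (\<lambda>(u, y, t). t i) (W i) = expec (map_pmf (W i) R) (\<lambda>w. ent (bind_pmf (c i w) (\<lambda>x. q2 x x0)))"
      by (rule cent_kernel[OF finR])
  qed

  have bel: "res n y = y" if "y \<in> set_pmf (K1 u)" for y u
    using PiN_undefined that by (fastforce simp: res_def fun_eq_iff K1_def)
  have upw: "upward n 0 t = t" if "t \<in> set_pmf (KT u)" for t u
    using PiN_undefined that by (fastforce simp: upward_def fun_eq_iff KT_def)

  have Y_V: "cent Q Y V = cent R (\<lambda>\<omega>. res n ((\<lambda>(u, y, t). y) \<omega>)) (\<lambda>(u, y, t). map h1 u)"
  proof -
    have "map_pmf (\<lambda>\<omega>. (U \<omega>, Y \<omega>)) Q = map_pmf (\<lambda>(u, y, t). (u, res n y)) R"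
      by (auto simp add: Q R_def rv map_bind_pmf map_pmf_def bind_assoc_pmf bind_return_pmf bel intro!: bind_pmf_cong)
    then have "cent (map_pmf (\<lambda>\<omega>. (U \<omega>, Y \<omega>)) Q) snd (\<lambda>z. map h1 (fst z)) = cent (map_pmf (\<lambda>(u, y, t). (u, res n y)) R) snd (\<lambda>z. map h1 (fst z))"
      by simp
    then show ?thesis by (simp add: cent_map V_def case_prod_unfold)
  qed
  have S_up: "S = cent R (\<lambda>\<omega>. upward n 0 ((\<lambda>(u, y, t). t) \<omega>)) (\<lambda>(u, y, t). map h1 u)"
  proof -
    have "map_pmf (\<lambda>(u, y, t). (u, t)) R = map_pmf (\<lambda>(u, y, t). (u, upward n 0 t)) R"
      by (rule map_pmf_cong) (auto simp: R_def upw)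
    then have "cent (map_pmf (\<lambda>(u, y, t). (u, t)) R) snd (\<lambda>z. map h1 (fst z)) = cent (map_pmf (\<lambda>(u, y, t). (u, upward n 0 t)) R) snd (\<lambda>z. map h1 (fst z))"
      by simp
    then show ?thesis by (simp add: cent_map S_def case_prod_unfold)
  qed

  have csum: "cent Q Y V - S = (\<Sum>i<n. expec (map_pmf (W i) R) (\<lambda>w. ent (bind_pmf (c i w) q1)))
     - (\<Sum>i<n. expec (map_pmf (W i) R) (\<lambda>w. ent (bind_pmf (c i w) (\<lambda>x. q2 x x0))))"
    unfolding Y_V S_up csiszar_sum sum_subtractf[symmetric]
    by (intro sum.cong refl) (use Y_R T_R in \<open>simp add: W_def case_prod_unfold\<close>)
  have S_ge: "(\<Sum>i<n. expec (map_pmf (W i) R) (\<lambda>w. ent (bind_pmf (c i w) (\<lambda>x. q2 x x0)))) \<le> S"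
  proof -
    have "(\<Sum>i<n. expec (map_pmf (W i) R) (\<lambda>w. ent (bind_pmf (c i w) (\<lambda>x. q2 x x0))))
        = (\<Sum>i<n. cent R (\<lambda>\<omega>. (\<lambda>(u, y, t). t) \<omega> i) (\<lambda>\<omega>. ((\<lambda>(u, y, t). map h1 u) \<omega>, res i ((\<lambda>(u, y, t). y) \<omega>), upward n (Suc i) ((\<lambda>(u, y, t). t) \<omega>))))"
      by (intro sum.cong refl) (use T_R in \<open>simp add: W_def case_prod_unfold\<close>)
    also have "\<dots> \<le> S" unfolding S_up by (rule chain_upward[OF finR])
    finally show ?thesis .
  qed

  define D where "D = bind_pmf (pmf_of_set {..<n}) (\<lambda>i. map_pmf (Pair i) (map_pmf (W i) R))"
  define k where "k = (\<lambda>(i, w). c i w)"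
  have n0: "{..<n} \<noteq> {}" using n by (simp add: lessThan_empty_iff)
  have finD: "finite (set_pmf D)" unfolding D_def using n0 finR by auto
  have exD: "expec D F = (\<Sum>i<n. expec (map_pmf (W i) R) (\<lambda>w. F (i, w))) / n" for F
    unfolding D_def using n0 finR by (subst expec_bind) (auto simp: integral_pmf_of_set)
  have mixX: "bind_pmf (map_pmf (W i) R) (c i) = map_pmf (X i) R" for i
  proof -
    have "map_pmf snd (bind_pmf R (\<lambda>u. map_pmf (Pair (W i u)) (return_pmf (X i u))))
      = bind_pmf (map_pmf (W i) R) (c i)"
      by (subst bind_pmf_disintegrate) (simp add: map_bind_pmf pmf.map_comp o_def c_def map_pmf_def bind_assoc_pmf bind_return_pmf)
    then show ?thesis by (simp add: map_bind_pmf map_pmf_def bind_assoc_pmf bind_return_pmf)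
  qed
  have Dk: "bind_pmf D k = bind_pmf (pmf_of_set {..<n}) (\<lambda>i. map_pmf (X i) R)"
    unfolding D_def by (simp add: bind_assoc_pmf bind_map_pmf k_def flip: mixX)
  have XA: "map_pmf (X i) R = map_pmf (\<lambda>u. f1 u ! i) A" for i
    by (simp add: R_def X_def map_bind_pmf map_pmf_def bind_assoc_pmf bind_return_pmf)
  have E_eq: "E = n * expec (bind_pmf D k) (\<lambda>x. ent (q1 x))"
  proof -
    have "E = expec A (\<lambda>u. \<Sum>i<n. ent (q1 (f1 u ! i)))"
      unfolding E_def K1_def by (subst ent_Pi_pmf) auto
    also have "\<dots> = (\<Sum>i<n. expec A (\<lambda>u. ent (q1 (f1 u ! i))))"
      using finA by (subst Bochner_Integration.integral_sum) (auto simp: integrable_measure_pmf_finite)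
    also have "\<dots> = (\<Sum>i<n. expec (map_pmf (X i) R) (\<lambda>x. ent (q1 x)))"
      unfolding XA by simp
    also have "\<dots> = n * expec (bind_pmf D k) (\<lambda>x. ent (q1 x))"
      unfolding Dk using n n0 finR by (subst expec_bind) (auto simp: integral_pmf_of_set)
    finally show ?thesis .
  qed
  \<comment> \<open>The position is part of \<open>D\<close>, but \<open>H(Y1)\<close> is taken
    under the mixture over positions; concavity makes that at least the average over
    positions.\<close>
  have Y_le: "ent (map_pmf Y Q) \<le> n * ent (bind_pmf (bind_pmf D k) q1)"
  proof -
    have "map_pmf Y Q = map_pmf (\<lambda>\<omega> j. if j < n then Y \<omega> j else undefined) Q"
      by (rule map_pmf_cong) (auto simp: Q rv K1_def fun_eq_iff dest: PiN_undefined)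
    then have "ent (map_pmf Y Q) \<le> (\<Sum>i<n. ent (map_pmf (\<lambda>\<omega>. Y \<omega> i) Q))"
      using chain_le[OF finQ, where Y = Y and n = n and d = undefined] by simp
    also have "\<dots> = (\<Sum>i<n. ent (bind_pmf (map_pmf (X i) R) q1))"
    proof (rule sum.cong[OF refl])
      fix i assume i: "i \<in> {..<n}"
      have comp: "map_pmf (\<lambda>f. f i) (K1 u) = q1 (f1 u ! i)" for u
        unfolding K1_def by (subst Pi_pmf_component) (use i in auto)
      have "map_pmf (\<lambda>\<omega>. Y \<omega> i) Q = bind_pmf A (\<lambda>u. map_pmf (\<lambda>f. f i) (K1 u))"
        by (simp add: Q rv map_bind_pmf map_pmf_def bind_assoc_pmf bind_return_pmf)
      then show "ent (map_pmf (\<lambda>\<omega>. Y \<omega> i) Q) = ent (bind_pmf (map_pmf (X i) R) q1)"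
        by (simp add: comp XA bind_map_pmf)
    qed
    also have "\<dots> = n * expec (pmf_of_set {..<n}) (\<lambda>i. ent (bind_pmf (map_pmf (X i) R) q1))"
      using n n0 by (simp add: integral_pmf_of_set)
    also have "\<dots> \<le> n * ent (bind_pmf (pmf_of_set {..<n}) (\<lambda>i. bind_pmf (map_pmf (X i) R) q1))"
      using n0 by (intro mult_left_mono ent_mixture_le) auto
    finally show ?thesis unfolding Dk bind_assoc_pmf .
  qed
  have exq1: "(\<Sum>i<n. expec (map_pmf (W i) R) (\<lambda>w. ent (bind_pmf (c i w) q1))) = n * expec D (\<lambda>z. ent (bind_pmf (k z) q1))"
   and exq2: "(\<Sum>i<n. expec (map_pmf (W i) R) (\<lambda>w. ent (bind_pmf (c i w) (\<lambda>x. q2 x x0)))) = n * expec D (\<lambda>z. ent (bind_pmf (k z) (\<lambda>x. q2 x x0)))"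
    unfolding exD k_def using n by auto
  have div: "a \<le> m / n + b" if "real n * a \<le> m + real n * b" for a m b
    using that n by (simp add: field_simps)
  show ?thesis
  proof (intro exI[of _ D] exI[of _ k] conjI finD)
    have "n * ent pU1 \<le> 1 + n * (\<epsilon> * log 2 CARD('u1) + ent (bind_pmf (bind_pmf D k) q1) - expec (bind_pmf D k) (\<lambda>x. ent (q1 x)))"
      using I1 Y_le E_eq by (simp add: algebra_simps)
    from div[OF this] show "ent pU1 \<le> 1 / n + \<epsilon> * log 2 CARD('u1)
       + ent (bind_pmf (bind_pmf D k) q1) - expec (bind_pmf D k) (\<lambda>x. ent (q1 x))" by simp
    have "n * ent pU2 \<le> 1 + n * (\<epsilon> * log 2 CARD('u2) + max_output_entropy q2 - expec D (\<lambda>z. ent (bind_pmf (k z) (\<lambda>x. q2 x x0))))"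
      using I2 S_ge exq2 by (simp add: algebra_simps)
    from div[OF this] show "ent pU2 \<le> 1 / n + \<epsilon> * log 2 CARD('u2)
       + max_output_entropy q2 - expec D (\<lambda>z. ent (bind_pmf (k z) (\<lambda>x. q2 x x0)))" by simp
    have "n * (ent pU1 - ent (map_pmf h1 pU1) + ent pU2) \<le> 2 + n * (\<epsilon> * log 2 CARD('u1) + \<epsilon> * log 2 CARD('u2)
       + max_output_entropy q2 - expec D (\<lambda>z. ent (bind_pmf (k z) (\<lambda>x. q2 x x0)))
       + expec D (\<lambda>z. ent (bind_pmf (k z) q1)) - expec (bind_pmf D k) (\<lambda>x. ent (q1 x)))"
      using I2 I3 csum exq1 exq2 E_eq by (simp add: algebra_simps)
    from div[OF this] show "ent pU1 - ent (map_pmf h1 pU1) + ent pU2 \<le> 2 / n + \<epsilon> * log 2 CARD('u1) + \<epsilon> * log 2 CARD('u2)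
       + max_output_entropy q2 - expec D (\<lambda>z. ent (bind_pmf (k z) (\<lambda>x. q2 x x0)))
       + expec D (\<lambda>z. ent (bind_pmf (k z) q1)) - expec (bind_pmf D k) (\<lambda>x. ent (q1 x))" by simp
  qed
qed

section \<open>Removing the slack by compactness\<close>

definition neg_xlog :: "real \<Rightarrow> real" where
  "neg_xlog t = - t * log 2 t"

text \<open>Only the endpoint 0 is delicate: substituting the reciprocal reduces it to the decay of
  \<open>ln x / x\<close> at infinity.\<close>

lemma continuous_on_neg_xlog: "continuous_on {0..} neg_xlog"
proof (unfold continuous_on_eq_continuous_within, rule ballI)
  fix t :: real assume "t \<in> {0..}"
  show "continuous (at t within {0..}) neg_xlog"
  proof (cases "t = 0")
    case True
    have "((\<lambda>x::real. ln (inverse x) / inverse x) \<longlongrightarrow> 0) (at_right 0)"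
      by (rule filterlim_compose[OF ln_x_over_x_tendsto_0 filterlim_inverse_at_top_right])
    then have "((\<lambda>x::real. ln (inverse x) / inverse x / ln 2) \<longlongrightarrow> 0 / ln 2) (at_right 0)"
      by (intro tendsto_divide tendsto_const) auto
    moreover have "\<forall>\<^sub>F x in at_right (0::real). ln (inverse x) / inverse x / ln 2 = neg_xlog x"
      using eventually_at_right_less[of "0::real"]
      by eventually_elim (simp add: neg_xlog_def log_def ln_inverse divide_inverse mult_ac)
    ultimately have "(neg_xlog \<longlongrightarrow> 0) (at_right 0)"
      using tendsto_cong by force
    then show ?thesis
      by (simp add: True continuous_within at_within_Ici_at_right) (simp add: neg_xlog_def)
  next
    case False
    with \<open>t \<in> {0..}\<close> have "t > 0" by simp
    then have "isCont (\<lambda>t. - t * log 2 t) t"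
      unfolding log_def by (intro continuous_intros) auto
    then show ?thesis unfolding neg_xlog_def[abs_def] by (rule continuous_at_imp_continuous_at_within)
  qed
qed

lemma ent_UNIV: "ent (p :: 'a::finite pmf) = (\<Sum>x\<in>UNIV. neg_xlog (pmf p x))"
proof -
  have "(\<Sum>x\<in>set_pmf p. pmf p x * log 2 (pmf p x)) = (\<Sum>x\<in>UNIV. pmf p x * log 2 (pmf p x))"
    by (rule sum.mono_neutral_left) (auto simp: set_pmf_iff)
  then show ?thesis by (simp add: ent_sum neg_xlog_def sum_negf)
qed

lemma expec_UNIV: "expec (p :: 'a::finite pmf) f = (\<Sum>x\<in>UNIV. pmf p x * f x)"
  using integral_measure_pmf[of UNIV p f] by simp

text \<open>Coordinates of a law in Euclidean space, where compactness and convex hulls are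
  available.\<close>

definition pvec :: "'a::finite pmf \<Rightarrow> real ^ 'a" where
  "pvec p = (\<chi> x. pmf p x)"

lemma pvec_nth [simp]: "pvec p $ x = pmf p x"
  by (simp add: pvec_def)

definition prob_simplex :: "(real ^ 'a::finite) set" where
  "prob_simplex = {v. (\<forall>x. 0 \<le> v $ x) \<and> (\<Sum>x\<in>UNIV. v $ x) = 1}"

lemma range_pvec: "range (pvec :: 'a::finite pmf \<Rightarrow> _) = prob_simplex"
proof (intro equalityI subsetI)
  fix v :: "real ^ 'a" assume "v \<in> range pvec"
  then obtain p :: "'a pmf" where "v = pvec p" by blast
  then show "v \<in> prob_simplex" using sum_pmf_eq_1[of UNIV p] by (simp add: prob_simplex_def)
next
  fix v :: "real ^ 'a" assume v: "v \<in> prob_simplex"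
  have "(\<integral>\<^sup>+ x. ennreal (v $ x) \<partial>count_space UNIV) = 1"
    using v by (subst nn_integral_count_space_finite) (auto simp: prob_simplex_def sum_ennreal)
  then have "pmf (embed_pmf (\<lambda>x. v $ x)) x = v $ x" for x
    using v by (intro pmf_embed_pmf) (auto simp: prob_simplex_def)
  then have "v = pvec (embed_pmf (\<lambda>x. v $ x))" by (simp add: vec_eq_iff)
  then show "v \<in> range pvec" by blast
qed

lemma compact_prob_simplex: "compact (prob_simplex :: (real ^ 'a::finite) set)"
proof -
  have "prob_simplex \<subseteq> (cbox 0 1 :: (real ^ 'a) set)"
  proof
    fix v :: "real ^ 'a" assume v: "v \<in> prob_simplex"
    have "v $ x \<le> (\<Sum>x\<in>UNIV. v $ x)" for x
      by (rule member_le_sum) (use v in \<open>auto simp: prob_simplex_def\<close>)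
    then show "v \<in> cbox 0 1" using v by (auto simp: prob_simplex_def mem_box_cart)
  qed
  then have "bounded (prob_simplex :: (real ^ 'a) set)" by (rule bounded_subset[OF bounded_cbox])
  moreover have "closed (prob_simplex :: (real ^ 'a) set)"
    unfolding prob_simplex_def by (intro closed_Collect_conj closed_Collect_all closed_Collect_le closed_Collect_eq continuous_intros)
  ultimately show ?thesis by (simp add: compact_eq_bounded_closed)
qed

lemma convex_prob_simplex: "convex (prob_simplex :: (real ^ 'a::finite) set)"
  unfolding convex_def prob_simplex_def
  by (auto simp: sum.distrib sum_distrib_left[symmetric])

text \<open>Output entropy as a function of the coordinate vector of the input law. The inner sums
  are linear, so continuity reduces to that of \<open>neg_xlog\<close>.\<close>

definition out_ent :: "('a::finite \<Rightarrow> 'b::finite pmf) \<Rightarrow> real ^ 'a \<Rightarrow> real" where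
  "out_ent q v = (\<Sum>y\<in>UNIV. neg_xlog (\<Sum>x\<in>UNIV. v $ x * pmf (q x) y))"

lemma out_ent_pvec: "out_ent q (pvec p) = ent (bind_pmf p q)"
  unfolding out_ent_def ent_UNIV pmf_bind expec_UNIV by simp

lemma continuous_on_out_ent: "continuous_on prob_simplex (out_ent q)"
  unfolding out_ent_def[abs_def]
proof (rule continuous_on_sum)
  fix y
  show "continuous_on prob_simplex (\<lambda>v. neg_xlog (\<Sum>x\<in>UNIV. v $ x * pmf (q x) y))"
    by (rule continuous_on_compose2[OF continuous_on_neg_xlog])
       (auto simp: prob_simplex_def intro!: sum_nonneg continuous_intros)
qed

section \<open>Compactness of the achievable entropy triples\<close>

context
  fixes q :: "'x::finite \<Rightarrow> 'y::finite pmf" and r :: "'x \<Rightarrow> 'z::finite pmf"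
begin

text \<open>The whole input law is kept because the bound on \<open>H(U1)\<close> uses the entropy
  of the averaged output, which is not an average over \<open>W\<close>. The other two coordinates
  do average under mixing, to the conditional output entropies given \<open>W\<close>.\<close>

definition entropy_point :: "'x pmf \<Rightarrow> (real ^ 'x) \<times> real \<times> real" where
  "entropy_point p = (pvec p, ent (bind_pmf p q), ent (bind_pmf p r))"

lemma compact_range_entropy_point: "compact (range entropy_point)"
proof -
  have "range entropy_point = (\<lambda>v. (v, out_ent q v, out_ent r v)) ` prob_simplex"
    unfolding range_pvec[symmetric] by (auto simp: entropy_point_def out_ent_pvec image_iff)
  then show ?thesis
    by (auto intro!: compact_continuous_image continuous_intros continuous_on_out_ent compact_prob_simplex)
qed

lemma mixture_in_hull:
  assumes "finite (set_pmf D)"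
  shows "(pvec (bind_pmf D k), expec D (\<lambda>z. ent (bind_pmf (k z) q)), expec D (\<lambda>z. ent (bind_pmf (k z) r)))
    \<in> convex hull (range entropy_point)"
proof -
  have "(\<Sum>z\<in>set_pmf D. pmf D z *\<^sub>R entropy_point (k z)) \<in> convex hull (range entropy_point)"
    using assms by (intro convex_sum convex_convex_hull) (auto simp: sum_pmf_eq_1 hull_inc)
  also have "(\<Sum>z\<in>set_pmf D. pmf D z *\<^sub>R entropy_point (k z))
    = (pvec (bind_pmf D k), expec D (\<lambda>z. ent (bind_pmf (k z) q)), expec D (\<lambda>z. ent (bind_pmf (k z) r)))"
    using assms by (simp add: entropy_point_def sum_prod vec_eq_iff pmf_bind expec_sum)
  finally show ?thesis .
qed

text \<open>The indices of a finite convex combination become the values of the auxiliary variable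
  and its weights their law. This replaces an auxiliary variable of arbitrary type by a finitely
  supported one on the naturals.\<close>

lemma hull_eq_mixture:
  assumes "z \<in> convex hull (range entropy_point)"
  obtains W :: "nat pmf" and k where "finite (set_pmf W)"
    "z = (pvec (bind_pmf W k), expec W (\<lambda>w. ent (bind_pmf (k w) q)), expec W (\<lambda>w. ent (bind_pmf (k w) r)))"
proof -
  obtain n u x where ux': "\<forall>i\<in>{1::nat..n}. 0 \<le> u i \<and> x i \<in> range entropy_point"
    and u1: "sum u {1..n} = 1" and z: "(\<Sum>i = 1..n. u i *\<^sub>R x i) = z"
    using assms unfolding convex_hull_indexed mem_Collect_eq by blast
  then have ux: "\<And>i. i \<in> {1..n} \<Longrightarrow> 0 \<le> u i \<and> x i \<in> range entropy_point" by blast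
  have "\<forall>i\<in>{1..n}. \<exists>p. x i = entropy_point p" using ux by blast
  from bchoice[OF this] obtain k where k: "\<And>i. i \<in> {1..n} \<Longrightarrow> x i = entropy_point (k i)" by blast
  define W where "W = embed_pmf (\<lambda>i. if i \<in> {1..n} then u i else 0)"
  have pW: "pmf W i = (if i \<in> {1..n} then u i else 0)" for i
  proof -
    have "(\<integral>\<^sup>+ i. ennreal (if i \<in> {1..n} then u i else 0) \<partial>count_space UNIV)
        = (\<integral>\<^sup>+ i. ennreal (u i) * indicator {1..n} i \<partial>count_space UNIV)"
      by (intro nn_integral_cong) (auto simp: indicator_def)
    also have "\<dots> = (\<integral>\<^sup>+ i. ennreal (u i) \<partial>count_space {1..n})"
      by (subst nn_integral_count_space_indicator) auto
    also have "\<dots> = (\<Sum>i\<in>{1..n}. ennreal (u i))"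
      by (rule nn_integral_count_space_finite) simp
    also have "\<dots> = ennreal (sum u {1..n})"
      by (rule sum_ennreal) (use ux in blast)
    finally show ?thesis
      unfolding W_def using ux u1 by (intro pmf_embed_pmf) auto
  qed
  have sub: "set_pmf W \<subseteq> {1..n}" by (auto simp: set_pmf_iff pW split: if_splits)
  then have fin: "finite (set_pmf W)" by (rule finite_subset) simp
  have ex: "expec W f = (\<Sum>i = 1..n. u i * f i)" for f
  proof -
    have "expec W f = (\<Sum>i\<in>{1..n}. pmf W i *\<^sub>R f i)"
      by (rule integral_measure_pmf) (use sub in auto)
    then show ?thesis by (simp add: pW)
  qed
  have "z = (\<Sum>i = 1..n. u i *\<^sub>R entropy_point (k i))"
    unfolding z[symmetric] by (rule sum.cong) (auto simp: k)
  also have "\<dots> = (pvec (bind_pmf W k), expec W (\<lambda>w. ent (bind_pmf (k w) q)), expec W (\<lambda>w. ent (bind_pmf (k w) r)))"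
    by (simp add: entropy_point_def sum_prod vec_eq_iff pmf_bind ex)
  finally show ?thesis using that fin by blast
qed

text \<open>The approximate witnesses may have growing supports and need not converge as laws. Their
  images in one fixed compact hull are comparable, and a best point of the hull is again realised by
  a mixture.\<close>

lemma mixture_limit:
  fixes a1 a2 a3 \<tau> :: real and c :: "'x \<Rightarrow> real"
  assumes ex: "\<And>\<delta>. \<delta> > 0 \<Longrightarrow> \<exists>(D :: 'd pmf) k. finite (set_pmf D) \<and>
      a1 \<le> \<delta> + ent (bind_pmf (bind_pmf D k) q) - expec (bind_pmf D k) c \<and>
      a2 \<le> \<delta> + \<tau> - expec D (\<lambda>z. ent (bind_pmf (k z) r)) \<and>
      a3 \<le> \<delta> + \<tau> - expec D (\<lambda>z. ent (bind_pmf (k z) r)) + expec D (\<lambda>z. ent (bind_pmf (k z) q)) - expec (bind_pmf D k) c"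
  shows "\<exists>(W :: nat pmf) k. finite (set_pmf W) \<and>
      a1 \<le> ent (bind_pmf (bind_pmf W k) q) - expec (bind_pmf W k) c \<and>
      a2 \<le> \<tau> - expec W (\<lambda>z. ent (bind_pmf (k z) r)) \<and>
      a3 \<le> \<tau> - expec W (\<lambda>z. ent (bind_pmf (k z) r)) + expec W (\<lambda>z. ent (bind_pmf (k z) q)) - expec (bind_pmf W k) c"
proof -
  let ?C = "convex hull (range entropy_point)"
  define l where "l v = (\<Sum>x\<in>UNIV. v $ x * c x)" for v :: "real ^ 'x"
  \<comment> \<open>The smallest of the three margins. Its maximum over the hull is at least
    \<open>- \<delta>\<close> for every positive \<open>\<delta>\<close>, hence nonnegative.\<close>
  define s where "s = (\<lambda>(v, s, t). min (out_ent q v - l v - a1) (min (\<tau> - t - a2) (\<tau> - t + s - l v - a3)))"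
  have l: "l (pvec p) = expec p c" for p by (simp add: l_def expec_UNIV)
  have comp: "compact ?C" by (rule compact_convex_hull[OF compact_range_entropy_point])
  \<comment> \<open>Continuity of the output entropy is established on the simplex; convexity keeps
    the first coordinate of every hull point there.\<close>
  have sub: "?C \<subseteq> prob_simplex \<times> UNIV"
  proof (rule hull_minimal)
    show "range entropy_point \<subseteq> prob_simplex \<times> UNIV" by (auto simp: entropy_point_def range_pvec[symmetric])
  qed (intro convex_Times convex_prob_simplex convex_UNIV)
  have "continuous_on ?C s"
    unfolding s_def l_def case_prod_unfold
    by (intro continuous_intros continuous_on_compose2[OF continuous_on_out_ent]) (use sub in auto)
  with comp obtain z where z: "z \<in> ?C" and max: "\<And>z'. z' \<in> ?C \<Longrightarrow> s z' \<le> s z"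
    using continuous_attains_sup[of ?C s] by force
  have "- \<delta> \<le> s z" if \<delta>: "\<delta> > 0" for \<delta>
  proof -
    obtain D :: "'d pmf" and k where fin: "finite (set_pmf D)" and
      "a1 \<le> \<delta> + ent (bind_pmf (bind_pmf D k) q) - expec (bind_pmf D k) c"
      "a2 \<le> \<delta> + \<tau> - expec D (\<lambda>z. ent (bind_pmf (k z) r))"
      "a3 \<le> \<delta> + \<tau> - expec D (\<lambda>z. ent (bind_pmf (k z) r)) + expec D (\<lambda>z. ent (bind_pmf (k z) q)) - expec (bind_pmf D k) c"
      using ex[OF \<delta>] by blast
    then have "- \<delta> \<le> s (pvec (bind_pmf D k), expec D (\<lambda>z. ent (bind_pmf (k z) q)), expec D (\<lambda>z. ent (bind_pmf (k z) r)))"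
      by (simp add: s_def l out_ent_pvec)
    also have "\<dots> \<le> s z" by (rule max[OF mixture_in_hull[OF fin]])
    finally show ?thesis .
  qed
  then have "0 \<le> s z + \<delta>" if "\<delta> > 0" for \<delta>
    using that by force
  then have "0 \<le> s z" by (rule field_le_epsilon)
  moreover obtain W :: "nat pmf" and k where fin: "finite (set_pmf W)" and
    "z = (pvec (bind_pmf W k), expec W (\<lambda>w. ent (bind_pmf (k w) q)), expec W (\<lambda>w. ent (bind_pmf (k w) r)))"
    using hull_eq_mixture[OF z] by blast
  ultimately show ?thesis
    by (intro exI[of _ W] exI[of _ k]) (simp add: s_def l out_ent_pvec)
qed

end

lemma converse:
  fixes ch :: "'x1::finite \<Rightarrow> 'x2::finite \<Rightarrow> ('y1::finite \<times> 'y2::finite) pmf"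
    and q1 :: "'x1 \<Rightarrow> 'y1 pmf" and q2 :: "'x1 \<Rightarrow> 'x2 \<Rightarrow> 'y2 pmf"
    and pU1 :: "'u1::finite pmf" and pU2 :: "'u2::finite pmf"
    and h1 :: "'u1 \<Rightarrow> 'v1::finite"
  assumes ch: "\<And>x1 x2. ch x1 x2 = pair_pmf (q1 x1) (q2 x1 x2)"
    and c1: "condition1 q2"
    and rel: "reliable_transmission ch pU1 h1 pU2"
  shows "\<exists>(W :: nat pmf) k. finite (set_pmf W) \<and>
      ent pU1 \<le> ent (bind_pmf (bind_pmf W k) q1) - expec (bind_pmf W k) (\<lambda>x. ent (q1 x)) \<and>
      ent pU2 \<le> max_output_entropy q2 - expec W (\<lambda>w. ent (bind_pmf (k w) (\<lambda>x. q2 x x0))) \<and>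
      ent pU1 - ent (map_pmf h1 pU1) + ent pU2
        \<le> max_output_entropy q2 - expec W (\<lambda>w. ent (bind_pmf (k w) (\<lambda>x. q2 x x0)))
          + expec W (\<lambda>w. ent (bind_pmf (k w) q1)) - expec (bind_pmf W k) (\<lambda>x. ent (q1 x))"
proof (rule mixture_limit[where q = q1 and r = "\<lambda>x. q2 x x0" and c = "\<lambda>x. ent (q1 x)"
      and \<tau> = "max_output_entropy q2" and ?a1.0 = "ent pU1" and ?a2.0 = "ent pU2"
      and ?a3.0 = "ent pU1 - ent (map_pmf h1 pU1) + ent pU2"])
  fix \<delta> :: real assume \<delta>: "\<delta> > 0"
  let ?L1 = "log 2 (real CARD('u1))" and ?L2 = "log 2 (real CARD('u2))"
  obtain f1 :: "nat \<Rightarrow> 'u1 list \<Rightarrow> 'x1 list" and f2 :: "nat \<Rightarrow> 'u2 list \<Rightarrow> 'x2 list"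
    and g1 :: "nat \<Rightarrow> 'y1 list \<Rightarrow> 'u1 list" and g2 :: "nat \<Rightarrow> 'y2 list \<Rightarrow> 'v1 list \<Rightarrow> 'u2 list"
    where code: "(\<forall>n us1. length us1 = n \<longrightarrow> length (f1 n us1) = n) \<and>
        (\<forall>n us2. length us2 = n \<longrightarrow> length (f2 n us2) = n) \<and>
        (\<forall>n ys1. length ys1 = n \<longrightarrow> length (g1 n ys1) = n) \<and>
        (\<forall>n ys2 vs1. length ys2 = n \<longrightarrow> length vs1 = n \<longrightarrow> length (g2 n ys2 vs1) = n) \<and>
        (\<lambda>n. error_prob n ch pU1 h1 pU2 (f1 n) (f2 n) (g1 n) (g2 n)) \<longlonglongrightarrow> 0"
    using rel unfolding reliable_transmission_def by (elim exE)
  then have f1: "\<forall>u. length u = n \<longrightarrow> length (f1 n u) = n"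
    and f2: "\<forall>u. length u = n \<longrightarrow> length (f2 n u) = n"
    and lim: "(\<lambda>n. error_prob n ch pU1 h1 pU2 (f1 n) (f2 n) (g1 n) (g2 n)) \<longlonglongrightarrow> 0" for n
    by auto
  define e where "e n = error_prob n ch pU1 h1 pU2 (f1 n) (f2 n) (g1 n) (g2 n)" for n
  have "(\<lambda>n. 2 * (1 / real n) + e n * ?L1 + e n * ?L2) \<longlonglongrightarrow> 2 * 0 + 0 * ?L1 + 0 * ?L2"
    using lim unfolding e_def by (intro tendsto_intros lim_1_over_n) auto
  \<comment> \<open>This total dominates the error terms of all three inequalities, so a single
    block length serves them together.\<close>
  then have "\<forall>\<^sub>F n in sequentially. 2 * (1 / real n) + e n * ?L1 + e n * ?L2 < \<delta>"
    using \<delta> by (intro order_tendstoD(2)) auto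
  then have "\<forall>\<^sub>F n in sequentially. n \<ge> 1 \<and> 2 * (1 / real n) + e n * ?L1 + e n * ?L2 < \<delta>"
    by (intro eventually_conj eventually_ge_at_top)
  then obtain n where n: "n \<ge> 1" and small: "2 * (1 / real n) + e n * ?L1 + e n * ?L2 < \<delta>"
    by (auto dest: eventually_happens)
  have "e n \<ge> 0" by (simp add: e_def error_prob_def)
  then have nn: "e n * ?L1 \<ge> 0" "e n * ?L2 \<ge> 0"
    by (simp_all add: Suc_leI)
  have pos: "1 / real n > 0" using n by simp
  obtain D :: "(nat \<times> 'v1 list \<times> (nat \<Rightarrow> 'y1) \<times> (nat \<Rightarrow> 'y2)) pmf" and k where
    "finite (set_pmf D) \<and>
    ent pU1 \<le> 1 / n + e n * ?L1
       + ent (bind_pmf (bind_pmf D k) q1) - expec (bind_pmf D k) (\<lambda>x. ent (q1 x)) \<and>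
    ent pU2 \<le> 1 / n + e n * ?L2
       + max_output_entropy q2 - expec D (\<lambda>z. ent (bind_pmf (k z) (\<lambda>x. q2 x x0))) \<and>
    ent pU1 - ent (map_pmf h1 pU1) + ent pU2 \<le> 2 / n + e n * ?L1 + e n * ?L2
       + max_output_entropy q2 - expec D (\<lambda>z. ent (bind_pmf (k z) (\<lambda>x. q2 x x0)))
       + expec D (\<lambda>z. ent (bind_pmf (k z) q1)) - expec (bind_pmf D k) (\<lambda>x. ent (q1 x))"
    using converse_block[where ?x0.0 = x0 and ?f1.0 = "f1 n" and ?f2.0 = "f2 n" and ?q1.0 = q1
      and ?pU1.0 = pU1 and ?pU2.0 = pU2 and ?h1.0 = h1 and ?g1.0 = "g1 n" and ?g2.0 = "g2 n", OF c1 n f1 f2]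
    unfolding e_def error_prob_eq[OF ch] by (elim exE)
  moreover have "2 / real n = 1 / real n + 1 / real n" by simp
  ultimately show "\<exists>(D :: (nat \<times> 'v1 list \<times> (nat \<Rightarrow> 'y1) \<times> (nat \<Rightarrow> 'y2)) pmf) k. finite (set_pmf D) \<and>
    ent pU1 \<le> \<delta> + ent (bind_pmf (bind_pmf D k) q1) - expec (bind_pmf D k) (\<lambda>x. ent (q1 x)) \<and>
    ent pU2 \<le> \<delta> + max_output_entropy q2 - expec D (\<lambda>z. ent (bind_pmf (k z) (\<lambda>x. q2 x x0))) \<and>
    ent pU1 - ent (map_pmf h1 pU1) + ent pU2 \<le> \<delta>
       + max_output_entropy q2 - expec D (\<lambda>z. ent (bind_pmf (k z) (\<lambda>x. q2 x x0)))
       + expec D (\<lambda>z. ent (bind_pmf (k z) q1)) - expec (bind_pmf D k) (\<lambda>x. ent (q1 x))"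
    using small nn pos by (intro exI[of _ D] exI[of _ k]) (safe; linarith)
qed

section \<open>Random coding\<close>

lemma prob_bind: "measure_pmf.prob (bind_pmf p f) E = expec p (\<lambda>x. measure_pmf.prob (f x) E)"
proof -
  have "integrable (measure_pmf p) (\<lambda>x. measure_pmf.prob (f x) E)"
    by (rule measure_pmf.integrable_const_bound[where B = 1]) auto
  then have "(\<integral>\<^sup>+x. ennreal (measure_pmf.prob (f x) E) \<partial>measure_pmf p) = ennreal (expec p (\<lambda>x. measure_pmf.prob (f x) E))"
    by (rule nn_integral_eq_integral) auto
  moreover have "emeasure (measure_pmf (bind_pmf p f)) E = (\<integral>\<^sup>+x. emeasure (measure_pmf (f x)) E \<partial>measure_pmf p)"
    by (simp add: emeasure_bind_pmf)
  ultimately show ?thesis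
    by (simp add: measure_pmf.emeasure_eq_measure integral_nonneg_AE)
qed

lemma prob_bind_le:
  assumes "\<And>x. x \<in> set_pmf p \<Longrightarrow> measure_pmf.prob (f x) E \<le> b"
  shows "measure_pmf.prob (bind_pmf p f) E \<le> b"
  unfolding prob_bind
proof (rule measure_pmf.integral_le_const)
  show "integrable (measure_pmf p) (\<lambda>x. measure_pmf.prob (f x) E)"
    by (rule measure_pmf.integrable_const_bound[where B = 1]) auto
qed (use assms in \<open>simp add: AE_measure_pmf_iff\<close>)

text \<open>The change of measure behind all error bounds: a threshold test in favour of \<open>R\<close> rarely
  succeeds under \<open>Q\<close>.\<close>

lemma prob_threshold_le:
  assumes t: "t > 0" and c: "c \<ge> 0"
  shows "measure_pmf.prob Q {y. t * pmf Q y < pmf R y * c} \<le> c / t"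
proof -
  let ?E = "{y. t * pmf Q y < pmf R y * c}"
  have "ennreal (measure_pmf.prob Q ?E) = (\<integral>\<^sup>+y. indicator ?E y \<partial>measure_pmf Q)"
    by (simp add: measure_pmf.emeasure_eq_measure)
  also have "\<dots> = (\<integral>\<^sup>+y. ennreal (pmf Q y) * indicator ?E y \<partial>count_space UNIV)"
    by (rule nn_integral_measure_pmf)
  also have "\<dots> \<le> (\<integral>\<^sup>+y. ennreal (c / t) * ennreal (pmf R y) \<partial>count_space UNIV)"
  proof (rule nn_integral_mono)
    fix y
    have "pmf Q y \<le> c / t * pmf R y" if "y \<in> ?E"
      using that t by (simp add: field_simps)
    then show "ennreal (pmf Q y) * indicator ?E y \<le> ennreal (c / t) * ennreal (pmf R y)"
      using t c by (auto simp: indicator_def ennreal_mult[symmetric] intro!: ennreal_leI)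
  qed
  also have "\<dots> = ennreal (c / t)"
    by (simp add: nn_integral_cmult nn_integral_pmf_eq_1)
  finally show ?thesis using t c by (subst (asm) ennreal_le_iff) auto
qed

text \<open>Codewords that a computation does not read integrate out. This and the version for two
  coordinates replace a random codebook by fresh draws of the words in play.\<close>

lemma bind_Pi_component:
  assumes "finite A" "x \<in> A"
  shows "bind_pmf (Pi_pmf A d p) (\<lambda>f. F (f x)) = bind_pmf (p x) F"
proof -
  have "bind_pmf (Pi_pmf A d p) (\<lambda>f. F (f x)) = bind_pmf (map_pmf (\<lambda>f. f x) (Pi_pmf A d p)) F"
    by (simp add: bind_map_pmf)
  then show ?thesis using assms by (simp add: Pi_pmf_component)
qed

lemma bind_Pi_component2:
  assumes "finite A" "x \<in> A" "x' \<in> A" "x \<noteq> x'"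
  shows "bind_pmf (Pi_pmf A d p) (\<lambda>f. F (f x) (f x')) = bind_pmf (p x) (\<lambda>a. bind_pmf (p x') (F a))"
proof -
  have "A = insert x (A - {x})" using assms by auto
  then have "bind_pmf (Pi_pmf A d p) (\<lambda>f. F (f x) (f x'))
     = bind_pmf (Pi_pmf (insert x (A - {x})) d p) (\<lambda>f. F (f x) (f x'))"
    by simp
  also have "\<dots> = bind_pmf (p x) (\<lambda>a. bind_pmf (Pi_pmf (A - {x}) d p) (\<lambda>f. F a (f x')))"
    using assms by (subst Pi_pmf_insert') (auto simp: bind_assoc_pmf bind_return_pmf)
  also have "\<dots> = bind_pmf (p x) (\<lambda>a. bind_pmf (p x') (F a))"
    using assms by (intro bind_pmf_cong refl bind_Pi_component) auto
  finally show ?thesis .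
qed

section \<open>One-shot superposition coding\<close>

definition transmission_law ::
  "'u1 pmf \<Rightarrow> 'u2 pmf \<Rightarrow> ('x1 \<Rightarrow> 'y1 pmf) \<Rightarrow> ('x1 \<Rightarrow> 'x2 \<Rightarrow> 'y2 pmf) \<Rightarrow> ('u1 \<Rightarrow> 'x1) \<Rightarrow> ('u2 \<Rightarrow> 'x2)
    \<Rightarrow> ('u1 \<times> 'u2 \<times> 'y1 \<times> 'y2) pmf" where
  "transmission_law pU1 pU2 K1 K2 f1 f2 = do {
     u1 \<leftarrow> pU1; u2 \<leftarrow> pU2; y1 \<leftarrow> K1 (f1 u1); y2 \<leftarrow> K2 (f1 u1) (f2 u2); return_pmf (u1, u2, y1, y2)}"

text \<open>The law seen by the transmitted pair after averaging over the codebook: its cloud centre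
  and codewords are fresh draws, independent of the sources.\<close>

definition ideal_law ::
  "'u1 pmf \<Rightarrow> 'u2 pmf \<Rightarrow> 'w pmf \<Rightarrow> ('w \<Rightarrow> 'x1 pmf) \<Rightarrow> 'x2 pmf \<Rightarrow> ('x1 \<Rightarrow> 'y1 pmf) \<Rightarrow> ('x1 \<Rightarrow> 'x2 \<Rightarrow> 'y2 pmf)
    \<Rightarrow> ('u1 \<times> 'u2 \<times> 'w \<times> 'x1 \<times> 'x2 \<times> 'y1 \<times> 'y2) pmf" where
  "ideal_law pU1 pU2 pW pX1W pX2 K1 K2 = do {
     u1 \<leftarrow> pU1; u2 \<leftarrow> pU2; w \<leftarrow> pW; x1 \<leftarrow> pX1W w; x2 \<leftarrow> pX2; y1 \<leftarrow> K1 x1; y2 \<leftarrow> K2 x1 x2;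
     return_pmf (u1, u2, w, x1, x2, y1, y2)}"

text \<open>Random superposition code. The cloud of the source word \<open>u\<close> is indexed by its side information
  \<open>h u\<close> and a random hash below \<open>M\<close>; Receiver 2 need only resolve the hash. The tests \<open>A\<close>, \<open>B\<close> guard
  Receiver 1 against words in other clouds and in the same cloud, the tests \<open>C\<close>, \<open>D\<close> guard
  Receiver 2 against words with a wrong and with the right cloud.\<close>

lemma random_coding:
  fixes pU1 :: "'u1 pmf" and pU2 :: "'u2 pmf" and h :: "'u1 \<Rightarrow> 'v" and pW :: "'w pmf"
    and pX1W :: "'w \<Rightarrow> 'x1 pmf" and pX2 :: "'x2 pmf" and K1 :: "'x1 \<Rightarrow> 'y1 pmf"
    and K2 :: "'x1 \<Rightarrow> 'x2 \<Rightarrow> 'y2 pmf" and M :: nat and \<eta> :: real and b :: "'u1 \<Rightarrow> real"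
    and A :: "'u1 \<Rightarrow> 'x1 \<Rightarrow> 'y1 \<Rightarrow> bool" and B :: "'u1 \<Rightarrow> 'w \<Rightarrow> 'x1 \<Rightarrow> 'y1 \<Rightarrow> bool"
    and C D :: "'u2 \<Rightarrow> 'w \<Rightarrow> 'x2 \<Rightarrow> 'y2 \<Rightarrow> bool"
  assumes fin1: "finite (set_pmf pU1)" and fin2: "finite (set_pmf pU2)"
    and M: "M > 0" and \<eta>: "\<eta> \<ge> 0"
    and HA: "\<And>u x. measure_pmf.prob (bind_pmf pW (\<lambda>w. bind_pmf (pX1W w) K1)) {y. A u x y} \<le> pmf pU1 u * \<eta>"
    and HB: "\<And>u w x. w \<in> set_pmf pW \<Longrightarrow>
      measure_pmf.prob (bind_pmf (pX1W w) K1) {y. B u w x y} \<le> M * b u * \<eta>"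
    and b: "\<And>u. b u \<ge> 0" "\<And>v. (\<Sum>u\<in>{u \<in> set_pmf pU1. h u = v}. b u) \<le> 1"
    and HC: "\<And>u w x. measure_pmf.prob (bind_pmf pW (\<lambda>w. bind_pmf (pX1W w) (\<lambda>x1. bind_pmf pX2 (K2 x1)))) {y. C u w x y}
      \<le> pmf pU2 u * \<eta> / M"
    and HD: "\<And>u w x. w \<in> set_pmf pW \<Longrightarrow>
      measure_pmf.prob (bind_pmf (pX1W w) (\<lambda>x1. bind_pmf pX2 (K2 x1))) {y. D u w x y} \<le> pmf pU2 u * \<eta>"
  shows "\<exists>f1 f2 g1 g2. measure_pmf.prob (transmission_law pU1 pU2 K1 K2 f1 f2)
        {(u1, u2, y1, y2). (u1, u2) \<noteq> (g1 y1, g2 y2 (h u1))}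
     \<le> measure_pmf.prob (ideal_law pU1 pU2 pW pX1W pX2 K1 K2)
        {(u1, u2, w, x1, x2, y1, y2). \<not> (A u1 x1 y1 \<and> B u1 w x1 y1 \<and> C u2 w x2 y2 \<and> D u2 w x2 y2)} + 4 * \<eta>"
proof -
  define S1 where "S1 = set_pmf pU1"
  define S2 where "S2 = set_pmf pU2"
  define Cl where "Cl = h ` S1 \<times> {..<M}"
  have fS: "finite S1" "finite S2" "finite Cl" by (auto simp: S1_def S2_def Cl_def fin1 fin2)
  have M0: "{..<M} \<noteq> {}" "finite {..<M}" using M by (auto simp: lessThan_empty_iff)
  define Rl where "Rl = Pi_pmf S1 undefined (\<lambda>_. pmf_of_set {..<M})"
  define Wl where "Wl = Pi_pmf Cl undefined (\<lambda>_. pW)"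
  \<comment> \<open>Satellites are drawn independently around the centre of their own cloud; words
    that share a cloud share only its centre.\<close>
  define X1l where "X1l r w = Pi_pmf S1 undefined (\<lambda>u. pX1W (w (h u, r u)))" for r :: "'u1 \<Rightarrow> nat" and w
  define X2l where "X2l = Pi_pmf S2 undefined (\<lambda>_. pX2)"
  define CB where "CB = do {r \<leftarrow> Rl; w \<leftarrow> Wl; x1 \<leftarrow> X1l r w; x2 \<leftarrow> X2l; return_pmf (r, w, x1, x2)}"
  have finR: "finite (set_pmf Rl)"
    unfolding Rl_def using fS M0 by (intro finite_set_Pi_pmf) auto
  have cl: "(h u, r u) \<in> Cl" if "u \<in> S1" "r \<in> set_pmf Rl" for u r
  proof -
    have "r u < M"
      using that fS M0 by (auto simp: Rl_def set_Pi_pmf PiE_dflt_def)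
    then show ?thesis using that by (auto simp: Cl_def)
  qed

  define g1 where "g1 = (\<lambda>(r :: 'u1 \<Rightarrow> nat, w :: 'v \<times> nat \<Rightarrow> 'w, x1, x2 :: 'u2 \<Rightarrow> 'x2) y. SOME u. u \<in> S1 \<and> A u (x1 u) y \<and> B u (w (h u, r u)) (x1 u) y)"
  \<comment> \<open>Any hash value may vouch for \<open>u\<close>. Receiver 2 is asked for its own
    word alone, so ambiguity of the hash is no error.\<close>
  define g2 where "g2 = (\<lambda>(r :: 'u1 \<Rightarrow> nat, w :: 'v \<times> nat \<Rightarrow> 'w, x1 :: 'u1 \<Rightarrow> 'x1, x2) y v. SOME u. u \<in> S2 \<and>
      (\<exists>r'<M. C u (w (v, r')) (x2 u) y \<and> D u (w (v, r')) (x2 u) y))"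
  define T where "T = (\<lambda>(r :: 'u1 \<Rightarrow> nat, w :: 'v \<times> nat \<Rightarrow> 'w, x1, x2). transmission_law pU1 pU2 K1 K2 x1 x2)"
  define Err where "Err = (\<lambda>c. {(u1, u2, y1, y2). (u1, u2) \<noteq> (g1 c y1, g2 c y2 (h u1))})"
  define J where "J = do {c \<leftarrow> CB; z \<leftarrow> T c; return_pmf (c, z)}"
  define Jc where "Jc u1 u2 r = do {w \<leftarrow> Wl; x1 \<leftarrow> X1l r w; x2 \<leftarrow> X2l; y1 \<leftarrow> K1 (x1 u1); y2 \<leftarrow> K2 (x1 u1) (x2 u2);
     return_pmf ((r, w, x1, x2), (u1, u2, y1, y2))}" for u1 u2 r
  \<comment> \<open>With sources and hash drawn ahead of the codewords, each error event can be
    bounded while these are held fixed.\<close>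
  have J: "J = do {u1 \<leftarrow> pU1; u2 \<leftarrow> pU2; r \<leftarrow> Rl; Jc u1 u2 r}"
  proof -
    have "J = do {c \<leftarrow> CB; u1 \<leftarrow> pU1; u2 \<leftarrow> pU2; y1 \<leftarrow> K1 (fst (snd (snd c)) u1);
        y2 \<leftarrow> K2 (fst (snd (snd c)) u1) (snd (snd (snd c)) u2); return_pmf (c, (u1, u2, y1, y2))}"
      unfolding J_def T_def transmission_law_def by (simp add: case_prod_unfold bind_assoc_pmf bind_return_pmf)
    also have "\<dots> = do {u1 \<leftarrow> pU1; c \<leftarrow> CB; u2 \<leftarrow> pU2; y1 \<leftarrow> K1 (fst (snd (snd c)) u1);
        y2 \<leftarrow> K2 (fst (snd (snd c)) u1) (snd (snd (snd c)) u2); return_pmf (c, (u1, u2, y1, y2))}"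
      by (rule bind_commute_pmf)
    also have "\<dots> = do {u1 \<leftarrow> pU1; u2 \<leftarrow> pU2; c \<leftarrow> CB; y1 \<leftarrow> K1 (fst (snd (snd c)) u1);
        y2 \<leftarrow> K2 (fst (snd (snd c)) u1) (snd (snd (snd c)) u2); return_pmf (c, (u1, u2, y1, y2))}"
      by (intro bind_pmf_cong refl bind_commute_pmf)
    also have "\<dots> = do {u1 \<leftarrow> pU1; u2 \<leftarrow> pU2; r \<leftarrow> Rl; Jc u1 u2 r}"
      unfolding CB_def Jc_def by (simp add: bind_assoc_pmf bind_return_pmf)
    finally show ?thesis .
  qed

  define tup where "tup = (\<lambda>((r, w, x1, x2), (u1, u2, y1, y2)). (u1 :: 'u1, u2 :: 'u2, w (h u1, r u1 :: nat) :: 'w, x1 u1 :: 'x1, x2 u2 :: 'x2, y1 :: 'y1, y2 :: 'y2))"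
  define bad where "bad = {(u1, u2, w, x1, x2, y1, y2). \<not> (A u1 x1 y1 \<and> B u1 w x1 y1 \<and> C u2 w x2 y2 \<and> D u2 w x2 y2)}"
  define E1 where "E1 = {((r :: 'u1 \<Rightarrow> nat, w :: 'v \<times> nat \<Rightarrow> 'w, x1, x2 :: 'u2 \<Rightarrow> 'x2), (u1, u2 :: 'u2, y1, y2 :: 'y2)).
      \<exists>u\<in>S1 - {u1}. A u (x1 u) y1 \<and> B u (w (h u, r u)) (x1 u) y1}"
  define E2 where "E2 = {((r :: 'u1 \<Rightarrow> nat, w :: 'v \<times> nat \<Rightarrow> 'w, x1 :: 'u1 \<Rightarrow> 'x1, x2), (u1, u2, y1 :: 'y1, y2)).
      \<exists>u\<in>S2 - {u2}. \<exists>r'<M. C u (w (h u1, r')) (x2 u) y2 \<and> D u (w (h u1, r')) (x2 u) y2}"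

  have supp: "u1 \<in> S1 \<and> u2 \<in> S2 \<and> r u1 < M" if J': "((r, w, x1, x2), (u1, u2, y1, y2)) \<in> set_pmf J" for r w x1 x2 u1 u2 y1 y2
  proof -
    have "u1 \<in> S1" "u2 \<in> S2" "r \<in> set_pmf Rl" using J' by (auto simp: J Jc_def S1_def S2_def)
    then show ?thesis using cl[of u1 r] by (auto simp: Cl_def)
  qed
  have "measure_pmf.prob J {(c, z). z \<in> Err c} \<le> measure_pmf.prob J (tup -` bad \<union> E1 \<union> E2)"
  proof (rule measure_pmf.finite_measure_mono_AE)
    show "AE x in measure_pmf J. x \<in> {(c, z). z \<in> Err c} \<longrightarrow> x \<in> tup -` bad \<union> E1 \<union> E2"
    proof (unfold AE_measure_pmf_iff, intro ballI impI, rule ccontr)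
      fix x assume x: "x \<in> set_pmf J" "x \<in> {(c, z). z \<in> Err c}" "x \<notin> tup -` bad \<union> E1 \<union> E2"
      obtain r w x1 x2 u1 u2 y1 y2 where xx: "x = ((r, w, x1, x2), (u1, u2, y1, y2))"
        by (metis prod.exhaust)
      note s = supp[OF x(1)[unfolded xx]]
      have ok: "A u1 (x1 u1) y1" "B u1 (w (h u1, r u1)) (x1 u1) y1"
         "C u2 (w (h u1, r u1)) (x2 u2) y2" "D u2 (w (h u1, r u1)) (x2 u2) y2"
        using x(3) by (auto simp: xx tup_def bad_def)
      have "g1 (r, w, x1, x2) y1 = u1"
        unfolding g1_def prod.case
        by (rule some_equality) (use s ok x(3) in \<open>auto simp: xx E1_def\<close>)
      moreover have "g2 (r, w, x1, x2) y2 (h u1) = u2"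
        unfolding g2_def prod.case
        by (rule some_equality) (use s ok x(3) in \<open>auto simp: xx E2_def\<close>)
      ultimately show False using x(2) by (auto simp: xx Err_def)
    qed
  qed simp
  also have "\<dots> \<le> measure_pmf.prob J (tup -` bad) + measure_pmf.prob J E1 + measure_pmf.prob J E2"
    using measure_Un_le[of "tup -` bad \<union> E1" "measure_pmf J" E2]
      measure_Un_le[of "tup -` bad" "measure_pmf J" E1] by simp
  also have "measure_pmf.prob J (tup -` bad) = measure_pmf.prob (ideal_law pU1 pU2 pW pX1W pX2 K1 K2) bad"
  proof -
    have 1: "map_pmf tup (Jc u1 u2 r) = do {w \<leftarrow> pW; x1 \<leftarrow> pX1W w; x2 \<leftarrow> pX2; y1 \<leftarrow> K1 x1; y2 \<leftarrow> K2 x1 x2;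
        return_pmf (u1, u2, w, x1, x2, y1, y2)}" (is "_ = bind_pmf pW ?F")
      if u: "u1 \<in> S1" "u2 \<in> S2" and r: "r \<in> set_pmf Rl" for u1 u2 r
    proof -
      have "map_pmf tup (Jc u1 u2 r) = do {w \<leftarrow> Wl; x1 \<leftarrow> X1l r w; x2 \<leftarrow> X2l; y1 \<leftarrow> K1 (x1 u1); y2 \<leftarrow> K2 (x1 u1) (x2 u2);
          return_pmf (u1, u2, w (h u1, r u1), x1 u1, x2 u2, y1, y2)}"
        by (simp add: Jc_def map_bind_pmf tup_def)
      also have "\<dots> = do {w \<leftarrow> Wl; x1 \<leftarrow> X1l r w; x2 \<leftarrow> pX2; y1 \<leftarrow> K1 (x1 u1); y2 \<leftarrow> K2 (x1 u1) x2;
          return_pmf (u1, u2, w (h u1, r u1), x1 u1, x2, y1, y2)}"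
        unfolding X2l_def by (intro bind_pmf_cong refl bind_Pi_component fS u)
      also have "\<dots> = do {w \<leftarrow> Wl; x1 \<leftarrow> pX1W (w (h u1, r u1)); x2 \<leftarrow> pX2; y1 \<leftarrow> K1 x1; y2 \<leftarrow> K2 x1 x2;
          return_pmf (u1, u2, w (h u1, r u1), x1, x2, y1, y2)}"
        unfolding X1l_def by (intro bind_pmf_cong refl bind_Pi_component fS u)
      also have "\<dots> = bind_pmf pW ?F"
        unfolding Wl_def by (rule bind_Pi_component[where F = ?F]) (intro fS cl u r)+
      finally show ?thesis .
    qed
    have "map_pmf tup J = ideal_law pU1 pU2 pW pX1W pX2 K1 K2"
      unfolding J map_bind_pmf ideal_law_def
    proof (intro bind_pmf_cong refl)
      fix u1 u2 assume "u1 \<in> set_pmf pU1" "u2 \<in> set_pmf pU2"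
      then have "bind_pmf Rl (\<lambda>r. map_pmf tup (Jc u1 u2 r)) = bind_pmf Rl (\<lambda>_. do {w \<leftarrow> pW; x1 \<leftarrow> pX1W w; x2 \<leftarrow> pX2; y1 \<leftarrow> K1 x1; y2 \<leftarrow> K2 x1 x2;
        return_pmf (u1, u2, w, x1, x2, y1, y2)})"
        by (intro bind_pmf_cong refl 1) (auto simp: S1_def S2_def)
      then show "bind_pmf Rl (\<lambda>r. map_pmf tup (Jc u1 u2 r)) = do {w \<leftarrow> pW; x1 \<leftarrow> pX1W w; x2 \<leftarrow> pX2; y1 \<leftarrow> K1 x1; y2 \<leftarrow> K2 x1 x2;
        return_pmf (u1, u2, w, x1, x2, y1, y2)}"
        by simp
    qed
    then show ?thesis by (metis measure_map_pmf)
  qed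
  also have "measure_pmf.prob J E1 \<le> 2 * \<eta>"
    unfolding J
  proof (rule prob_bind_le, rule prob_bind_le)
    fix u1 u2 assume u1: "u1 \<in> set_pmf pU1" and u2: "u2 \<in> set_pmf pU2"
    \<comment> \<open>Only competitors with the same side information can lie in the cloud of
      \<open>u1\<close>, and they do so only on a collision of the hashes.\<close>
    define N where "N = {u \<in> S1 - {u1}. h u = h u1}"
    have fN: "finite N" using fS by (auto simp: N_def)
    have given: "measure_pmf.prob (Jc u1 u2 r) E1 \<le> \<eta> + (\<Sum>u\<in>N. indicator {r. r u = r u1} r * (M * b u * \<eta>))"
      if r: "r \<in> set_pmf Rl" for r
    proof -
      let ?Eu = "\<lambda>u. {((r :: 'u1 \<Rightarrow> nat, w :: 'v \<times> nat \<Rightarrow> 'w, x1, x2 :: 'u2 \<Rightarrow> 'x2), (u1 :: 'u1, u2 :: 'u2, y1, y2 :: 'y2)). A u (x1 u) y1 \<and> B u (w (h u, r u)) (x1 u) y1}"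
      have proj: "measure_pmf.prob (Jc u1 u2 r) (?Eu u)
        = measure_pmf.prob (do {w \<leftarrow> Wl; x1 \<leftarrow> X1l r w; y1 \<leftarrow> K1 (x1 u1); return_pmf (w (h u, r u), x1 u, y1)})
            {(w, x, y). A u x y \<and> B u w x y}" for u
      proof -
        have m: "map_pmf (\<lambda>((r, w, x1, x2), (u1, u2, y1, y2)). (w (h u, r u), x1 u, y1)) (Jc u1 u2 r)
          = do {w \<leftarrow> Wl; x1 \<leftarrow> X1l r w; y1 \<leftarrow> K1 (x1 u1); return_pmf (w (h u, r u), x1 u, y1)}"
          by (simp add: Jc_def map_bind_pmf)
        show ?thesis unfolding m[symmetric] measure_map_pmf
          by (rule arg_cong[where f = "measure_pmf.prob _"]) auto
      qed
      \<comment> \<open>In the same cloud, the competing satellite is independent of the output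
        given the centre, so test \<open>B\<close> is decisive. In another cloud it is independent
        of the output altogether, and test \<open>A\<close> applies.\<close>
      have each: "measure_pmf.prob (Jc u1 u2 r) (?Eu u) \<le> pmf pU1 u * \<eta> + (if u \<in> N then indicator {r. r u = r u1} r * (M * b u * \<eta>) else 0)"
        if u: "u \<in> S1 - {u1}" for u
      proof (cases "(h u, r u) = (h u1, r u1)")
        case True
        have "do {w \<leftarrow> Wl; x1 \<leftarrow> X1l r w; y1 \<leftarrow> K1 (x1 u1); return_pmf (w (h u, r u), x1 u, y1)}
          = do {w \<leftarrow> Wl; x \<leftarrow> pX1W (w (h u1, r u1)); x' \<leftarrow> pX1W (w (h u1, r u1)); y1 \<leftarrow> K1 x; return_pmf (w (h u1, r u1), x', y1)}"
          unfolding X1l_def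
          by (rule bind_pmf_cong[OF refl], subst bind_Pi_component2[where x = u1 and x' = u and F = "\<lambda>x x'. do {y1 \<leftarrow> K1 x; return_pmf (_, x', y1)}"])
             (use u u1 fS True in \<open>auto simp: S1_def\<close>)
        also have "\<dots> = do {w \<leftarrow> pW; x \<leftarrow> pX1W w; x' \<leftarrow> pX1W w; y1 \<leftarrow> K1 x; return_pmf (w, x', y1)}"
          unfolding Wl_def using fS cl[OF _ r, of u1] u1
          by (intro bind_Pi_component[where F = "\<lambda>w. do {x \<leftarrow> pX1W w; x' \<leftarrow> pX1W w; y1 \<leftarrow> K1 x; return_pmf (w, x', y1)}"]) (auto simp: S1_def)
        also have "\<dots> = do {w \<leftarrow> pW; x' \<leftarrow> pX1W w; map_pmf (\<lambda>y. (w, x', y)) (bind_pmf (pX1W w) K1)}"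
          by (rule bind_pmf_cong[OF refl], subst bind_commute_pmf)
             (simp add: map_bind_pmf map_pmf_def bind_assoc_pmf)
        finally have "measure_pmf.prob (Jc u1 u2 r) (?Eu u)
           = measure_pmf.prob (do {w \<leftarrow> pW; x' \<leftarrow> pX1W w; map_pmf (\<lambda>y. (w, x', y)) (bind_pmf (pX1W w) K1)}) {(w, x, y). A u x y \<and> B u w x y}"
          unfolding proj by simp
        also have "\<dots> \<le> M * b u * \<eta>"
        proof (intro prob_bind_le)
          fix w x' assume w: "w \<in> set_pmf pW"
          have "measure_pmf.prob (map_pmf (\<lambda>y. (w, x', y)) (bind_pmf (pX1W w) K1)) {(w, x, y). A u x y \<and> B u w x y}
             \<le> measure_pmf.prob (bind_pmf (pX1W w) K1) {y. B u w x' y}"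
            unfolding measure_map_pmf by (rule measure_pmf.finite_measure_mono) auto
          also have "\<dots> \<le> M * b u * \<eta>" by (rule HB[OF w])
          finally show "measure_pmf.prob (map_pmf (\<lambda>y. (w, x', y)) (bind_pmf (pX1W w) K1)) {(w, x, y). A u x y \<and> B u w x y} \<le> M * b u * \<eta>" .
        qed
        finally show ?thesis using True u \<eta> by (simp add: N_def add_increasing)
      next
        case False
        have "do {w \<leftarrow> Wl; x1 \<leftarrow> X1l r w; y1 \<leftarrow> K1 (x1 u1); return_pmf (w (h u, r u), x1 u, y1)}
          = do {w \<leftarrow> Wl; x \<leftarrow> pX1W (w (h u1, r u1)); x' \<leftarrow> pX1W (w (h u, r u)); y1 \<leftarrow> K1 x; return_pmf (w (h u, r u), x', y1)}"
          unfolding X1l_def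
          by (rule bind_pmf_cong[OF refl], subst bind_Pi_component2[where x = u1 and x' = u and F = "\<lambda>x x'. do {y1 \<leftarrow> K1 x; return_pmf (_, x', y1)}"])
             (use u u1 fS in \<open>auto simp: S1_def\<close>)
        also have "\<dots> = do {w \<leftarrow> pW; w' \<leftarrow> pW; x \<leftarrow> pX1W w; x' \<leftarrow> pX1W w'; y1 \<leftarrow> K1 x; return_pmf (w', x', y1)}"
          unfolding Wl_def using fS cl[OF _ r, of u1] cl[OF _ r, of u] u u1 False
          by (intro bind_Pi_component2[where F = "\<lambda>w w'. do {x \<leftarrow> pX1W w; x' \<leftarrow> pX1W w'; y1 \<leftarrow> K1 x; return_pmf (w', x', y1)}"]) (auto simp: S1_def)
        also have "\<dots> = do {w \<leftarrow> pW; w' \<leftarrow> pW; x' \<leftarrow> pX1W w'; x \<leftarrow> pX1W w; y1 \<leftarrow> K1 x; return_pmf (w', x', y1)}"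
          by (rule bind_pmf_cong[OF refl], rule bind_pmf_cong[OF refl], rule bind_commute_pmf)
        also have "\<dots> = do {w' \<leftarrow> pW; w \<leftarrow> pW; x' \<leftarrow> pX1W w'; x \<leftarrow> pX1W w; y1 \<leftarrow> K1 x; return_pmf (w', x', y1)}"
          by (rule bind_commute_pmf)
        also have "\<dots> = do {w' \<leftarrow> pW; x' \<leftarrow> pX1W w'; w \<leftarrow> pW; x \<leftarrow> pX1W w; y1 \<leftarrow> K1 x; return_pmf (w', x', y1)}"
          by (rule bind_pmf_cong[OF refl], rule bind_commute_pmf)
        also have "\<dots> = do {w' \<leftarrow> pW; x' \<leftarrow> pX1W w'; map_pmf (\<lambda>y. (w', x', y)) (bind_pmf pW (\<lambda>w. bind_pmf (pX1W w) K1))}"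
          by (simp add: map_bind_pmf map_pmf_def bind_assoc_pmf)
        finally have "measure_pmf.prob (Jc u1 u2 r) (?Eu u)
           = measure_pmf.prob (do {w' \<leftarrow> pW; x' \<leftarrow> pX1W w'; map_pmf (\<lambda>y. (w', x', y)) (bind_pmf pW (\<lambda>w. bind_pmf (pX1W w) K1))}) {(w, x, y). A u x y \<and> B u w x y}"
          unfolding proj by simp
        also have "\<dots> \<le> pmf pU1 u * \<eta>"
        proof (intro prob_bind_le)
          fix w' x'
          have "measure_pmf.prob (map_pmf (\<lambda>y. (w', x', y)) (bind_pmf pW (\<lambda>w. bind_pmf (pX1W w) K1))) {(w, x, y). A u x y \<and> B u w x y}
             \<le> measure_pmf.prob (bind_pmf pW (\<lambda>w. bind_pmf (pX1W w) K1)) {y. A u x' y}"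
            unfolding measure_map_pmf by (rule measure_pmf.finite_measure_mono) auto
          also have "\<dots> \<le> pmf pU1 u * \<eta>" by (rule HA)
          finally show "measure_pmf.prob (map_pmf (\<lambda>y. (w', x', y)) (bind_pmf pW (\<lambda>w. bind_pmf (pX1W w) K1))) {(w, x, y). A u x y \<and> B u w x y} \<le> pmf pU1 u * \<eta>" .
        qed
        finally show ?thesis using b \<eta> by (simp add: add_increasing2)
      qed
      have "measure_pmf.prob (Jc u1 u2 r) E1 \<le> measure_pmf.prob (Jc u1 u2 r) (\<Union>u\<in>S1 - {u1}. ?Eu u)"
        by (rule measure_pmf.finite_measure_mono_AE) (auto simp: AE_measure_pmf_iff Jc_def E1_def)
      also have "\<dots> \<le> (\<Sum>u\<in>S1 - {u1}. measure_pmf.prob (Jc u1 u2 r) (?Eu u))"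
        using fS by (intro measure_pmf.finite_measure_subadditive_finite) auto
      also have "\<dots> \<le> (\<Sum>u\<in>S1 - {u1}. pmf pU1 u * \<eta> + (if u \<in> N then indicator {r. r u = r u1} r * (M * b u * \<eta>) else 0))"
        by (rule sum_mono) (rule each)
      also have "\<dots> = (\<Sum>u\<in>S1 - {u1}. pmf pU1 u) * \<eta> + (\<Sum>u\<in>N. indicator {r. r u = r u1} r * (M * b u * \<eta>))"
        using fS by (simp add: sum.distrib sum_distrib_right N_def sum.If_cases Int_def)
      also have "(\<Sum>u\<in>S1 - {u1}. pmf pU1 u) \<le> (\<Sum>u\<in>S1. pmf pU1 u)"
        using fS by (intro sum_mono2) auto
      also have "\<dots> = 1" using fin1 by (simp add: S1_def sum_pmf_eq_1)
      finally show ?thesis using \<eta> by (simp add: mult_right_mono)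
    qed
    \<comment> \<open>The collision probability cancels the factor \<open>M\<close> in the bound for
      \<open>B\<close>; what remains is the sum of \<open>b\<close> over one fibre.\<close>
    have coll: "expec Rl (\<lambda>r. indicator {r. r u = r u1} r) = 1 / M" if u: "u \<in> N" for u
    proof -
      have "expec Rl (\<lambda>r. indicator {r. r u = r u1} r) = measure_pmf.prob (map_pmf (\<lambda>r. (r u, r u1)) Rl) {(a, c). a = c}"
        by (simp add: vimage_def case_prod_unfold)
      also have "map_pmf (\<lambda>r. (r u, r u1)) Rl = do {a \<leftarrow> pmf_of_set {..<M}; c \<leftarrow> pmf_of_set {..<M}; return_pmf (a, c)}"
        unfolding Rl_def map_pmf_def
        by (rule bind_Pi_component2[where F = "\<lambda>a c. return_pmf (a, c)"]) (use u u1 fS in \<open>auto simp: N_def S1_def\<close>)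
      also have "measure_pmf.prob \<dots> {(a, c). a = c} = expec (pmf_of_set {..<M}) (\<lambda>a. 1 / M)"
        unfolding prob_bind
      proof (rule expec_cong)
        fix a assume "a \<in> set_pmf (pmf_of_set {..<M})"
        then have a: "a < M" using M0 by simp
        have "(\<lambda>c. measure_pmf.prob (return_pmf (a, c)) {(a, c). a = c}) = (\<lambda>c. if c = a then 1 else 0)"
          by (auto simp: fun_eq_iff indicator_def)
        then have "expec (pmf_of_set {..<M}) (\<lambda>c. measure_pmf.prob (return_pmf (a, c)) {(a, c). a = c})
          = (\<Sum>c<M. if c = a then 1 else 0) / M"
          by (simp only: integral_pmf_of_set[OF M0] card_lessThan)
        also have "\<dots> = 1 / M" using a by simp
        finally show "expec (pmf_of_set {..<M}) (\<lambda>c. measure_pmf.prob (return_pmf (a, c)) {(a, c). a = c}) = 1 / M" .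
      qed
      finally show ?thesis by simp
    qed
    have "measure_pmf.prob (bind_pmf Rl (Jc u1 u2)) E1 \<le> expec Rl (\<lambda>r. \<eta> + (\<Sum>u\<in>N. indicator {r. r u = r u1} r * (M * b u * \<eta>)))"
      unfolding prob_bind by (rule expec_mono[OF finR given])
    also have "\<dots> = \<eta> + (\<Sum>u\<in>N. expec Rl (\<lambda>r. indicator {r. r u = r u1} r) * (M * b u * \<eta>))"
      using finR by (subst expec_add) (simp_all add: integrable_measure_pmf_finite)
    also have "\<dots> = \<eta> + (\<Sum>u\<in>N. b u) * \<eta>"
      using M by (simp add: coll[simplified] sum_distrib_right)
    also have "(\<Sum>u\<in>N. b u) \<le> (\<Sum>u\<in>{u \<in> set_pmf pU1. h u = h u1}. b u)"
      using b fin1 by (intro sum_mono2) (auto simp: N_def S1_def)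
    also have "\<dots> \<le> 1" by (rule b)
    finally show "measure_pmf.prob (bind_pmf Rl (Jc u1 u2)) E1 \<le> 2 * \<eta>" using \<eta> by (simp add: mult_right_mono)
  qed
  also have "measure_pmf.prob J E2 \<le> 2 * \<eta>"
    unfolding J
  proof (intro prob_bind_le)
    fix u1 u2 r assume u1: "u1 \<in> set_pmf pU1" and u2: "u2 \<in> set_pmf pU2" and r: "r \<in> set_pmf Rl"
    let ?c = "(h u1, r u1)"
    have c: "?c \<in> Cl" using cl[OF _ r, of u1] u1 by (simp add: S1_def)
    then have ru1: "r u1 < M" by (simp add: Cl_def)
    let ?Eu = "\<lambda>(u, r'). {((r :: 'u1 \<Rightarrow> nat, w :: 'v \<times> nat \<Rightarrow> 'w, x1 :: 'u1 \<Rightarrow> 'x1, x2), (u1, u2 :: 'u2, y1 :: 'y1, y2)). C u (w (h u1, r')) (x2 u) y2 \<and> D u (w (h u1, r')) (x2 u) y2}"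
    have proj: "measure_pmf.prob (Jc u1 u2 r) (?Eu (u, r'))
      = measure_pmf.prob (do {w \<leftarrow> Wl; x1 \<leftarrow> pX1W (w ?c); x' \<leftarrow> pX2; x2 \<leftarrow> pX2; y2 \<leftarrow> K2 x1 x2; return_pmf (w (h u1, r'), x', y2)})
          {(w, x, y). C u w x y \<and> D u w x y}" if u: "u \<in> S2 - {u2}" for u r'
    proof -
      have "map_pmf (\<lambda>((r, w, x1, x2), (u1, u2, y1, y2)). (w (h u1, r'), x2 u, y2)) (Jc u1 u2 r)
        = do {w \<leftarrow> Wl; x1 \<leftarrow> X1l r w; x2 \<leftarrow> X2l; y2 \<leftarrow> K2 (x1 u1) (x2 u2); return_pmf (w (h u1, r'), x2 u, y2)}"
        by (simp add: Jc_def map_bind_pmf)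
      also have "\<dots> = do {w \<leftarrow> Wl; x1 \<leftarrow> X1l r w; x' \<leftarrow> pX2; x2 \<leftarrow> pX2; y2 \<leftarrow> K2 (x1 u1) x2; return_pmf (w (h u1, r'), x', y2)}"
      proof (intro bind_pmf_cong refl)
        fix w x1
        show "bind_pmf X2l (\<lambda>x2. bind_pmf (K2 (x1 u1) (x2 u2)) (\<lambda>y2. return_pmf (w (h u1, r'), x2 u, y2)))
          = do {x' \<leftarrow> pX2; x2 \<leftarrow> pX2; y2 \<leftarrow> K2 (x1 u1) x2; return_pmf (w (h u1, r'), x', y2)}"
          unfolding X2l_def
          by (rule bind_Pi_component2[where x = u and x' = u2 and F = "\<lambda>x' x2. do {y2 \<leftarrow> K2 (x1 u1) x2; return_pmf (w (h u1, r'), x', y2)}"])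
             (use u u2 fS in \<open>auto simp: S2_def\<close>)
      qed
      also have "\<dots> = do {w \<leftarrow> Wl; x1 \<leftarrow> pX1W (w ?c); x' \<leftarrow> pX2; x2 \<leftarrow> pX2; y2 \<leftarrow> K2 x1 x2; return_pmf (w (h u1, r'), x', y2)}"
      proof (intro bind_pmf_cong refl)
        fix w
        show "bind_pmf (X1l r w) (\<lambda>x1. do {x' \<leftarrow> pX2; x2 \<leftarrow> pX2; y2 \<leftarrow> K2 (x1 u1) x2; return_pmf (w (h u1, r'), x', y2)})
          = do {x1 \<leftarrow> pX1W (w ?c); x' \<leftarrow> pX2; x2 \<leftarrow> pX2; y2 \<leftarrow> K2 x1 x2; return_pmf (w (h u1, r'), x', y2)}"
          unfolding X1l_def
          by (rule bind_Pi_component[where x = u1 and F = "\<lambda>x1. do {x' \<leftarrow> pX2; x2 \<leftarrow> pX2; y2 \<leftarrow> K2 x1 x2; return_pmf (w (h u1, r'), x', y2)}"])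
             (use u1 fS in \<open>auto simp: S1_def\<close>)
      qed
      finally have m: "map_pmf (\<lambda>((r, w, x1, x2), (u1, u2, y1, y2)). (w (h u1, r'), x2 u, y2)) (Jc u1 u2 r) = \<dots>" .
      show ?thesis unfolding m[symmetric] measure_map_pmf
        by (rule arg_cong[where f = "measure_pmf.prob _"]) auto
    qed
    \<comment> \<open>With the right hash the centre is the true one and \<open>D\<close> bounds the
      event. With a wrong hash the tested centre is independent of the output and \<open>C\<close>
      applies; summing over the hashes cancels its division by \<open>M\<close>.\<close>
    have each: "measure_pmf.prob (Jc u1 u2 r) (?Eu (u, r')) \<le> pmf pU2 u * \<eta> / M + (if r' = r u1 then pmf pU2 u * \<eta> else 0)"
      if u: "u \<in> S2 - {u2}" and r': "r' < M" for u r'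
    proof (cases "r' = r u1")
      case True
      have "do {w \<leftarrow> Wl; x1 \<leftarrow> pX1W (w ?c); x' \<leftarrow> pX2; x2 \<leftarrow> pX2; y2 \<leftarrow> K2 x1 x2; return_pmf (w (h u1, r'), x', y2)}
        = do {w \<leftarrow> pW; x1 \<leftarrow> pX1W w; x' \<leftarrow> pX2; x2 \<leftarrow> pX2; y2 \<leftarrow> K2 x1 x2; return_pmf (w, x', y2)}"
        unfolding Wl_def True
        by (rule bind_Pi_component[where F = "\<lambda>w. do {x1 \<leftarrow> pX1W w; x' \<leftarrow> pX2; x2 \<leftarrow> pX2; y2 \<leftarrow> K2 x1 x2; return_pmf (w, x', y2)}"]) (intro fS c)+
      also have "\<dots> = do {w \<leftarrow> pW; x' \<leftarrow> pX2; x1 \<leftarrow> pX1W w; x2 \<leftarrow> pX2; y2 \<leftarrow> K2 x1 x2; return_pmf (w, x', y2)}"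
        by (intro bind_pmf_cong refl bind_commute_pmf)
      also have "\<dots> = do {w \<leftarrow> pW; x' \<leftarrow> pX2; map_pmf (\<lambda>y. (w, x', y)) (bind_pmf (pX1W w) (\<lambda>x1. bind_pmf pX2 (K2 x1)))}"
        by (simp add: map_bind_pmf map_pmf_def bind_assoc_pmf)
      finally have "measure_pmf.prob (Jc u1 u2 r) (?Eu (u, r'))
         = measure_pmf.prob (do {w \<leftarrow> pW; x' \<leftarrow> pX2; map_pmf (\<lambda>y. (w, x', y)) (bind_pmf (pX1W w) (\<lambda>x1. bind_pmf pX2 (K2 x1)))}) {(w, x, y). C u w x y \<and> D u w x y}"
        unfolding proj[OF u] by simp
      also have "\<dots> \<le> pmf pU2 u * \<eta>"
      proof (intro prob_bind_le)
        fix w x' assume w: "w \<in> set_pmf pW"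
        have "measure_pmf.prob (map_pmf (\<lambda>y. (w, x', y)) (bind_pmf (pX1W w) (\<lambda>x1. bind_pmf pX2 (K2 x1)))) {(w, x, y). C u w x y \<and> D u w x y}
           \<le> measure_pmf.prob (bind_pmf (pX1W w) (\<lambda>x1. bind_pmf pX2 (K2 x1))) {y. D u w x' y}"
          unfolding measure_map_pmf by (rule measure_pmf.finite_measure_mono) auto
        also have "\<dots> \<le> pmf pU2 u * \<eta>" by (rule HD[OF w])
        finally show "measure_pmf.prob (map_pmf (\<lambda>y. (w, x', y)) (bind_pmf (pX1W w) (\<lambda>x1. bind_pmf pX2 (K2 x1)))) {(w, x, y). C u w x y \<and> D u w x y} \<le> pmf pU2 u * \<eta>" .
      qed
      finally show ?thesis using True \<eta> by (simp add: add_increasing)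
    next
      case False
      have c': "(h u1, r') \<in> Cl" "?c \<noteq> (h u1, r')" using False r' c by (auto simp: Cl_def)
      have "do {w \<leftarrow> Wl; x1 \<leftarrow> pX1W (w ?c); x' \<leftarrow> pX2; x2 \<leftarrow> pX2; y2 \<leftarrow> K2 x1 x2; return_pmf (w (h u1, r'), x', y2)}
        = do {w \<leftarrow> pW; w' \<leftarrow> pW; x1 \<leftarrow> pX1W w; x' \<leftarrow> pX2; x2 \<leftarrow> pX2; y2 \<leftarrow> K2 x1 x2; return_pmf (w', x', y2)}"
        unfolding Wl_def
        by (rule bind_Pi_component2[where F = "\<lambda>w w'. do {x1 \<leftarrow> pX1W w; x' \<leftarrow> pX2; x2 \<leftarrow> pX2; y2 \<leftarrow> K2 x1 x2; return_pmf (w', x', y2)}"]) (intro fS c c')+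
      also have "\<dots> = do {w' \<leftarrow> pW; w \<leftarrow> pW; x1 \<leftarrow> pX1W w; x' \<leftarrow> pX2; x2 \<leftarrow> pX2; y2 \<leftarrow> K2 x1 x2; return_pmf (w', x', y2)}"
        by (rule bind_commute_pmf)
      also have "\<dots> = do {w' \<leftarrow> pW; w \<leftarrow> pW; x' \<leftarrow> pX2; x1 \<leftarrow> pX1W w; x2 \<leftarrow> pX2; y2 \<leftarrow> K2 x1 x2; return_pmf (w', x', y2)}"
        by (intro bind_pmf_cong refl bind_commute_pmf)
      also have "\<dots> = do {w' \<leftarrow> pW; x' \<leftarrow> pX2; w \<leftarrow> pW; x1 \<leftarrow> pX1W w; x2 \<leftarrow> pX2; y2 \<leftarrow> K2 x1 x2; return_pmf (w', x', y2)}"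
        by (rule bind_pmf_cong[OF refl]) (rule bind_commute_pmf)
      also have "\<dots> = do {w' \<leftarrow> pW; x' \<leftarrow> pX2; map_pmf (\<lambda>y. (w', x', y)) (bind_pmf pW (\<lambda>w. bind_pmf (pX1W w) (\<lambda>x1. bind_pmf pX2 (K2 x1))))}"
        by (simp add: map_bind_pmf map_pmf_def bind_assoc_pmf)
      finally have "measure_pmf.prob (Jc u1 u2 r) (?Eu (u, r'))
         = measure_pmf.prob (do {w' \<leftarrow> pW; x' \<leftarrow> pX2; map_pmf (\<lambda>y. (w', x', y)) (bind_pmf pW (\<lambda>w. bind_pmf (pX1W w) (\<lambda>x1. bind_pmf pX2 (K2 x1))))}) {(w, x, y). C u w x y \<and> D u w x y}"
        unfolding proj[OF u] by simp
      also have "\<dots> \<le> pmf pU2 u * \<eta> / M"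
      proof (intro prob_bind_le)
        fix w' x'
        have "measure_pmf.prob (map_pmf (\<lambda>y. (w', x', y)) (bind_pmf pW (\<lambda>w. bind_pmf (pX1W w) (\<lambda>x1. bind_pmf pX2 (K2 x1))))) {(w, x, y). C u w x y \<and> D u w x y}
           \<le> measure_pmf.prob (bind_pmf pW (\<lambda>w. bind_pmf (pX1W w) (\<lambda>x1. bind_pmf pX2 (K2 x1)))) {y. C u w' x' y}"
          unfolding measure_map_pmf by (rule measure_pmf.finite_measure_mono) auto
        also have "\<dots> \<le> pmf pU2 u * \<eta> / M" by (rule HC)
        finally show "measure_pmf.prob (map_pmf (\<lambda>y. (w', x', y)) (bind_pmf pW (\<lambda>w. bind_pmf (pX1W w) (\<lambda>x1. bind_pmf pX2 (K2 x1))))) {(w, x, y). C u w x y \<and> D u w x y} \<le> pmf pU2 u * \<eta> / M" .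
      qed
      finally show ?thesis using False by simp
    qed
    have "measure_pmf.prob (Jc u1 u2 r) E2 \<le> measure_pmf.prob (Jc u1 u2 r) (\<Union>a\<in>(S2 - {u2}) \<times> {..<M}. ?Eu a)"
      by (rule measure_pmf.finite_measure_mono_AE) (auto simp: AE_measure_pmf_iff Jc_def E2_def)
    also have "\<dots> \<le> (\<Sum>a\<in>(S2 - {u2}) \<times> {..<M}. measure_pmf.prob (Jc u1 u2 r) (?Eu a))"
      using fS by (intro measure_pmf.finite_measure_subadditive_finite) auto
    also have "\<dots> \<le> (\<Sum>(u, r')\<in>(S2 - {u2}) \<times> {..<M}. pmf pU2 u * \<eta> / M + (if r' = r u1 then pmf pU2 u * \<eta> else 0))"
      by (rule sum_mono) (use each in auto)
    also have "\<dots> = (\<Sum>u\<in>S2 - {u2}. \<Sum>r'<M. pmf pU2 u * \<eta> / M + (if r' = r u1 then pmf pU2 u * \<eta> else 0))"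
      by (rule sum.cartesian_product[symmetric])
    also have "\<dots> = (\<Sum>u\<in>S2 - {u2}. pmf pU2 u) * (2 * \<eta>)"
      unfolding sum_distrib_right using M ru1 by (intro sum.cong refl) (simp add: sum.distrib)
    also have "\<dots> \<le> (\<Sum>u\<in>S2. pmf pU2 u) * (2 * \<eta>)"
      using fS \<eta> by (intro mult_right_mono sum_mono2) auto
    also have "\<dots> = 2 * \<eta>" using fin2 by (simp add: S2_def sum_pmf_eq_1)
    finally show "measure_pmf.prob (Jc u1 u2 r) E2 \<le> 2 * \<eta>" .
  qed
  finally have avg: "measure_pmf.prob J {(c, z). z \<in> Err c} \<le> measure_pmf.prob (ideal_law pU1 pU2 pW pX1W pX2 K1 K2) bad + 4 * \<eta>"
    by simp
  have "\<exists>c\<in>set_pmf CB. measure_pmf.prob (T c) (Err c) \<le> measure_pmf.prob J {(c, z). z \<in> Err c}"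
  proof (rule ccontr)
    assume "\<not> ?thesis"
    then have less: "measure_pmf.prob J {(c, z). z \<in> Err c} < measure_pmf.prob (T c) (Err c)" if "c \<in> set_pmf CB" for c
      using that by force
    have "measure_pmf.prob J {(c, z). z \<in> Err c} = expec CB (\<lambda>c. measure_pmf.prob (T c) (Err c))"
    proof -
      have "measure_pmf.prob (bind_pmf (T c) (\<lambda>z. return_pmf (c, z))) {(c, z). z \<in> Err c} = measure_pmf.prob (T c) (Err c)" for c
        unfolding map_pmf_def[symmetric] measure_map_pmf by (rule arg_cong[where f = "measure_pmf.prob _"]) auto
      then show ?thesis unfolding J_def prob_bind[of CB] by simp
    qed
    moreover have "measure_pmf.prob J {(c, z). z \<in> Err c} < expec CB (\<lambda>c. measure_pmf.prob (T c) (Err c))"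
      by (rule measure_pmf.expectation_greater)
         (auto simp: AE_measure_pmf_iff less intro!: measure_pmf.integrable_const_bound[where B = 1])
    ultimately show False by simp
  qed
  then obtain c where "measure_pmf.prob (T c) (Err c) \<le> measure_pmf.prob J {(c, z). z \<in> Err c}" by blast
  with avg have c: "measure_pmf.prob (T c) (Err c) \<le> measure_pmf.prob (ideal_law pU1 pU2 pW pX1W pX2 K1 K2) bad + 4 * \<eta>"
    by simp
  obtain r w x1 x2 where cc: "c = (r, w, x1, x2)" by (cases c)
  show ?thesis
    by (intro exI[of _ x1] exI[of _ x2] exI[of _ "g1 c"] exI[of _ "g2 c"])
       (use c in \<open>simp add: cc T_def Err_def bad_def\<close>)
qed

section \<open>Achievability\<close>

lemma lln_lower:
  fixes \<phi> :: "'a \<Rightarrow> real" and c :: real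
  assumes fin: "finite (set_pmf P)" and c: "c < expec P \<phi>"
  shows "(\<lambda>n. measure_pmf.prob (PiN n (\<lambda>_. P)) {l. (\<Sum>i<n. \<phi> (l i)) \<le> n * c}) \<longlonglongrightarrow> 0"
proof -
  \<comment> \<open>The summand 1 keeps the interval nondegenerate even if \<open>\<phi>\<close>
    vanishes, as the Hoeffding bound divides by its length.\<close>
  define b where "b = 1 + (\<Sum>x\<in>set_pmf P. \<bar>\<phi> x\<bar>)"
  have b: "\<phi> x \<in> {- b..b}" if "x \<in> set_pmf P" for x
    using member_le_sum[of x "set_pmf P" "\<lambda>x. \<bar>\<phi> x\<bar>"] fin that by (auto simp: b_def)
  have "(\<Sum>x\<in>set_pmf P. \<bar>\<phi> x\<bar>) \<ge> 0" by (rule sum_nonneg) simp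
  then have b0: "b > 0" unfolding b_def by linarith
  define \<epsilon> where "\<epsilon> = expec P \<phi> - c"
  define K where "K = 2 * \<epsilon>\<^sup>2 / (b - - b)\<^sup>2"
  have K: "K > 0" using c b0 by (simp add: K_def \<epsilon>_def)
  have bound: "measure_pmf.prob (PiN n (\<lambda>_. P)) {l. (\<Sum>i<n. \<phi> (l i)) \<le> n * c} \<le> exp (- (K * n))" if n: "n \<ge> 1" for n
  proof -
    let ?M = "PiN n (\<lambda>_. P)"
    have comp: "map_pmf (\<lambda>l. l i) ?M = P" if "i < n" for i
      using that by (subst Pi_pmf_component) auto
    interpret Hoeffding_ineq "measure_pmf ?M" "{..<n}" "\<lambda>i l. \<phi> (l i)" "\<lambda>_. - b" "\<lambda>_. b" "\<Sum>i<n. expec ?M (\<lambda>l. \<phi> (l i))"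
    proof unfold_locales
      show "prob_space.indep_vars (measure_pmf ?M) (\<lambda>_. borel) (\<lambda>i l. \<phi> (l i)) {..<n}"
        by (rule prob_space.indep_vars_compose2[OF measure_pmf.prob_space_axioms indep_vars_Pi_pmf]) auto
      fix i assume "i \<in> {..<n}"
      then have "set_pmf P = (\<lambda>l. l i) ` set_pmf ?M" using comp[of i] by (metis lessThan_iff set_map_pmf)
      then show "AE l in measure_pmf ?M. \<phi> (l i) \<in> {- b..b}"
        using b by (auto simp: AE_measure_pmf_iff)
    qed auto
    have "expec ?M (\<lambda>l. \<phi> (l i)) = expec P \<phi>" if "i < n" for i
      using comp[OF that] by (metis integral_map_pmf)
    then have mu: "(\<Sum>i<n. expec ?M (\<lambda>l. \<phi> (l i))) = n * expec P \<phi>" by simp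
    have "(\<Sum>i\<in>{..<n}. (b - - b)\<^sup>2) > 0" using n b0 by simp
    from Hoeffding_ineq_le[OF _ this, of "n * \<epsilon>"] c
    have "measure_pmf.prob ?M {l. (\<Sum>i<n. \<phi> (l i)) \<le> n * expec P \<phi> - n * \<epsilon>} \<le> exp (- 2 * (n * \<epsilon>)\<^sup>2 / (n * (b - - b)\<^sup>2))"
      unfolding mu by (simp add: \<epsilon>_def)
    also have "n * expec P \<phi> - n * \<epsilon> = n * c" by (simp add: \<epsilon>_def algebra_simps)
    also have "- 2 * (n * \<epsilon>)\<^sup>2 / (n * (b - - b)\<^sup>2) = - (K * n)"
      using n by (simp add: K_def power_mult_distrib) (simp add: power2_eq_square)
    finally show ?thesis .
  qed
  have "(\<lambda>n. exp (- (K * real n))) = (\<lambda>n. exp (- K) ^ n)"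
    by (simp add: exp_of_nat_mult[symmetric] mult.commute)
  moreover have "(\<lambda>n. exp (- K) ^ n) \<longlonglongrightarrow> 0"
    by (rule LIMSEQ_power_zero) (use K in simp)
  ultimately have lim: "(\<lambda>n. exp (- (K * real n))) \<longlonglongrightarrow> 0" by simp
  show ?thesis
    by (rule tendsto_sandwich[OF _ _ tendsto_const lim])
       (auto intro!: always_eventually eventually_mono[OF eventually_ge_at_top[of 1]] bound)
qed

text \<open>On the support both products are positive, so logarithms turn the failure of a
  likelihood test into a lower deviation of a sum of i.i.d. terms.\<close>

lemma lln_ratio:
  fixes f g :: "'a \<Rightarrow> real" and c :: real
  assumes fin: "finite (set_pmf P)"
    and pos: "\<And>l. l \<in> set_pmf P \<Longrightarrow> f l > 0" "\<And>l. l \<in> set_pmf P \<Longrightarrow> g l > 0"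
    and c: "c < expec P (\<lambda>l. log 2 (f l) - log 2 (g l))"
  shows "(\<lambda>n. measure_pmf.prob (PiN n (\<lambda>_. P)) {l. (\<Prod>i<n. f (l i)) \<le> 2 powr (n * c) * (\<Prod>i<n. g (l i))}) \<longlonglongrightarrow> 0"
proof -
  have "measure_pmf.prob (PiN n (\<lambda>_. P)) {l. (\<Prod>i<n. f (l i)) \<le> 2 powr (n * c) * (\<Prod>i<n. g (l i))}
      = measure_pmf.prob (PiN n (\<lambda>_. P)) {l. (\<Sum>i<n. log 2 (f (l i)) - log 2 (g (l i))) \<le> n * c}" for n
  proof (rule measure_pmf.finite_measure_eq_AE)
    show "AE l in measure_pmf (PiN n (\<lambda>_. P)). (l \<in> {l. (\<Prod>i<n. f (l i)) \<le> 2 powr (n * c) * (\<Prod>i<n. g (l i))})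
       = (l \<in> {l. (\<Sum>i<n. log 2 (f (l i)) - log 2 (g (l i))) \<le> n * c})"
    proof (unfold AE_measure_pmf_iff, intro ballI)
      fix l assume "l \<in> set_pmf (PiN n (\<lambda>_. P))"
      then have l: "l i \<in> set_pmf P" if "i < n" for i
        using that by (auto simp: set_Pi_pmf PiE_dflt_def)
      have lp: "(\<Prod>i<n. k (l i)) > 0 \<and> log 2 (\<Prod>i<n. k (l i)) = (\<Sum>i<n. log 2 (k (l i)))" if "\<And>l. l \<in> set_pmf P \<Longrightarrow> k l > 0" for k
      proof -
        have "\<forall>i<n. k (l i) > 0" using that l by auto
        then show ?thesis
          by (induction n) (auto simp: log_mult less_imp_neq[symmetric] prod_pos)
      qed
      note lf = lp[of f, OF pos(1)] and lg = lp[of g, OF pos(2)]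
      have "(\<Prod>i<n. f (l i)) \<le> 2 powr (n * c) * (\<Prod>i<n. g (l i))
        \<longleftrightarrow> log 2 (\<Prod>i<n. f (l i)) \<le> log 2 (2 powr (n * c) * (\<Prod>i<n. g (l i)))"
        using lf lg by (subst log_le_cancel_iff) auto
      also have "log 2 (2 powr (n * c) * (\<Prod>i<n. g (l i))) = n * c + log 2 (\<Prod>i<n. g (l i))"
        by (subst log_mult) (use lg in \<open>auto simp del: prod_zero_iff\<close>)
      also have "log 2 (\<Prod>i<n. f (l i)) \<le> n * c + log 2 (\<Prod>i<n. g (l i))
         \<longleftrightarrow> (\<Sum>i<n. log 2 (f (l i)) - log 2 (g (l i))) \<le> n * c"
        using lf lg by (simp add: sum_subtractf algebra_simps)
      finally show "(l \<in> {l. (\<Prod>i<n. f (l i)) \<le> 2 powr (n * c) * (\<Prod>i<n. g (l i))})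
       = (l \<in> {l. (\<Sum>i<n. log 2 (f (l i)) - log 2 (g (l i))) \<le> n * c})" by simp
    qed
  qed auto
  then show ?thesis using lln_lower[OF fin c] by simp
qed

section \<open>From the one-shot code to block codes\<close>

lemma res_lst: "res n ((!) (lst n f)) = res n f"
  by (auto simp: res_def)

lemma res_PiN: "f \<in> set_pmf (PiN n K) \<Longrightarrow> res n f = f"
  using PiN_undefined by (fastforce simp: res_def)

lemma pmf_PiN_res: "pmf (PiN n K) (res n v) = (\<Prod>i<n. pmf (K i) (v i))"
  by (subst pmf_Pi') (auto simp: res_def)

lemma PiN_cong: "(\<And>i. i < n \<Longrightarrow> K i = L i) \<Longrightarrow> PiN n K = PiN n L"
  by (rule Pi_pmf_cong) auto

lemma PiN_bind: "PiN n (\<lambda>i. bind_pmf (K i) (L i)) = bind_pmf (PiN n K) (\<lambda>f. PiN n (\<lambda>i. L i (f i)))"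
  by (rule Pi_pmf_bind) simp

lemma PiN_return: "PiN n (\<lambda>i. return_pmf (f i)) = return_pmf (res n f)"
  by (simp add: res_def lessThan_def)

lemma PiN_map: "PiN n (\<lambda>i. map_pmf (k i) (K i)) = map_pmf (\<lambda>f. res n (\<lambda>i. k i (f i))) (PiN n K)"
  by (simp add: map_pmf_def PiN_bind PiN_return)

text \<open>The summands are the conditional probabilities of \<open>u\<close> given its value of
  \<open>h\<close>; over a fibre they add up to 1, or to 0 if the fibre has no mass.\<close>

lemma sum_pmf_fibre_le:
  assumes "finite (set_pmf p)"
  shows "(\<Sum>u\<in>{u \<in> set_pmf p. h u = v}. pmf p u / pmf (map_pmf h p) (h u)) \<le> 1"
proof -
  have "(\<Sum>u\<in>{u \<in> set_pmf p. h u = v}. pmf p u / pmf (map_pmf h p) (h u))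
     = (\<Sum>u\<in>{u \<in> set_pmf p. h u = v}. pmf p u) / pmf (map_pmf h p) v"
    by (simp add: sum_divide_distrib)
  also have "(\<Sum>u\<in>{u \<in> set_pmf p. h u = v}. pmf p u) = measure_pmf.prob p {u \<in> set_pmf p. h u = v}"
    using assms by (simp add: measure_measure_pmf_finite)
  also have "\<dots> = pmf (map_pmf h p) v"
    unfolding pmf_map by (intro measure_pmf.finite_measure_eq_AE) (auto simp: AE_measure_pmf_iff)
  finally show ?thesis by simp
qed

text \<open>Lists of length \<open>n\<close> and functions with the default beyond \<open>n\<close>
  carry the same words. List access is unspecified past the end, so it is restricted by
  \<open>res\<close> before it enters the function code.\<close>

lemma list_code:
  fixes q1 :: "'x1 \<Rightarrow> 'y1 pmf" and q2 :: "'x1 \<Rightarrow> 'x2 \<Rightarrow> 'y2 pmf" and n :: nat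
    and f1 :: "(nat \<Rightarrow> 'u1) \<Rightarrow> nat \<Rightarrow> 'x1" and f2 :: "(nat \<Rightarrow> 'u2) \<Rightarrow> nat \<Rightarrow> 'x2"
    and g1 :: "(nat \<Rightarrow> 'y1) \<Rightarrow> nat \<Rightarrow> 'u1" and g2 :: "(nat \<Rightarrow> 'y2) \<Rightarrow> (nat \<Rightarrow> 'v1) \<Rightarrow> nat \<Rightarrow> 'u2"
  assumes ch: "\<And>x1 x2. ch x1 x2 = pair_pmf (q1 x1) (q2 x1 x2)"
  defines "F1 \<equiv> \<lambda>us. lst n (f1 (res n ((!) us)))" and "F2 \<equiv> \<lambda>us. lst n (f2 (res n ((!) us)))"
    and "G1 \<equiv> \<lambda>ys. lst n (g1 (res n ((!) ys)))" and "G2 \<equiv> \<lambda>ys vs. lst n (g2 (res n ((!) ys)) (res n ((!) vs)))"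
  shows "error_prob n ch pU1 h1 pU2 F1 F2 G1 G2
    \<le> measure_pmf.prob (transmission_law (PiN n (\<lambda>_. pU1)) (PiN n (\<lambda>_. pU2)) (\<lambda>x. PiN n (\<lambda>i. q1 (x i)))
         (\<lambda>x x'. PiN n (\<lambda>i. q2 (x i) (x' i))) f1 f2)
       {(u1, u2, y1, y2). (u1, u2) \<noteq> (g1 y1, g2 y2 (res n (\<lambda>i. h1 (u1 i))))}"
proof -
  let ?T = "transmission_law (PiN n (\<lambda>_. pU1)) (PiN n (\<lambda>_. pU2)) (\<lambda>x. PiN n (\<lambda>i. q1 (x i)))
         (\<lambda>x x'. PiN n (\<lambda>i. q2 (x i) (x' i))) f1 f2"
  have k1: "PiN n (\<lambda>i. q1 (F1 us ! i)) = PiN n (\<lambda>i. q1 (f1 (res n ((!) us)) i))" for us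
    by (rule PiN_cong) (simp add: F1_def)
  have k2: "PiN n (\<lambda>i. q2 (F1 us ! i) (F2 us' ! i)) = PiN n (\<lambda>i. q2 (f1 (res n ((!) us)) i) (f2 (res n ((!) us')) i))" for us us'
    by (rule PiN_cong) (simp add: F1_def F2_def)
  have "code_fun_law n q1 q2 pU1 pU2 F1 F2 = map_pmf (\<lambda>(u1, u2, y1, y2). (lst n u1, lst n u2, y1, y2)) ?T"
    unfolding code_fun_law_def transmission_law_def replicate_pmf_eq_Pi k1 k2
    by (auto simp: bind_map_pmf map_bind_pmf res_lst res_PiN intro!: bind_pmf_cong)
  then have "error_prob n ch pU1 h1 pU2 F1 F2 G1 G2
     = measure_pmf.prob ?T ((\<lambda>(u1, u2, y1, y2). (lst n u1, lst n u2, y1, y2)) -`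
        {(us1, us2, y1, y2). (us1, us2) \<noteq> (G1 (lst n y1), G2 (lst n y2) (map h1 us1))})"
    by (simp add: error_prob_eq[OF ch])
  also have "\<dots> \<le> measure_pmf.prob ?T {(u1, u2, y1, y2). (u1, u2) \<noteq> (g1 y1, g2 y2 (res n (\<lambda>i. h1 (u1 i))))}"
  proof (rule measure_pmf.finite_measure_mono_AE)
    have "x \<in> {(u1, u2, y1, y2). (u1, u2) \<noteq> (g1 y1, g2 y2 (res n (\<lambda>i. h1 (u1 i))))}"
      if x: "x \<in> set_pmf ?T" and bad: "x \<in> (\<lambda>(u1, u2, y1, y2). (lst n u1, lst n u2, y1, y2)) -`
        {(us1, us2, y1, y2). (us1, us2) \<noteq> (G1 (lst n y1), G2 (lst n y2) (map h1 us1))}" for x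
    proof -
      obtain u1 u2 y1 y2 where xx: "x = (u1, u2, y1, y2)" by (cases x)
      have "res n y1 = y1" "res n y2 = y2"
        using x by (auto simp: xx transmission_law_def intro!: res_PiN)
      moreover have "res n ((!) (map h1 (lst n u1))) = res n (\<lambda>i. h1 (u1 i))"
        by (auto simp: res_def)
      ultimately show ?thesis using bad by (auto simp: xx G1_def G2_def res_lst simp del: map_map)
    qed
    then show "AE x in measure_pmf ?T. x \<in> (\<lambda>(u1, u2, y1, y2). (lst n u1, lst n u2, y1, y2)) -`
        {(us1, us2, y1, y2). (us1, us2) \<noteq> (G1 (lst n y1), G2 (lst n y2) (map h1 us1))}
      \<longrightarrow> x \<in> {(u1, u2, y1, y2). (u1, u2) \<noteq> (g1 y1, g2 y2 (res n (\<lambda>i. h1 (u1 i))))}"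
      unfolding AE_measure_pmf_iff by blast
  qed simp
  finally show ?thesis .
qed

text \<open>Reading independent letters componentwise is the same as drawing whole words stage by
  stage. This expresses test failures for words under an i.i.d. law of letters.\<close>

lemma ideal_law_block:
  "ideal_law (PiN n (\<lambda>_. pU1)) (PiN n (\<lambda>_. pU2)) (PiN n (\<lambda>_. pW)) (\<lambda>w. PiN n (\<lambda>i. pX1W (w i)))
     (PiN n (\<lambda>_. pX2)) (\<lambda>x. PiN n (\<lambda>i. q1 (x i))) (\<lambda>x x'. PiN n (\<lambda>i. q2 (x i) (x' i)))
   = map_pmf (\<lambda>l. (res n (\<lambda>i. U1 (l i)), res n (\<lambda>i. U2 (l i)), res n (\<lambda>i. W (l i)), res n (\<lambda>i. X1 (l i)),
        res n (\<lambda>i. X2 (l i)), res n (\<lambda>i. Y1 (l i)), res n (\<lambda>i. Y2 (l i))))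
       (PiN n (\<lambda>_. single_letter_law q1 q2 pU1 h1 pU2 pW pX1W pX2))"
proof -
  show ?thesis
    unfolding single_letter_law_def PiN_bind PiN_return ideal_law_def map_bind_pmf map_return_pmf
    by (intro bind_pmf_cong refl) (simp add: res_def fun_eq_iff PiN_undefined)
qed

text \<open>The number \<open>t\<close> is the margin by which a weighted likelihood must beat the
  output law. Each kind of competitor passes its test with total probability at most
  \<open>1 / t\<close>, which gives \<open>4 / t\<close>; the other terms are the probabilities that
  the true words fail.\<close>

lemma coding_block:
  fixes q1 :: "'x1::finite \<Rightarrow> 'y1::finite pmf" and q2 :: "'x1 \<Rightarrow> 'x2::finite \<Rightarrow> 'y2::finite pmf"
    and pU1 :: "'u1::finite pmf" and pU2 :: "'u2::finite pmf" and h1 :: "'u1 \<Rightarrow> 'v1::finite"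
    and pW :: "nat pmf" and pX1W :: "nat \<Rightarrow> 'x1 pmf" and pX2 :: "'x2 pmf" and n M :: nat and t :: real
  assumes ch: "\<And>x1 x2. ch x1 x2 = pair_pmf (q1 x1) (q2 x1 x2)"
    and finW: "finite (set_pmf pW)" and M: "M > 0" and t: "t > 0"
  defines "Q1W \<equiv> \<lambda>w. bind_pmf (pX1W w) q1"
    and "K2W \<equiv> \<lambda>w x2. bind_pmf (pX1W w) (\<lambda>x1. q2 x1 x2)"
    and "Q2W \<equiv> \<lambda>w. bind_pmf (pX1W w) (\<lambda>x1. bind_pmf pX2 (q2 x1))"
    and "L \<equiv> PiN n (\<lambda>_. single_letter_law q1 q2 pU1 h1 pU2 pW pX1W pX2)"
  shows "\<exists>F1 F2 G1 G2. (\<forall>us. length (F1 us) = n) \<and> (\<forall>us. length (F2 us) = n) \<and>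
     (\<forall>ys. length (G1 ys) = n) \<and> (\<forall>ys vs. length (G2 ys vs) = n) \<and>
     error_prob n ch pU1 h1 pU2 F1 F2 G1 G2 \<le> 4 / t
     + measure_pmf.prob L {l. (\<Prod>i<n. pmf (q1 (X1 (l i))) (Y1 (l i)) * pmf pU1 (U1 (l i)))
         \<le> t * (\<Prod>i<n. pmf (bind_pmf pW Q1W) (Y1 (l i)))}
     + measure_pmf.prob L {l. M * (\<Prod>i<n. pmf (q1 (X1 (l i))) (Y1 (l i)) * pmf pU1 (U1 (l i)))
         \<le> t * (\<Prod>i<n. pmf (Q1W (W (l i))) (Y1 (l i)) * pmf (map_pmf h1 pU1) (h1 (U1 (l i))))}
     + measure_pmf.prob L {l. (\<Prod>i<n. pmf (K2W (W (l i)) (X2 (l i))) (Y2 (l i)) * pmf pU2 (U2 (l i)))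
         \<le> t * M * (\<Prod>i<n. pmf (bind_pmf pW Q2W) (Y2 (l i)))}
     + measure_pmf.prob L {l. (\<Prod>i<n. pmf (K2W (W (l i)) (X2 (l i))) (Y2 (l i)) * pmf pU2 (U2 (l i)))
         \<le> t * (\<Prod>i<n. pmf (Q2W (W (l i))) (Y2 (l i)))}"
     (is "\<exists>F1 F2 G1 G2. _ F1 \<and> _ F2 \<and> _ G1 \<and> _ G2 \<and> _ \<le> 4 / t + measure_pmf.prob L ?EA + measure_pmf.prob L ?EB + measure_pmf.prob L ?EC + measure_pmf.prob L ?ED")
proof -
  define P1 where "P1 = PiN n (\<lambda>_. pU1)"
  define P2 where "P2 = PiN n (\<lambda>_. pU2)"
  define PW where "PW = PiN n (\<lambda>_. pW)"
  define kX where "kX = (\<lambda>w. PiN n (\<lambda>i. pX1W (w i)))"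
  define PX2 where "PX2 = PiN n (\<lambda>_. pX2)"
  define K1 where "K1 = (\<lambda>x. PiN n (\<lambda>i. q1 (x i)))"
  define K2 where "K2 = (\<lambda>x x'. PiN n (\<lambda>i. q2 (x i) (x' i)))"
  define hh where "hh = (\<lambda>u. res n (\<lambda>i. h1 (u i)))"
  define KK where "KK = (\<lambda>w x. PiN n (\<lambda>i. K2W (w i) (x i)))"
  have V: "map_pmf hh P1 = PiN n (\<lambda>_. map_pmf h1 pU1)"
    by (simp add: hh_def P1_def PiN_map)
  have mix1: "bind_pmf (kX w) K1 = PiN n (\<lambda>i. Q1W (w i))" for w
    by (simp add: kX_def K1_def Q1W_def PiN_bind)
  have mix1': "bind_pmf PW (\<lambda>w. bind_pmf (kX w) K1) = PiN n (\<lambda>_. bind_pmf pW Q1W)"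
    by (simp add: mix1 PW_def PiN_bind)
  have mix2: "bind_pmf (kX w) (\<lambda>x1. bind_pmf PX2 (K2 x1)) = PiN n (\<lambda>i. Q2W (w i))" for w
    by (simp add: kX_def K2_def PX2_def Q2W_def PiN_bind)
  have mix2': "bind_pmf PW (\<lambda>w. bind_pmf (kX w) (\<lambda>x1. bind_pmf PX2 (K2 x1))) = PiN n (\<lambda>_. bind_pmf pW Q2W)"
    by (simp add: mix2 PW_def PiN_bind)
  \<comment> \<open>The conditional probability of the source word given its side information, the
    weight appropriate among words in the same cloud.\<close>
  define b where "b = (\<lambda>u. pmf P1 u / pmf (map_pmf hh P1) (hh u))"
  define A where "A = (\<lambda>u x y. t * pmf (PiN n (\<lambda>_. bind_pmf pW Q1W)) y < pmf (K1 x) y * pmf P1 u)"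
  define B where "B = (\<lambda>u w x y. t * pmf (PiN n (\<lambda>i. Q1W (w i))) y < pmf (K1 x) y * (M * b u))"
  \<comment> \<open>Receiver 2 does not decode the satellite: through \<open>KK\<close> the first
    input is averaged out given the cloud centre. The factor \<open>M\<close> pays for the hashes
    that it has to exclude.\<close>
  define C where "C = (\<lambda>u w x y. (t * M) * pmf (PiN n (\<lambda>_. bind_pmf pW Q2W)) y < pmf (KK w x) y * pmf P2 u)"
  define D where "D = (\<lambda>u w x y. t * pmf (PiN n (\<lambda>i. Q2W (w i))) y < pmf (KK w x) y * pmf P2 u)"
  have b0: "b u \<ge> 0" for u by (simp add: b_def)
  have "\<exists>f1 f2 g1 g2. measure_pmf.prob (transmission_law P1 P2 K1 K2 f1 f2)
        {(u1, u2, y1, y2). (u1, u2) \<noteq> (g1 y1, g2 y2 (hh u1))}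
     \<le> measure_pmf.prob (ideal_law P1 P2 PW kX PX2 K1 K2)
        {(u1, u2, w, x1, x2, y1, y2). \<not> (A u1 x1 y1 \<and> B u1 w x1 y1 \<and> C u2 w x2 y2 \<and> D u2 w x2 y2)} + 4 * (1 / t)"
  proof (rule random_coding[where M = M and b = b])
    show "measure_pmf.prob (bind_pmf PW (\<lambda>w. bind_pmf (kX w) K1)) {y. A u x y} \<le> pmf P1 u * (1 / t)" for u x
      unfolding mix1' A_def using prob_threshold_le[OF t, of "pmf P1 u"] by simp
    show "measure_pmf.prob (bind_pmf (kX w) K1) {y. B u w x y} \<le> M * b u * (1 / t)" for u w x
      unfolding mix1 B_def using prob_threshold_le[OF t, of "M * b u"] b0 by simp
    show "measure_pmf.prob (bind_pmf PW (\<lambda>w. bind_pmf (kX w) (\<lambda>x1. bind_pmf PX2 (K2 x1)))) {y. C u w x y} \<le> pmf P2 u * (1 / t) / M" for u w x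
      unfolding mix2' C_def using prob_threshold_le[of "t * M" "pmf P2 u"] t M by simp
    show "measure_pmf.prob (bind_pmf (kX w) (\<lambda>x1. bind_pmf PX2 (K2 x1))) {y. D u w x y} \<le> pmf P2 u * (1 / t)" for u w x
      unfolding mix2 D_def using prob_threshold_le[OF t, of "pmf P2 u"] by simp
    show "(\<Sum>u\<in>{u \<in> set_pmf P1. hh u = v}. b u) \<le> 1" for v
      unfolding b_def by (rule sum_pmf_fibre_le) (simp add: P1_def finite_set_PiN)
  qed (use M t b0 in \<open>auto simp: P1_def P2_def finite_set_PiN\<close>)
  then obtain f1 f2 g1 g2 where code: "measure_pmf.prob (transmission_law P1 P2 K1 K2 f1 f2)
        {(u1, u2, y1, y2). (u1, u2) \<noteq> (g1 y1, g2 y2 (hh u1))}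
     \<le> measure_pmf.prob (ideal_law P1 P2 PW kX PX2 K1 K2)
        {(u1, u2, w, x1, x2, y1, y2). \<not> (A u1 x1 y1 \<and> B u1 w x1 y1 \<and> C u2 w x2 y2 \<and> D u2 w x2 y2)} + 4 * (1 / t)"
    by blast
  define F1 where "F1 = (\<lambda>us. lst n (f1 (res n ((!) us))))"
  define F2 where "F2 = (\<lambda>us. lst n (f2 (res n ((!) us))))"
  define G1 where "G1 = (\<lambda>ys. lst n (g1 (res n ((!) ys))))"
  define G2 where "G2 = (\<lambda>ys vs. lst n (g2 (res n ((!) ys)) (res n ((!) vs))))"
  have "error_prob n ch pU1 h1 pU2 F1 F2 G1 G2 \<le> measure_pmf.prob (transmission_law P1 P2 K1 K2 f1 f2)
        {(u1, u2, y1, y2). (u1, u2) \<noteq> (g1 y1, g2 y2 (hh u1))}"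
    unfolding F1_def F2_def G1_def G2_def P1_def P2_def K1_def K2_def hh_def by (rule list_code[OF ch])
  also note code
  also have "measure_pmf.prob (ideal_law P1 P2 PW kX PX2 K1 K2)
        {(u1, u2, w, x1, x2, y1, y2). \<not> (A u1 x1 y1 \<and> B u1 w x1 y1 \<and> C u2 w x2 y2 \<and> D u2 w x2 y2)}
    \<le> measure_pmf.prob L (?EA \<union> ?EB \<union> ?EC \<union> ?ED)"
    unfolding P1_def P2_def PW_def kX_def PX2_def K1_def K2_def ideal_law_block[where ?h1.0 = h1] L_def[symmetric] measure_map_pmf
  proof (rule measure_pmf.finite_measure_mono_AE)
    let ?F = "\<lambda>l. (res n (\<lambda>i. U1 (l i)), res n (\<lambda>i. U2 (l i)), res n (\<lambda>i. W (l i)), res n (\<lambda>i. X1 (l i)),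
        res n (\<lambda>i. X2 (l i)), res n (\<lambda>i. Y1 (l i)), res n (\<lambda>i. Y2 (l i)))"
    let ?bad = "{(u1, u2, w, x1, x2, y1, y2). \<not> (A u1 x1 y1 \<and> B u1 w x1 y1 \<and> C u2 w x2 y2 \<and> D u2 w x2 y2)}"
    show "AE l in measure_pmf L. l \<in> ?F -` ?bad \<longrightarrow> l \<in> ?EA \<union> ?EB \<union> ?EC \<union> ?ED"
      unfolding AE_measure_pmf_iff
    proof (intro ballI impI, rule ccontr)
      fix l assume l: "l \<in> set_pmf L" and bad: "l \<in> ?F -` ?bad" and ok: "l \<notin> ?EA \<union> ?EB \<union> ?EC \<union> ?ED"
      have K1r: "PiN n (\<lambda>i. q1 (res n x i)) = PiN n (\<lambda>i. q1 (x i))" for x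
        by (rule PiN_cong) simp
      have KKr: "PiN n (\<lambda>i. K2W (res n w i) (res n x i)) = PiN n (\<lambda>i. K2W (w i) (x i))" for w x
        by (rule PiN_cong) simp
      have Q1r: "PiN n (\<lambda>i. Q1W (res n w i)) = PiN n (\<lambda>i. Q1W (w i))" for w
        by (rule PiN_cong) simp
      have Q2r: "PiN n (\<lambda>i. Q2W (res n w i)) = PiN n (\<lambda>i. Q2W (w i))" for w
        by (rule PiN_cong) simp
      have hr: "hh (res n u) = res n (\<lambda>i. h1 (u i))" for u
        by (auto simp: hh_def res_def)
      have mem: "U1 (l i) \<in> set_pmf pU1" if "i < n" for i
        using l that law_support(1)[of "l i" q1 q2 pU1 h1 pU2 pW pX1W pX2]
        by (auto simp: L_def set_Pi_pmf PiE_dflt_def)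
      \<comment> \<open>\<open>B\<close> contains the quotient \<open>b\<close>; positivity of its
        denominator gives the division-free form of \<open>?EB\<close>.\<close>
      have pV: "(\<Prod>i<n. pmf (map_pmf h1 pU1) (h1 (U1 (l i)))) > 0"
        by (rule prod_pos) (use mem in \<open>auto intro!: pmf_positive\<close>)
      have a: "A (res n (\<lambda>i. U1 (l i))) (res n (\<lambda>i. X1 (l i))) (res n (\<lambda>i. Y1 (l i)))"
        using ok by (simp add: A_def K1_def K1r P1_def pmf_PiN_res prod.distrib)
      have b: "B (res n (\<lambda>i. U1 (l i))) (res n (\<lambda>i. W (l i))) (res n (\<lambda>i. X1 (l i))) (res n (\<lambda>i. Y1 (l i)))"
        using ok pV unfolding B_def b_def V
        by (simp add: K1_def K1r Q1r P1_def hr pmf_PiN_res prod.distrib field_simps)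
      have c: "C (res n (\<lambda>i. U2 (l i))) (res n (\<lambda>i. W (l i))) (res n (\<lambda>i. X2 (l i))) (res n (\<lambda>i. Y2 (l i)))"
        using ok by (simp add: C_def KK_def KKr P2_def pmf_PiN_res prod.distrib)
      have d: "D (res n (\<lambda>i. U2 (l i))) (res n (\<lambda>i. W (l i))) (res n (\<lambda>i. X2 (l i))) (res n (\<lambda>i. Y2 (l i)))"
        using ok by (simp add: D_def KK_def KKr Q2r P2_def pmf_PiN_res prod.distrib)
      show False using bad a b c d by simp
    qed
  qed simp
  also have "measure_pmf.prob L (?EA \<union> ?EB \<union> ?EC \<union> ?ED)
    \<le> measure_pmf.prob L ?EA + measure_pmf.prob L ?EB + measure_pmf.prob L ?EC + measure_pmf.prob L ?ED"
    using measure_Un_le[of "?EA \<union> ?EB \<union> ?EC" "measure_pmf L" ?ED] measure_Un_le[of "?EA \<union> ?EB" "measure_pmf L" ?EC]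
      measure_Un_le[of ?EA "measure_pmf L" ?EB] by simp
  finally have "error_prob n ch pU1 h1 pU2 F1 F2 G1 G2 \<le> 4 / t + measure_pmf.prob L ?EA + measure_pmf.prob L ?EB + measure_pmf.prob L ?EC + measure_pmf.prob L ?ED"
    by simp
  moreover have "length (F1 us) = n" "length (F2 us') = n" "length (G1 ys) = n" "length (G2 ys' vs) = n" for us us' ys ys' vs
    by (simp_all add: F1_def F2_def G1_def G2_def)
  ultimately show ?thesis by blast
qed

lemma achievability:
  fixes ch :: "'x1::finite \<Rightarrow> 'x2::finite \<Rightarrow> ('y1::finite \<times> 'y2::finite) pmf"
    and q1 :: "'x1 \<Rightarrow> 'y1 pmf" and q2 :: "'x1 \<Rightarrow> 'x2 \<Rightarrow> 'y2 pmf"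
    and pU1 :: "'u1::finite pmf" and pU2 :: "'u2::finite pmf" and h1 :: "'u1 \<Rightarrow> 'v1::finite"
    and pW :: "nat pmf" and pX1W :: "nat \<Rightarrow> 'x1 pmf" and pX2 :: "'x2 pmf"
  assumes ch: "\<And>x1 x2. ch x1 x2 = pair_pmf (q1 x1) (q2 x1 x2)"
    and finW: "finite (set_pmf pW)" and c2: "condition2_witness q2 pX2"
  defines "P \<equiv> single_letter_law q1 q2 pU1 h1 pU2 pW pX1W pX2"
  assumes r1: "H P U1 < I P X1 Y1"
    and r2: "H P U2 < I P (\<lambda>l. (W l, X2 l)) Y2"
    and r3: "H_cond P U1 V1 + H P U2 < I P (\<lambda>l. (W l, X2 l)) Y2 + I_cond P X1 Y1 W"
  shows "reliable_transmission ch pU1 h1 pU2"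
proof -
  define Q1W where "Q1W = (\<lambda>w. bind_pmf (pX1W w) q1)"
  define K2W where "K2W = (\<lambda>w x2. bind_pmf (pX1W w) (\<lambda>x1. q2 x1 x2))"
  define Q2W where "Q2W = (\<lambda>w. bind_pmf (pX1W w) (\<lambda>x1. bind_pmf pX2 (q2 x1)))"
  let ?\<tau> = "max_output_entropy q2"
  have finP: "finite (set_pmf P)" unfolding P_def by (rule finite_set_single_letter_law[OF finW])
  note supp = law_support[of _ q1 q2 pU1 h1 pU2 pW pX1W pX2, folded P_def]
  have J1: "map_pmf (\<lambda>l. (X1 l, Y1 l)) P = bind_pmf (bind_pmf pW pX1W) (\<lambda>x. map_pmf (Pair x) (q1 x))"
    and J2: "map_pmf (\<lambda>l. ((W l, X2 l), Y2 l)) P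
      = bind_pmf (pair_pmf pW pX2) (\<lambda>z. map_pmf (Pair z) (K2W (fst z) (snd z)))"
    and J3: "map_pmf (\<lambda>l. (W l, Y1 l)) P = bind_pmf pW (\<lambda>w. map_pmf (Pair w) (Q1W w))"
    and J4: "map_pmf (\<lambda>l. (W l, Y2 l)) P = bind_pmf pW (\<lambda>w. map_pmf (Pair w) (Q2W w))"
    and mU1: "map_pmf U1 P = pU1" and mU2: "map_pmf U2 P = pU2"
    and mV1: "map_pmf (\<lambda>l. h1 (U1 l)) P = map_pmf h1 pU1"
    and mY1: "map_pmf Y1 P = bind_pmf pW Q1W" and mY2: "map_pmf Y2 P = bind_pmf pW Q2W"
    unfolding P_def Q1W_def K2W_def Q2W_def by (rule map_single_letter_law)+
  \<comment> \<open>With \<open>pX2\<close> as the second input law, \<open>Y2\<close> has entropy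
    \<open>?\<tau>\<close> given any cloud as well as on average. The tests \<open>C\<close> and
    \<open>D\<close> therefore have the same information gap, and only \<open>C\<close> is burdened
    by \<open>R\<close>.\<close>
  have tau: "ent (Q2W w) = ?\<tau>" "ent (bind_pmf pW Q2W) = ?\<tau>" for w
  proof -
    have "Q2W w = output_law q2 (pX1W w) pX2" "bind_pmf pW Q2W = output_law q2 (bind_pmf pW pX1W) pX2"
      by (simp_all add: Q2W_def output_law_def bind_assoc_pmf)
    then show "ent (Q2W w) = ?\<tau>" "ent (bind_pmf pW Q2W) = ?\<tau>"
      using c2 by (simp_all add: condition2_witness_def H_eq_ent)
  qed
  define S where "S = expec (pair_pmf pW pX2) (\<lambda>z. ent (K2W (fst z) (snd z)))"
  define e where "e = expec (bind_pmf pW pX1W) (\<lambda>x. ent (q1 x))"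
  define HW where "HW = expec pW (\<lambda>w. ent (Q1W w))"
  have "I P X1 Y1 = ent (bind_pmf pW Q1W) - e"
    unfolding I_eq_ent[OF finP] mY1 cent_kernel[OF finP J1] e_def ..
  moreover have "I P (\<lambda>l. (W l, X2 l)) Y2 = ?\<tau> - S"
    unfolding I_eq_ent[OF finP] mY2 tau cent_kernel[OF finP J2] S_def ..
  moreover have "I_cond P X1 Y1 W = HW - e"
    using law_I_cond[OF finW, of q1 q2 pU1 h1 pU2 pX1W pX2] by (simp add: P_def HW_def e_def Q1W_def)
  moreover have "H P U1 = ent pU1" "H P U2 = ent pU2" "H_cond P U1 V1 = ent pU1 - ent (map_pmf h1 pU1)"
    unfolding P_def by (simp_all add: law_H_U1 law_H_U2 law_H_cond finW)
  ultimately have a1: "0 < ent (bind_pmf pW Q1W) - e - ent pU1" and a2: "0 < ?\<tau> - S - ent pU2"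
    and a3: "0 < (HW - e - (ent pU1 - ent (map_pmf h1 pU1))) + (?\<tau> - S - ent pU2)"
    using r1 r2 r3 by auto
  define gB where "gB = HW - e - (ent pU1 - ent (map_pmf h1 pU1))"
  define g2 where "g2 = ?\<tau> - S - ent pU2"
  \<comment> \<open>\<open>gB\<close> may be negative, and then the hash must supply the missing
    rate: \<open>R\<close> has to exceed \<open>- gB\<close> and stay below \<open>g2\<close>. The
    midpoint of these two bounds is taken, clipped at 0; the third rate condition is what makes the
    interval nonempty.\<close>
  define R where "R = max 0 ((g2 - gB) / 2)"
  define m where "m = min (ent (bind_pmf pW Q1W) - e - ent pU1) (min (R + gB) (g2 - R))"
  \<comment> \<open>A quarter of the least margin leaves room for \<open>2 * \<delta>\<close> in
    test \<open>C\<close>, where rounding \<open>M\<close> costs a second share.\<close>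
  define \<delta> where "\<delta> = m / 4"
  have g: "g2 > 0" "gB + g2 > 0" using a2 a3 by (simp_all add: g2_def gB_def)
  have R: "R \<ge> 0" "R < g2" "R + gB > 0"
    using g by (auto simp: R_def max_def field_simps)
  have \<delta>: "\<delta> > 0" "\<delta> < ent (bind_pmf pW Q1W) - e - ent pU1" "\<delta> - R < gB" "2 * \<delta> + R < g2" "\<delta> < g2"
  proof -
    have "m > 0" "m \<le> ent (bind_pmf pW Q1W) - e - ent pU1" "m \<le> R + gB" "m \<le> g2 - R"
      using R a1 by (auto simp: m_def)
    then show "\<delta> > 0" "\<delta> < ent (bind_pmf pW Q1W) - e - ent pU1" "\<delta> - R < gB" "2 * \<delta> + R < g2" "\<delta> < g2"
      using R unfolding \<delta>_def by linarith+
  qed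

  have EK1: "expec P (\<lambda>l. log 2 (pmf (q1 (X1 l)) (Y1 l))) = - e"
    unfolding e_def by (rule expec_log_kernel[OF finP J1])
  have EK2: "expec P (\<lambda>l. log 2 (pmf (K2W (W l) (X2 l)) (Y2 l))) = - S"
    using expec_log_kernel[OF finP J2] by (simp add: S_def)
  have EQ1W: "expec P (\<lambda>l. log 2 (pmf (Q1W (W l)) (Y1 l))) = - HW"
    unfolding HW_def by (rule expec_log_kernel[OF finP J3])
  have EQ2W: "expec P (\<lambda>l. log 2 (pmf (Q2W (W l)) (Y2 l))) = - ?\<tau>"
    using expec_log_kernel[OF finP J4] by (simp add: tau)
  note EU1 = expec_log_marginal[OF mU1] and EU2 = expec_log_marginal[OF mU2] and EV1 = expec_log_marginal[OF mV1]
    and EY1 = expec_log_marginal[OF mY1] and EY2 = expec_log_marginal[OF mY2]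

  have pos: "pmf (q1 (X1 l)) (Y1 l) > 0" "pmf pU1 (U1 l) > 0" "pmf (bind_pmf pW Q1W) (Y1 l) > 0"
    "pmf (Q1W (W l)) (Y1 l) > 0" "pmf (map_pmf h1 pU1) (h1 (U1 l)) > 0" "pmf (K2W (W l) (X2 l)) (Y2 l) > 0"
    "pmf pU2 (U2 l) > 0" "pmf (bind_pmf pW Q2W) (Y2 l) > 0" "pmf (Q2W (W l)) (Y2 l) > 0"
    if "l \<in> set_pmf P" for l
    using supp[OF that] by (intro pmf_positive; simp add: Q1W_def K2W_def Q2W_def; blast)+
  let ?L = "\<lambda>n. PiN n (\<lambda>_. P)"
  \<comment> \<open>All four failure events compare products of two factors; where the output law
    stands alone, the constant 1 is the second factor.\<close>
  have lim: "(\<lambda>n. measure_pmf.prob (?L n) {l. (\<Prod>i<n. f (l i) * f' (l i)) \<le> 2 powr (n * c) * (\<Prod>i<n. g (l i) * g' (l i))}) \<longlonglongrightarrow> 0"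
    if "\<And>l. l \<in> set_pmf P \<Longrightarrow> f l > 0" "\<And>l. l \<in> set_pmf P \<Longrightarrow> f' l > 0"
      "\<And>l. l \<in> set_pmf P \<Longrightarrow> g l > 0" "\<And>l. l \<in> set_pmf P \<Longrightarrow> g' l > 0"
      "c < expec P (\<lambda>l. log 2 (f l)) + expec P (\<lambda>l. log 2 (f' l)) - (expec P (\<lambda>l. log 2 (g l)) + expec P (\<lambda>l. log 2 (g' l)))"
    for f f' g g' and c :: real
  proof (rule lln_ratio[OF finP])
    have "expec P (\<lambda>l. log 2 (f l * f' l) - log 2 (g l * g' l))
       = expec P (\<lambda>l. (log 2 (f l) + log 2 (f' l)) - (log 2 (g l) + log 2 (g' l)))"
      by (rule expec_cong) (use that in \<open>simp add: log_mult less_imp_neq[symmetric]\<close>)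
    also have "\<dots> = expec P (\<lambda>l. log 2 (f l)) + expec P (\<lambda>l. log 2 (f' l)) - (expec P (\<lambda>l. log 2 (g l)) + expec P (\<lambda>l. log 2 (g' l)))"
      using finP by (simp add: expec_diff expec_add)
    finally show "c < expec P (\<lambda>l. log 2 (f l * f' l) - log 2 (g l * g' l))" using that by simp
  qed (use that in auto)

  \<comment> \<open>Rounding up guarantees the full rate \<open>R\<close> for test \<open>B\<close>,
    and \<open>R \<ge> 0\<close> keeps the excess within a factor 2 for test
    \<open>C\<close>.\<close>
  define M where "M n = nat \<lceil>2 powr (real n * R)\<rceil>" for n
  have M0: "M n > 0" for n by (simp add: M_def)
  have Mge: "2 powr (real n * R) \<le> M n" for n
    unfolding M_def by (simp add: of_nat_nat)
  have Mle: "M n \<le> 2 * 2 powr (real n * R)" for n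
  proof -
    have "real (M n) \<le> 2 powr (real n * R) + 1" by (simp add: M_def)
    moreover have "1 \<le> 2 powr (real n * R)" using R by (simp add: ge_one_powr_ge_zero)
    ultimately show ?thesis by simp
  qed
  define t where "t n = 2 powr (real n * \<delta>)" for n
  define pA where "pA n = measure_pmf.prob (?L n) {l. (\<Prod>i<n. pmf (q1 (X1 (l i))) (Y1 (l i)) * pmf pU1 (U1 (l i)))
         \<le> 2 powr (n * \<delta>) * (\<Prod>i<n. pmf (bind_pmf pW Q1W) (Y1 (l i)) * 1)}" for n
  define pB where "pB n = measure_pmf.prob (?L n) {l. (\<Prod>i<n. pmf (q1 (X1 (l i))) (Y1 (l i)) * pmf pU1 (U1 (l i)))
         \<le> 2 powr (n * (\<delta> - R)) * (\<Prod>i<n. pmf (Q1W (W (l i))) (Y1 (l i)) * pmf (map_pmf h1 pU1) (h1 (U1 (l i))))}" for n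
  define pC where "pC n = measure_pmf.prob (?L n) {l. (\<Prod>i<n. pmf (K2W (W (l i)) (X2 (l i))) (Y2 (l i)) * pmf pU2 (U2 (l i)))
         \<le> 2 powr (n * (2 * \<delta> + R)) * (\<Prod>i<n. pmf (bind_pmf pW Q2W) (Y2 (l i)) * 1)}" for n
  define pD where "pD n = measure_pmf.prob (?L n) {l. (\<Prod>i<n. pmf (K2W (W (l i)) (X2 (l i))) (Y2 (l i)) * pmf pU2 (U2 (l i)))
         \<le> 2 powr (n * \<delta>) * (\<Prod>i<n. pmf (Q2W (W (l i))) (Y2 (l i)) * 1)}" for n
  have limA: "pA \<longlonglongrightarrow> 0"
    unfolding pA_def by (rule lim) (use pos \<delta> in \<open>simp_all add: EK1 EU1 EY1\<close>)
  have limB: "pB \<longlonglongrightarrow> 0"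
    unfolding pB_def by (rule lim) (use pos \<delta> in \<open>simp_all add: EK1 EU1 EQ1W EV1 gB_def\<close>)
  have limC: "pC \<longlonglongrightarrow> 0"
    unfolding pC_def by (rule lim) (use pos \<delta> in \<open>simp_all add: EK2 EU2 EY2 tau g2_def\<close>)
  have limD: "pD \<longlonglongrightarrow> 0"
    unfolding pD_def by (rule lim) (use pos \<delta> in \<open>simp_all add: EK2 EU2 EQ2W tau g2_def\<close>)

  \<comment> \<open>A code is chosen for every \<open>n\<close>, but the error bound is claimed only
    once \<open>2 powr (n * \<delta>)\<close> absorbs the factor 2 from rounding
    \<open>M n\<close>.\<close>
  have "\<forall>n. \<exists>c. (\<forall>us. length (fst c us) = n) \<and> (\<forall>us. length (fst (snd c) us) = n) \<and>
     (\<forall>ys. length (fst (snd (snd c)) ys) = n) \<and> (\<forall>ys vs. length (snd (snd (snd c)) ys vs) = n) \<and>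
     (n * \<delta> \<ge> 1 \<longrightarrow> error_prob n ch pU1 h1 pU2 (fst c) (fst (snd c)) (fst (snd (snd c))) (snd (snd (snd c)))
       \<le> 4 / t n + pA n + pB n + pC n + pD n)"
  proof
    fix n
    have t0: "t n > 0" by (simp add: t_def)
    obtain F1 F2 G1 G2 where len: "\<forall>us. length (F1 us) = n" "\<forall>us. length (F2 us) = n"
       "\<forall>ys. length (G1 ys) = n" "\<forall>ys vs. length (G2 ys vs) = n"
      and err: "error_prob n ch pU1 h1 pU2 F1 F2 G1 G2 \<le> 4 / t n
     + measure_pmf.prob (?L n) {l. (\<Prod>i<n. pmf (q1 (X1 (l i))) (Y1 (l i)) * pmf pU1 (U1 (l i)))
         \<le> t n * (\<Prod>i<n. pmf (bind_pmf pW Q1W) (Y1 (l i)))}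
     + measure_pmf.prob (?L n) {l. M n * (\<Prod>i<n. pmf (q1 (X1 (l i))) (Y1 (l i)) * pmf pU1 (U1 (l i)))
         \<le> t n * (\<Prod>i<n. pmf (Q1W (W (l i))) (Y1 (l i)) * pmf (map_pmf h1 pU1) (h1 (U1 (l i))))}
     + measure_pmf.prob (?L n) {l. (\<Prod>i<n. pmf (K2W (W (l i)) (X2 (l i))) (Y2 (l i)) * pmf pU2 (U2 (l i)))
         \<le> t n * M n * (\<Prod>i<n. pmf (bind_pmf pW Q2W) (Y2 (l i)))}
     + measure_pmf.prob (?L n) {l. (\<Prod>i<n. pmf (K2W (W (l i)) (X2 (l i))) (Y2 (l i)) * pmf pU2 (U2 (l i)))
         \<le> t n * (\<Prod>i<n. pmf (Q2W (W (l i))) (Y2 (l i)))}"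
      using coding_block[where n = n and ch = ch and ?q1.0 = q1 and ?q2.0 = q2 and M = "M n" and t = "t n" and ?pU1.0 = pU1 and ?pU2.0 = pU2 and ?h1.0 = h1
          and pX1W = pX1W and ?pX2.0 = pX2, OF ch finW M0 t0]
      by (elim exE conjE) (rule that; (assumption | simp only: Q1W_def K2W_def Q2W_def P_def))
    note err
    also have "measure_pmf.prob (?L n) {l. (\<Prod>i<n. pmf (q1 (X1 (l i))) (Y1 (l i)) * pmf pU1 (U1 (l i)))
         \<le> t n * (\<Prod>i<n. pmf (bind_pmf pW Q1W) (Y1 (l i)))} = pA n"
      by (simp add: pA_def t_def)
    also have "measure_pmf.prob (?L n) {l. M n * (\<Prod>i<n. pmf (q1 (X1 (l i))) (Y1 (l i)) * pmf pU1 (U1 (l i)))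
         \<le> t n * (\<Prod>i<n. pmf (Q1W (W (l i))) (Y1 (l i)) * pmf (map_pmf h1 pU1) (h1 (U1 (l i))))} \<le> pB n"
      unfolding pB_def
    proof (rule measure_pmf.finite_measure_mono, clarify)
      fix l :: "nat \<Rightarrow> ('u1, 'v1, 'u2, nat, 'x1, 'x2, 'y1, 'y2) letter"
      let ?f = "\<Prod>i<n. pmf (q1 (X1 (l i))) (Y1 (l i)) * pmf pU1 (U1 (l i))"
      let ?g = "\<Prod>i<n. pmf (Q1W (W (l i))) (Y1 (l i)) * pmf (map_pmf h1 pU1) (h1 (U1 (l i)))"
      assume a: "M n * ?f \<le> t n * ?g"
      have "2 powr (n * R) * ?f \<le> M n * ?f"
        by (rule mult_right_mono[OF Mge]) (auto intro!: prod_nonneg)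
      also note a
      also have "t n * ?g = 2 powr (n * R) * (2 powr (n * (\<delta> - R)) * ?g)"
        by (simp add: t_def powr_add[symmetric] algebra_simps mult.assoc[symmetric] del: mult.assoc)
      finally show "?f \<le> 2 powr (n * (\<delta> - R)) * ?g" by simp
    qed simp
    also have "measure_pmf.prob (?L n) {l. (\<Prod>i<n. pmf (K2W (W (l i)) (X2 (l i))) (Y2 (l i)) * pmf pU2 (U2 (l i)))
         \<le> t n * (\<Prod>i<n. pmf (Q2W (W (l i))) (Y2 (l i)))} = pD n"
      by (simp add: pD_def t_def)
    finally have err': "error_prob n ch pU1 h1 pU2 F1 F2 G1 G2 \<le> 4 / t n + pA n + pB n
     + measure_pmf.prob (?L n) {l. (\<Prod>i<n. pmf (K2W (W (l i)) (X2 (l i))) (Y2 (l i)) * pmf pU2 (U2 (l i)))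
         \<le> t n * M n * (\<Prod>i<n. pmf (bind_pmf pW Q2W) (Y2 (l i)))} + pD n"
      by simp
    have "measure_pmf.prob (?L n) {l. (\<Prod>i<n. pmf (K2W (W (l i)) (X2 (l i))) (Y2 (l i)) * pmf pU2 (U2 (l i)))
         \<le> t n * M n * (\<Prod>i<n. pmf (bind_pmf pW Q2W) (Y2 (l i)))} \<le> pC n" if n: "n * \<delta> \<ge> 1"
      unfolding pC_def
    proof (rule measure_pmf.finite_measure_mono, clarify)
      fix l :: "nat \<Rightarrow> ('u1, 'v1, 'u2, nat, 'x1, 'x2, 'y1, 'y2) letter"
      let ?f = "\<Prod>i<n. pmf (K2W (W (l i)) (X2 (l i))) (Y2 (l i)) * pmf pU2 (U2 (l i))"
      let ?g = "\<Prod>i<n. pmf (bind_pmf pW Q2W) (Y2 (l i))"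
      assume "?f \<le> t n * M n * ?g"
      also have "t n * M n \<le> t n * (2 * 2 powr (n * R))"
        by (rule mult_left_mono[OF Mle]) (use t0 in simp)
      also have "\<dots> = 2 powr (1 + n * \<delta> + n * R)" by (simp add: t_def powr_add)
      also have "\<dots> \<le> 2 powr (n * (2 * \<delta> + R))"
        using n by (intro powr_mono) (auto simp: algebra_simps)
      finally show "?f \<le> 2 powr (n * (2 * \<delta> + R)) * (\<Prod>i<n. pmf (bind_pmf pW Q2W) (Y2 (l i)) * 1)"
        by (simp add: prod_nonneg mult_right_mono)
    qed simp
    with err' len show "\<exists>c. (\<forall>us. length (fst c us) = n) \<and> (\<forall>us. length (fst (snd c) us) = n) \<and>
     (\<forall>ys. length (fst (snd (snd c)) ys) = n) \<and> (\<forall>ys vs. length (snd (snd (snd c)) ys vs) = n) \<and>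
     (n * \<delta> \<ge> 1 \<longrightarrow> error_prob n ch pU1 h1 pU2 (fst c) (fst (snd c)) (fst (snd (snd c))) (snd (snd (snd c)))
       \<le> 4 / t n + pA n + pB n + pC n + pD n)"
      by (intro exI[of _ "(F1, F2, G1, G2)"]) auto
  qed
  from choice[OF this] obtain c where c: "\<And>n us. length (fst (c n) us) = n" "\<And>n us. length (fst (snd (c n)) us) = n"
     "\<And>n ys. length (fst (snd (snd (c n))) ys) = n" "\<And>n ys vs. length (snd (snd (snd (c n))) ys vs) = n"
     "\<And>n. n * \<delta> \<ge> 1 \<Longrightarrow> error_prob n ch pU1 h1 pU2 (fst (c n)) (fst (snd (c n))) (fst (snd (snd (c n)))) (snd (snd (snd (c n))))
       \<le> 4 / t n + pA n + pB n + pC n + pD n"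
    by blast
  have "(\<lambda>n. error_prob n ch pU1 h1 pU2 (fst (c n)) (fst (snd (c n))) (fst (snd (snd (c n)))) (snd (snd (snd (c n))))) \<longlonglongrightarrow> 0"
  proof (rule tendsto_sandwich[OF _ _ tendsto_const])
    have "norm (2 powr - \<delta> :: real) < 1"
      using \<delta>(1) powr_less_mono[of "- \<delta>" 0 "2 :: real"] by simp
    then have "(\<lambda>n. (2 powr - \<delta> :: real) ^ n) \<longlonglongrightarrow> 0"
      by (rule LIMSEQ_power_zero)
    then have "(\<lambda>n. 4 * (2 powr - \<delta> :: real) ^ n) \<longlonglongrightarrow> 4 * 0" by (rule tendsto_mult[OF tendsto_const])
    also have "(\<lambda>n. 4 * (2 powr - \<delta> :: real) ^ n) = (\<lambda>n. 4 / t n)"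
      by (simp add: t_def powr_minus_divide powr_power power_divide mult.commute)
    finally have "(\<lambda>n. 4 / t n) \<longlonglongrightarrow> 0" by simp
    then have "(\<lambda>n. 4 / t n + pA n + pB n + pC n + pD n) \<longlonglongrightarrow> 0 + 0 + 0 + 0 + 0"
      by (intro tendsto_intros limA limB limC limD)
    then show "(\<lambda>n. 4 / t n + pA n + pB n + pC n + pD n) \<longlonglongrightarrow> 0" by simp
    have "\<forall>\<^sub>F n in sequentially. n \<ge> nat \<lceil>1 / \<delta>\<rceil>" by (rule eventually_ge_at_top)
    then show "\<forall>\<^sub>F n in sequentially. error_prob n ch pU1 h1 pU2 (fst (c n)) (fst (snd (c n))) (fst (snd (snd (c n)))) (snd (snd (snd (c n))))
       \<le> 4 / t n + pA n + pB n + pC n + pD n"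
    proof eventually_elim
      case (elim n)
      then have "1 / \<delta> \<le> n" by linarith
      then show ?case using \<delta>(1) by (intro c) (simp add: field_simps)
    qed
  qed (simp add: error_prob_def)
  then show ?thesis
    unfolding reliable_transmission_def
    by (intro exI[of _ "\<lambda>n. fst (c n)"] exI[of _ "\<lambda>n. fst (snd (c n))"] exI[of _ "\<lambda>n. fst (snd (snd (c n)))"] exI[of _ "\<lambda>n. snd (snd (snd (c n)))"])
       (auto simp: c)
qed

theorem corollary2:
  fixes ch :: "'x1::finite \<Rightarrow> 'x2::finite \<Rightarrow> ('y1::finite \<times> 'y2::finite) pmf"
    and q1 :: "'x1 \<Rightarrow> 'y1 pmf" and q2 :: "'x1 \<Rightarrow> 'x2 \<Rightarrow> 'y2 pmf"
    and pstar :: "'x2 pmf"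
    and pU1 :: "'u1::finite pmf" and pU2 :: "'u2::finite pmf"
    and h1 :: "'u1 \<Rightarrow> 'v1::finite"
  assumes z_channel: "\<And>x1 x2. ch x1 x2 = pair_pmf (q1 x1) (q2 x1 x2)"
    and cond1: "condition1 q2"
    and cond2: "condition2_witness q2 pstar"
  shows
    "((\<exists>(pW :: nat pmf) (pX1W :: nat \<Rightarrow> 'x1 pmf). finite (set_pmf pW) \<and>
        (let P = single_letter_law q1 q2 pU1 h1 pU2 pW pX1W pstar in
           H P U1 < I P X1 Y1 \<and>
           H P U2 < I P (\<lambda>l. (W l, X2 l)) Y2 \<and>
           H_cond P U1 V1 + H P U2 < I P (\<lambda>l. (W l, X2 l)) Y2 + I_cond P X1 Y1 W))
      \<longrightarrow> reliable_transmission ch pU1 h1 pU2)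
     \<and>
     (reliable_transmission ch pU1 h1 pU2 \<longrightarrow>
      (\<exists>(pW :: nat pmf) (pX1W :: nat \<Rightarrow> 'x1 pmf). finite (set_pmf pW) \<and>
        (let P = single_letter_law q1 q2 pU1 h1 pU2 pW pX1W pstar in
           H P U1 \<le> I P X1 Y1 \<and>
           H P U2 \<le> I P (\<lambda>l. (W l, X2 l)) Y2 \<and>
           H_cond P U1 V1 + H P U2 \<le> I P (\<lambda>l. (W l, X2 l)) Y2 + I_cond P X1 Y1 W)))"
proof (intro conjI impI)
  assume "\<exists>(pW :: nat pmf) (pX1W :: nat \<Rightarrow> 'x1 pmf). finite (set_pmf pW) \<and>
        (let P = single_letter_law q1 q2 pU1 h1 pU2 pW pX1W pstar in
           H P U1 < I P X1 Y1 \<and>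
           H P U2 < I P (\<lambda>l. (W l, X2 l)) Y2 \<and>
           H_cond P U1 V1 + H P U2 < I P (\<lambda>l. (W l, X2 l)) Y2 + I_cond P X1 Y1 W)"
  then show "reliable_transmission ch pU1 h1 pU2"
    unfolding Let_def by (elim exE conjE) (rule achievability[OF z_channel _ cond2])
next
  assume "reliable_transmission ch pU1 h1 pU2"
  from converse[OF z_channel cond1 this, where ?x0.0 = undefined]
  obtain pW :: "nat pmf" and k where fin: "finite (set_pmf pW)" and
    "ent pU1 \<le> ent (bind_pmf (bind_pmf pW k) q1) - expec (bind_pmf pW k) (\<lambda>x. ent (q1 x)) \<and>
     ent pU2 \<le> max_output_entropy q2 - expec pW (\<lambda>w. ent (bind_pmf (k w) (\<lambda>x. q2 x undefined))) \<and>
     ent pU1 - ent (map_pmf h1 pU1) + ent pU2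
        \<le> max_output_entropy q2 - expec pW (\<lambda>w. ent (bind_pmf (k w) (\<lambda>x. q2 x undefined)))
          + expec pW (\<lambda>w. ent (bind_pmf (k w) q1)) - expec (bind_pmf pW k) (\<lambda>x. ent (q1 x))"
    by (elim exE conjE) (rule that, simp_all)
  then show "\<exists>(pW :: nat pmf) (pX1W :: nat \<Rightarrow> 'x1 pmf). finite (set_pmf pW) \<and>
        (let P = single_letter_law q1 q2 pU1 h1 pU2 pW pX1W pstar in
           H P U1 \<le> I P X1 Y1 \<and>
           H P U2 \<le> I P (\<lambda>l. (W l, X2 l)) Y2 \<and>
           H_cond P U1 V1 + H P U2 \<le> I P (\<lambda>l. (W l, X2 l)) Y2 + I_cond P X1 Y1 W)"
    by (intro exI[of _ pW] exI[of _ k])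
       (simp add: Let_def law_H_U1 law_H_U2 law_H_cond law_I1 law_I_cond
         law_I2_conditions[OF _ cond1 cond2, where ?x0.0 = undefined])
qed

end
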